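(* Let $\alpha\in[1,2)$. The systems $$\mathbf{\Phi}_\alpha=\{\check\chi_\iota*\phi^{\alpha,\iota}_{j,l,k}\ :\ (j,l,k,\iota)\in\Delta\}\ \cup\ \{\check\chi_0*\phi^0_k\ :\ k\in\mathbb{Z}^2\},$$ $$\mathbf{\Phi}^d_\alpha=\{\check\gamma_\iota*\phi^{\alpha,\iota}_{j,l,k}\ :\ (j,l,k,\iota)\in\Delta\}\ \cup\ \{\check\gamma_0*\phi^0_k\ :\ k\in\mathbb{Z}^2\}$$ form a pair of dual frames for $L^2(\mathbb{R}^2)$. Consequently, $\mathbf{\Phi}^d_\alpha\in\mathbb{D}_{\mathbf{\Phi}_\alpha}$.
   Context: Fourier transform: $\hat f(\xi)=\int_{\mathbb{R}^2}f(x)e^{-2\pi i x^T\xi}dx$, extended to $L^2(\mathbb{R}^2)$; $\check{F}$ is the inverse Fourier transform. $\check\chi*\phi$ is the function with Fourier transform $\chi\hat\phi$. Frames: a frame for a Hilbert space $\mathcal{H}$ is a countable family $\{\phi_i\}$ for which there are $0<A\le B<\infty$ with $A\|f\|_2^2\le\sum_i|\langle f,\phi_i\rangle|^2\le B\|f\|_2^2$ for all $f\in\mathcal{H}$. Two frames $\{\phi_i\}$, $\{\phi_i^d\}$ (same index set) form a pair of dual frames if $f=\sum_i\langle f,\phi_i^d\rangle\phi_i$ and $f=\sum_i\langle f,\phi_i\rangle\phi_i^d$ for all $f\in\mathcal{H}$. $\mathbb{D}_\Phi$ is the set of sequences $\{\phi_i^d\}\subset\mathcal{H}$ with $f=\sum_i\langle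 f,\phi_i\rangle\phi_i^d$ for all $f\in\mathcal{H}$. Windows: let $\Xi$ be a Schwartz function on $\mathbb{R}$ with $\operatorname{supp}\hat\Xi\subset[-\frac1{16},\frac1{16}]$, $0\le\hat\Xi\le1$, $\hat\Xi=1$ on $[-\frac1{32},\frac1{32}]$. Set $\hat\Omega(\xi)=\hat\Xi(\xi_1)\hat\Xi(\xi_2)$, $W(\xi)=\sqrt{\hat\Omega^2(2^{-2}\xi)-\hat\Omega^2(\xi)}$, $W_j(\xi)=W(2^{-2j}\xi)$. Then $\hat\Omega^2+\sum_{j\ge0}W_j^2=1$. Shearlets: $A_{\alpha,\mathrm h}=\begin{bmatrix}2^2&0\\0&2^\alpha\end{bmatrix}$, $S_{\mathrm h}=\begin{bmatrix}1&1\\0&1\end{bmatrix}$, $A_{\alpha,\mathrm v}=\begin{bmatrix}2^\alpha&0\\0&2^2\end{bmatrix}$, $S_{\mathrm v}=\begin{bmatrix}1&0\\1&1\end{bmatrix}$. Let $v\in C^\infty(\mathbb{R})$ with $\operatorname{supp}v\subset[-\frac32,\frac32]$ and $\sum_{l=-2}^2|v(\omega-l)|^2=1$ for $\omega\in[-\frac32,\frac32]$. Put $V_{\mathrm h}(\xi)=v(\xi_2/\xi_1)$, $V_{\mathrm v}(\xi)=v(\xi_1/\xi_2)$. The index set is $$\Delta=\{(j,l,k,\iota):\ j\ge0,\ l\in\mathbb{Z},\ |l|\le\lceil2\cdot2^{(2-\alpha)j}\rceil,\ k\in\mathbb{Z}^2,\ \iota\in\{\mathrm h,\mathrm v\}\},$$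 and for $(j,l,k,\iota)\in\Delta$ $$\hat\phi^{\alpha,\iota}_{j,l,k}(\xi)=2^{-(2+\alpha)j/2}\,W_j(\xi)\,V_\iota(\xi^TA_{\alpha,\iota}^{-j}S_\iota^{-l})\,e^{2\pi i\xi^TA_{\alpha,\iota}^{-j}S_\iota^{-l}k}.$$ Cones: $\mathcal{C}_{\mathrm h}=\{|\xi_1|\ge\frac18,\ |\xi_2/\xi_1|\le\frac32\}$, $\mathcal{C}_{\mathrm v}=\{|\xi_2|\ge\frac18,\ |\xi_1/\xi_2|\le\frac32\}$, $\mathcal{C}_0=\{|\xi_1|,|\xi_2|\le1\}$; $\mathcal{C}^*_{\mathrm h}=\{\frac1{32}\le|\xi_1|\le\frac14,\ |\xi_2/\xi_1|\le\frac32\}$, $\mathcal{C}^*_{\mathrm v}=\{\frac1{32}\le|\xi_2|\le\frac14,\ |\xi_1/\xi_2|\le\frac32\}$ (subsets of $\mathbb{R}^2$). $\{\phi^0_k\}_{k\in\mathbb{Z}^2}$ is a Parseval frame for $L^2(\mathcal{C}_0)^\vee=\{f\in L^2(\mathbb{R}^2):\operatorname{supp}\hat f\subset\mathcal{C}_0\}$. Cut-offs: $\chi_\iota,\gamma_\iota\in C^\infty(\mathbb{R}^2)$, $\iota\in\{0,\mathrm h,\mathrm v\}$, are fixed real-valued functions such that (i) $\operatorname{supp}\chi_\iota,\operatorname{supp}\gamma_\iota\subset\mathcal{C}_\iota$ and $\sum_{\iota\in\{0,\mathrm h,\mathrm v\}}\chi_\iota(\xi)\gamma_\iota(\xi)=1$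 for all $\xi\in\mathbb{R}^2$; (ii) for $\iota\in\{\mathrm h,\mathrm v\}$ and every $N$, the functions $\xi\mapsto\chi_\iota(\xi^TS_\iota^lA_{\alpha,\iota}^j)$ and $\xi\mapsto\gamma_\iota(\xi^TS_\iota^lA_{\alpha,\iota}^j)$ ($j\ge0$, $|l|\le\lceil2\cdot2^{(2-\alpha)j}\rceil$) have $C^N(\mathcal{C}^*_\iota)$-norms bounded by a constant $C_N$ independent of $j$ (and $l$). *)

theory Defs
  imports "HOL-Analysis.Analysis"
begin

subsection \<open>Square-integrable functions\<close>

text \<open>
  Elements of \<open>L\<^sup>2\<close> are represented by Borel functions. Equality in \<open>L\<^sup>2\<close> is equality almost
  everywhere; below, identities in \<open>L\<^sup>2\<close> are only expressed as limits with respect to the norm.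
\<close>

definition L2 :: "('a::euclidean_space \<Rightarrow> complex) set" where
  "L2 = {f \<in> borel_measurable lborel. integrable lborel (\<lambda>x. (cmod (f x))\<^sup>2)}"

definition L2_norm :: "('a::euclidean_space \<Rightarrow> complex) \<Rightarrow> real" where
  "L2_norm f = sqrt (\<integral>x. (cmod (f x))\<^sup>2 \<partial>lborel)"

definition L2_inner ::
  "('a::euclidean_space \<Rightarrow> complex) \<Rightarrow> ('a \<Rightarrow> complex) \<Rightarrow> complex" where
  "L2_inner f g = (\<integral>x. f x * cnj (g x) \<partial>lborel)"

text \<open>
  Convergence in the \<open>L\<^sup>2\<close> norm. The integral of the squared distance is taken in the extended
  nonnegative reals, so that a non-integrable difference counts as infinitely large.
\<close>

definition L2_tendsto ::
  "('b \<Rightarrow> 'a::euclidean_space \<Rightarrow> complex) \<Rightarrow> ('a \<Rightarrow> complex) \<Rightarrow> 'b filter \<Rightarrow> bool" where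
  "L2_tendsto g f F \<longleftrightarrow>
     ((\<lambda>n. \<integral>\<^sup>+x. ennreal ((cmod (g n x - f x))\<^sup>2) \<partial>lborel) \<longlongrightarrow> 0) F"

text \<open>Unconditional convergence of the series \<open>\<Sum>i\<in>I. c i \<phi> i\<close> to \<open>f\<close> in \<open>L\<^sup>2\<close>.\<close>

definition L2_has_sum ::
  "('i \<Rightarrow> complex) \<Rightarrow> ('i \<Rightarrow> 'a::euclidean_space \<Rightarrow> complex) \<Rightarrow> 'i set \<Rightarrow> ('a \<Rightarrow> complex) \<Rightarrow> bool"
  where
  "L2_has_sum c \<phi> I f \<longleftrightarrow>
     L2_tendsto (\<lambda>J x. \<Sum>i\<in>J. c i * \<phi> i x) f (finite_subsets_at_top I)"

subsection \<open>Fourier transform\<close>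

definition fourier :: "('a::euclidean_space \<Rightarrow> complex) \<Rightarrow> 'a \<Rightarrow> complex" where
  "fourier f \<xi> = (\<integral>x. f x * cis (- 2 * pi * (x \<bullet> \<xi>)) \<partial>lborel)"

text \<open>Extension by continuity from \<open>L\<^sup>1 \<inter> L\<^sup>2\<close> to \<open>L\<^sup>2\<close>.\<close>

definition has_fourier_L2 ::
  "('a::euclidean_space \<Rightarrow> complex) \<Rightarrow> ('a \<Rightarrow> complex) \<Rightarrow> bool" where
  "has_fourier_L2 f F \<longleftrightarrow> f \<in> L2 \<and> F \<in> L2 \<and>
     (\<exists>g :: nat \<Rightarrow> 'a \<Rightarrow> complex. (\<forall>n. integrable lborel (g n) \<and> g n \<in> L2) \<and>
        L2_tendsto g f sequentially \<and> L2_tendsto (\<lambda>n. fourier (g n)) F sequentially)"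

text \<open>
  By Plancherel's theorem the two choices below exist for arguments in \<open>L\<^sup>2\<close> and are unique up to
  null sets.
\<close>

definition fourier_L2 :: "('a::euclidean_space \<Rightarrow> complex) \<Rightarrow> 'a \<Rightarrow> complex" where
  "fourier_L2 f = (SOME F. has_fourier_L2 f F)"

definition inv_fourier_L2 :: "('a::euclidean_space \<Rightarrow> complex) \<Rightarrow> 'a \<Rightarrow> complex" where
  "inv_fourier_L2 F = (SOME f. has_fourier_L2 f F)"

text \<open>\<open>fourier_filter m \<phi>\<close> is the convolution of \<open>\<phi>\<close> with the inverse Fourier transform of \<open>m\<close>.\<close>

definition fourier_filter ::
  "('a::euclidean_space \<Rightarrow> real) \<Rightarrow> ('a \<Rightarrow> complex) \<Rightarrow> 'a \<Rightarrow> complex" where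
  "fourier_filter m \<phi> = inv_fourier_L2 (\<lambda>\<xi>. complex_of_real (m \<xi>) * fourier_L2 \<phi> \<xi>)"

text \<open>
  \<open>L\<^sup>2(C)\<^sup>\<or>\<close>: for an element of \<open>L\<^sup>2\<close> the support is the essential support, and for closed \<open>C\<close>
  it lies in \<open>C\<close> iff the function vanishes almost everywhere outside \<open>C\<close>.
\<close>

definition L2_band :: "'a::euclidean_space set \<Rightarrow> ('a \<Rightarrow> complex) set" where
  "L2_band C = {f \<in> L2. AE \<xi> in lborel. \<xi> \<notin> C \<longrightarrow> fourier_L2 f \<xi> = 0}"

subsection \<open>Frames\<close>

definition frame_with_bounds ::
  "real \<Rightarrow> real \<Rightarrow> 'i set \<Rightarrow> ('a::euclidean_space \<Rightarrow> complex) set \<Rightarrow> ('i \<Rightarrow> 'a \<Rightarrow> complex) \<Rightarrow> bool"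
  where
  "frame_with_bounds A B I H \<phi> \<longleftrightarrow>
     0 < A \<and> A \<le> B \<and> countable I \<and> (\<forall>i\<in>I. \<phi> i \<in> H) \<and>
     (\<forall>f\<in>H. (\<lambda>i. (cmod (L2_inner f (\<phi> i)))\<^sup>2) summable_on I \<and>
        A * (L2_norm f)\<^sup>2 \<le> (\<Sum>\<^sub>\<infinity>i\<in>I. (cmod (L2_inner f (\<phi> i)))\<^sup>2) \<and>
        (\<Sum>\<^sub>\<infinity>i\<in>I. (cmod (L2_inner f (\<phi> i)))\<^sup>2) \<le> B * (L2_norm f)\<^sup>2)"

definition frame ::
  "'i set \<Rightarrow> ('a::euclidean_space \<Rightarrow> complex) set \<Rightarrow> ('i \<Rightarrow> 'a \<Rightarrow> complex) \<Rightarrow> bool" where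
  "frame I H \<phi> \<longleftrightarrow> (\<exists>A B. frame_with_bounds A B I H \<phi>)"

definition parseval_frame ::
  "'i set \<Rightarrow> ('a::euclidean_space \<Rightarrow> complex) set \<Rightarrow> ('i \<Rightarrow> 'a \<Rightarrow> complex) \<Rightarrow> bool" where
  "parseval_frame I H \<phi> \<longleftrightarrow> frame_with_bounds 1 1 I H \<phi>"

definition dual_frame_pair ::
  "'i set \<Rightarrow> ('a::euclidean_space \<Rightarrow> complex) set \<Rightarrow>
     ('i \<Rightarrow> 'a \<Rightarrow> complex) \<Rightarrow> ('i \<Rightarrow> 'a \<Rightarrow> complex) \<Rightarrow> bool" where
  "dual_frame_pair I H \<phi> \<psi> \<longleftrightarrow> frame I H \<phi> \<and> frame I H \<psi> \<and>
     (\<forall>f\<in>H. L2_has_sum (\<lambda>i. L2_inner f (\<psi> i)) \<phi> I f \<and>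
             L2_has_sum (\<lambda>i. L2_inner f (\<phi> i)) \<psi> I f)"

text \<open>The set \<open>\<bbbD>\<^sub>\<Phi>\<close> of sequences reconstructing from the coefficients with respect to \<open>\<phi>\<close>.\<close>

definition reconstructing ::
  "'i set \<Rightarrow> ('a::euclidean_space \<Rightarrow> complex) set \<Rightarrow> ('i \<Rightarrow> 'a \<Rightarrow> complex) \<Rightarrow>
     ('i \<Rightarrow> 'a \<Rightarrow> complex) set" where
  "reconstructing I H \<phi> =
     {\<psi>. (\<forall>i\<in>I. \<psi> i \<in> H) \<and> (\<forall>f\<in>H. L2_has_sum (\<lambda>i. L2_inner f (\<phi> i)) \<psi> I f)}"

subsection \<open>Smooth functions\<close>

definition fsupp :: "('a::topological_space \<Rightarrow> 'b::zero) \<Rightarrow> 'a set" where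
  "fsupp f = closure {x. f x \<noteq> 0}"

definition vderiv :: "(real \<Rightarrow> complex) \<Rightarrow> real \<Rightarrow> complex" where
  "vderiv f x = vector_derivative f (at x)"

definition smooth_real_line :: "(real \<Rightarrow> complex) \<Rightarrow> bool" where
  "smooth_real_line f \<longleftrightarrow> (\<forall>n x. (vderiv ^^ n) f differentiable at x)"

definition schwartz :: "(real \<Rightarrow> complex) \<Rightarrow> bool" where
  "schwartz f \<longleftrightarrow> smooth_real_line f \<and>
     (\<forall>m n. \<exists>C. \<forall>x. \<bar>x\<bar> ^ m * cmod ((vderiv ^^ n) f x) \<le> C)"

definition partial :: "'n::finite \<Rightarrow> (real^'n \<Rightarrow> real) \<Rightarrow> real^'n \<Rightarrow> real" where
  "partial i f x = deriv (\<lambda>t. f (x + t *\<^sub>R axis i 1)) 0"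

text \<open>
  The list of directions plays the role of a multi-index; its length is the order of the
  derivative.
\<close>

primrec partials :: "'n::finite list \<Rightarrow> (real^'n \<Rightarrow> real) \<Rightarrow> real^'n \<Rightarrow> real" where
  "partials [] f = f"
| "partials (i # ds) f = partial i (partials ds f)"

definition smooth :: "(real^'n::finite \<Rightarrow> real) \<Rightarrow> bool" where
  "smooth f \<longleftrightarrow> (\<forall>ds. continuous_on UNIV (partials ds f) \<and>
     (\<forall>i x. (\<lambda>t. partials ds f (x + t *\<^sub>R axis i 1)) differentiable at 0))"

text \<open>The supremum is extended-real, so the norm is \<open>\<infinity>\<close> if a derivative is unbounded on \<open>K\<close>.\<close>

definition CN_norm :: "nat \<Rightarrow> (real^'n::finite) set \<Rightarrow> (real^'n \<Rightarrow> real) \<Rightarrow> ereal" where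
  "CN_norm N K f = (SUP (ds, x) \<in> {ds. length ds \<le> N} \<times> K. ereal \<bar>partials ds f x\<bar>)"

subsection \<open>Windows\<close>

definition radial_generator :: "(real \<Rightarrow> complex) \<Rightarrow> bool" where
  "radial_generator \<Xi> \<longleftrightarrow> schwartz \<Xi> \<and>
     fsupp (fourier \<Xi>) \<subseteq> {-1/16..1/16} \<and>
     (\<forall>t. fourier \<Xi> t \<in> complex_of_real ` {0..1}) \<and>
     (\<forall>t\<in>{-1/32..1/32}. fourier \<Xi> t = 1)"

definition Omega_hat :: "(real \<Rightarrow> complex) \<Rightarrow> real^2 \<Rightarrow> complex" where
  "Omega_hat \<Xi> \<xi> = fourier \<Xi> (\<xi> $ 1) * fourier \<Xi> (\<xi> $ 2)"

text \<open>For a radial generator, \<open>Omega_hat \<Xi>\<close> is real-valued, so taking real parts is harmless.\<close>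

definition W :: "(real \<Rightarrow> complex) \<Rightarrow> real^2 \<Rightarrow> real" where
  "W \<Xi> \<xi> = sqrt (Re ((Omega_hat \<Xi> ((1/4) *\<^sub>R \<xi>))\<^sup>2 - (Omega_hat \<Xi> \<xi>)\<^sup>2))"

definition Wj :: "(real \<Rightarrow> complex) \<Rightarrow> nat \<Rightarrow> real^2 \<Rightarrow> real" where
  "Wj \<Xi> j \<xi> = W \<Xi> ((1 / 2 ^ (2 * j)) *\<^sub>R \<xi>)"

definition directional_window :: "(real \<Rightarrow> complex) \<Rightarrow> bool" where
  "directional_window v \<longleftrightarrow> smooth_real_line v \<and> fsupp v \<subseteq> {-3/2..3/2} \<and>
     (\<forall>\<omega>\<in>{-3/2..3/2}. (\<Sum>l\<in>{-2..2::int}. (cmod (v (\<omega> - of_int l)))\<^sup>2) = 1)"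

subsection \<open>Shearlets\<close>

datatype dir = Hor | Ver

datatype region = Low | Cone dir

fun scaling :: "real \<Rightarrow> dir \<Rightarrow> real^2^2" where
  "scaling \<alpha> Hor = vector [vector [2\<^sup>2, 0], vector [0, 2 powr \<alpha>]]"
| "scaling \<alpha> Ver = vector [vector [2 powr \<alpha>, 0], vector [0, 2\<^sup>2]]"

fun shear :: "dir \<Rightarrow> real^2^2" where
  "shear Hor = vector [vector [1, 1], vector [0, 1]]"
| "shear Ver = vector [vector [1, 0], vector [1, 1]]"

text \<open>
  Integer powers for the matrix product; the operator \<open>^\<close> on vector types is componentwise.
\<close>

definition mat_zpow :: "real^'n^'n \<Rightarrow> int \<Rightarrow> real^'n^'n" where
  "mat_zpow M z =
     (if 0 \<le> z then (((**) M) ^^ nat z) (mat 1)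
      else (((**) (matrix_inv M)) ^^ nat (- z)) (mat 1))"

text \<open>The denominators vanish only on a null set, so the value there is immaterial.\<close>

fun V :: "(real \<Rightarrow> complex) \<Rightarrow> dir \<Rightarrow> real^2 \<Rightarrow> complex" where
  "V v Hor \<xi> = v (\<xi> $ 2 / \<xi> $ 1)"
| "V v Ver \<xi> = v (\<xi> $ 1 / \<xi> $ 2)"

definition max_shear :: "real \<Rightarrow> nat \<Rightarrow> int" where
  "max_shear \<alpha> j = \<lceil>2 * 2 powr ((2 - \<alpha>) * real j)\<rceil>"

definition \<Delta> :: "real \<Rightarrow> (nat \<times> int \<times> (int^2) \<times> dir) set" where
  "\<Delta> \<alpha> = {(j, l, k, \<iota>). \<bar>l\<bar> \<le> max_shear \<alpha> j}"

definition shearlet_hat ::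
  "real \<Rightarrow> (real \<Rightarrow> complex) \<Rightarrow> (real \<Rightarrow> complex) \<Rightarrow> dir \<Rightarrow> nat \<Rightarrow> int \<Rightarrow> int^2 \<Rightarrow> real^2 \<Rightarrow> complex"
  where
  "shearlet_hat \<alpha> \<Xi> v \<iota> j l k \<xi> =
     (let \<eta> = \<xi> v* (mat_zpow (scaling \<alpha> \<iota>) (- int j) ** mat_zpow (shear \<iota>) (- l))
      in complex_of_real (2 powr (- (2 + \<alpha>) * real j / 2)) * complex_of_real (Wj \<Xi> j \<xi>) *
         V v \<iota> \<eta> * cis (2 * pi * (\<eta> \<bullet> (\<chi> i. real_of_int (k $ i)))))"

definition shearlet ::
  "real \<Rightarrow> (real \<Rightarrow> complex) \<Rightarrow> (real \<Rightarrow> complex) \<Rightarrow> dir \<Rightarrow> nat \<Rightarrow> int \<Rightarrow> int^2 \<Rightarrow> real^2 \<Rightarrow> complex"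
  where
  "shearlet \<alpha> \<Xi> v \<iota> j l k = inv_fourier_L2 (shearlet_hat \<alpha> \<Xi> v \<iota> j l k)"

subsection \<open>Frequency regions and cut-offs\<close>

fun \<C> :: "region \<Rightarrow> (real^2) set" where
  "\<C> Low = {\<xi>. \<bar>\<xi> $ 1\<bar> \<le> 1 \<and> \<bar>\<xi> $ 2\<bar> \<le> 1}"
| "\<C> (Cone Hor) = {\<xi>. 1/8 \<le> \<bar>\<xi> $ 1\<bar> \<and> \<bar>\<xi> $ 2 / \<xi> $ 1\<bar> \<le> 3/2}"
| "\<C> (Cone Ver) = {\<xi>. 1/8 \<le> \<bar>\<xi> $ 2\<bar> \<and> \<bar>\<xi> $ 1 / \<xi> $ 2\<bar> \<le> 3/2}"

fun \<C>_star :: "dir \<Rightarrow> (real^2) set" where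
  "\<C>_star Hor = {\<xi>. 1/32 \<le> \<bar>\<xi> $ 1\<bar> \<and> \<bar>\<xi> $ 1\<bar> \<le> 1/4 \<and> \<bar>\<xi> $ 2 / \<xi> $ 1\<bar> \<le> 3/2}"
| "\<C>_star Ver = {\<xi>. 1/32 \<le> \<bar>\<xi> $ 2\<bar> \<and> \<bar>\<xi> $ 2\<bar> \<le> 1/4 \<and> \<bar>\<xi> $ 1 / \<xi> $ 2\<bar> \<le> 3/2}"

definition rescale ::
  "real \<Rightarrow> dir \<Rightarrow> nat \<Rightarrow> int \<Rightarrow> (real^2 \<Rightarrow> real) \<Rightarrow> real^2 \<Rightarrow> real" where
  "rescale \<alpha> \<iota> j l f \<xi> =
     f (\<xi> v* (mat_zpow (shear \<iota>) l ** mat_zpow (scaling \<alpha> \<iota>) (int j)))"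

definition cutoffs ::
  "real \<Rightarrow> (region \<Rightarrow> real^2 \<Rightarrow> real) \<Rightarrow> (region \<Rightarrow> real^2 \<Rightarrow> real) \<Rightarrow> bool" where
  "cutoffs \<alpha> \<chi>' \<gamma> \<longleftrightarrow>
     (\<forall>r. smooth (\<chi>' r) \<and> smooth (\<gamma> r) \<and> fsupp (\<chi>' r) \<subseteq> \<C> r \<and> fsupp (\<gamma> r) \<subseteq> \<C> r) \<and>
     (\<forall>\<xi>. (\<Sum>r\<in>{Low, Cone Hor, Cone Ver}. \<chi>' r \<xi> * \<gamma> r \<xi>) = 1) \<and>
     (\<forall>\<iota> N. \<exists>C::real. \<forall>j l. \<bar>l\<bar> \<le> max_shear \<alpha> j \<longrightarrow>
        CN_norm N (\<C>_star \<iota>) (rescale \<alpha> \<iota> j l (\<chi>' (Cone \<iota>))) \<le> ereal C \<and>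
        CN_norm N (\<C>_star \<iota>) (rescale \<alpha> \<iota> j l (\<gamma> (Cone \<iota>))) \<le> ereal C)"

subsection \<open>The filtered shearlet systems\<close>

text \<open>The union of the two subsystems is indexed by the disjoint union of their index sets.\<close>

definition system_index :: "real \<Rightarrow> ((nat \<times> int \<times> (int^2) \<times> dir) + int^2) set" where
  "system_index \<alpha> = \<Delta> \<alpha> <+> UNIV"

fun shearlet_system ::
  "real \<Rightarrow> (real \<Rightarrow> complex) \<Rightarrow> (real \<Rightarrow> complex) \<Rightarrow> (int^2 \<Rightarrow> real^2 \<Rightarrow> complex) \<Rightarrow>
     (region \<Rightarrow> real^2 \<Rightarrow> real) \<Rightarrow> (nat \<times> int \<times> (int^2) \<times> dir) + int^2 \<Rightarrow> real^2 \<Rightarrow> complex" where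
  "shearlet_system \<alpha> \<Xi> v \<phi>0 \<chi>' (Inl (j, l, k, \<iota>)) =
     fourier_filter (\<chi>' (Cone \<iota>)) (shearlet \<alpha> \<Xi> v \<iota> j l k)"
| "shearlet_system \<alpha> \<Xi> v \<phi>0 \<chi>' (Inr k) = fourier_filter (\<chi>' Low) (\<phi>0 k)"

end

theory Submission
  imports Defs "HOL-Probability.Characteristic_Functions"
begin

text \<open>
  Why the two systems are dual frames. On the Fourier side, filtering a generator \<open>\<phi>\<close> by a real
  multiplier \<open>\<chi>\<close> is the same as filtering the analysed function: the coefficient of \<open>f\<close> with respect
  to the filtered generator is the inner product of \<open>\<chi> f^\<close> with \<open>\<phi>^\<close>, where \<open>^\<close> denotes the Fourier
  transform (\<open>fourier_filter_L2_inner\<close>). The function \<open>\<chi> f^\<close> lives on one of three regions, the low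
  frequency square and the two cones, and on each region the unfiltered generators are a tight frame
  with constant 1:

    \<^item> on the square, this is the hypothesis on the system \<open>\<phi>0\<close> (\<open>parseval_frame_band_tight\<close>);
    \<^item> on a cone, it is \<open>shearlets_tight_on_cone\<close>. For fixed scale \<open>j\<close> and shear \<open>l\<close> the linear map
      \<open>\<xi> \<mapsto> \<xi> A^(-j) S^(-l)\<close> carries the support of the window \<open>W\<^sub>j V\<close> into the cube of side 1 around 0,
      so the exponentials indexed by \<open>k\<close> form a Fourier basis there and the sum over \<open>k\<close> of the squared
      coefficients of \<open>G\<close> is the integral of \<open>|G W\<^sub>j V|\<^sup>2\<close>. The squares \<open>|V|\<^sup>2\<close> sum to 1 over the
      admissible shears and the \<open>W\<^sub>j\<^sup>2\<close> telescope to 1 over the scales.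

  Summing over the regions, the squared coefficients of \<open>f\<close> add up to the integral of
  \<open>(\<Sum>\<^sub>r \<chi>\<^sub>r\<^sup>2) |f^|\<^sup>2\<close>. The cut-offs are bounded: the sets \<open>C\<^sup>*\<close> cover the cones under the matrices
  \<open>S^l A^j\<close>, and there the hypothesis with \<open>N = 0\<close> applies (\<open>cutoffs_bounded\<close>). Hence there is an upper
  frame bound, and \<open>\<Sum>\<^sub>r \<chi>\<^sub>r \<gamma>\<^sub>r = 1\<close> yields a lower one by the Cauchy--Schwarz inequality. Polarising
  tightness gives the weak reconstruction formula, because \<open>\<Sum>\<^sub>r \<chi>\<^sub>r \<gamma>\<^sub>r = 1\<close> once more; a Bessel
  bound upgrades it to unconditional convergence in norm. This part of the argument is the locale
  \<open>glued_tight_frames\<close>.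

  The argument rests on two classical theorems. Plancherel's theorem, including surjectivity, is
  obtained from Gaussian regularisation and continuity of translations in \<open>L\<^sup>2\<close>
  (\<open>Plancherel_L1_L2\<close>, \<open>has_fourier_L2_surj\<close>). Parseval's identity for Fourier series on a cube
  (\<open>fourier_series_Parseval\<close>) is deduced from Plancherel's theorem: averaged over all translates of the
  lattice it is Plancherel's identity, Bessel's inequality bounds it for each translate, so it holds for
  almost every translate, and the coefficients depend continuously on the translate.
\<close>

section \<open>The Hilbert space of square-integrable functions\<close>

lemma borel_measurable_cnj [measurable]: "cnj \<in> borel_measurable borel"
  by (intro borel_measurable_continuous_onI continuous_intros)

lemma L2_measurable [measurable_dest]:
  "f \<in> L2 \<Longrightarrow> f \<in> borel_measurable borel"
  by (simp add: L2_def)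

lemma L2_integrable: "f \<in> L2 \<Longrightarrow> integrable lborel (\<lambda>x. (cmod (f x))\<^sup>2)"
  by (simp add: L2_def)

lemma L2I:
  "f \<in> borel_measurable borel \<Longrightarrow> integrable lborel (\<lambda>x. (cmod (f x))\<^sup>2) \<Longrightarrow> f \<in> L2"
  by (simp add: L2_def)

lemma L2_iff_nn_integral:
  assumes [measurable]: "f \<in> borel_measurable borel"
  shows "f \<in> L2 \<longleftrightarrow> (\<integral>\<^sup>+x. ennreal ((cmod (f x))\<^sup>2) \<partial>lborel) < \<infinity>"
  using assms by (simp add: L2_def integrable_iff_bounded)

lemma L2_norm_nonneg [simp]: "L2_norm f \<ge> 0"
  by (simp add: L2_norm_def)

lemma L2_norm_power2: "(L2_norm f)\<^sup>2 = (\<integral>x. (cmod (f x))\<^sup>2 \<partial>lborel)"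
  by (simp add: L2_norm_def)

lemma nn_integral_L2:
  "f \<in> L2 \<Longrightarrow> (\<integral>\<^sup>+x. ennreal ((cmod (f x))\<^sup>2) \<partial>lborel) = ennreal ((L2_norm f)\<^sup>2)"
  by (subst nn_integral_eq_integral) (auto simp: L2_norm_power2 L2_integrable)

lemma L2_norm_cong_AE:
  assumes "AE x in lborel. cmod (f x) = cmod (g x)"
    and [measurable]: "f \<in> borel_measurable borel" "g \<in> borel_measurable borel"
  shows "L2_norm f = L2_norm g"
  unfolding L2_norm_def
  by (subst integral_cong_AE[where g="\<lambda>x. (cmod (g x))\<^sup>2"]) (use assms(1) in auto)

lemma L2_dominated:
  assumes "g \<in> L2" and [measurable]: "f \<in> borel_measurable borel"
    and "AE x in lborel. cmod (f x) \<le> C * cmod (g x)"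
  shows "f \<in> L2"
proof (rule L2I)
  have [measurable]: "g \<in> borel_measurable borel" using assms by measurable
  show "integrable lborel (\<lambda>x. (cmod (f x))\<^sup>2)"
  proof (rule Bochner_Integration.integrable_bound)
    show "integrable lborel (\<lambda>x. C\<^sup>2 * (cmod (g x))\<^sup>2)"
      using L2_integrable[OF assms(1)] by simp
    show "AE x in lborel. norm ((cmod (f x))\<^sup>2) \<le> norm (C\<^sup>2 * (cmod (g x))\<^sup>2)"
      using assms(3)
      by eventually_elim (auto simp: power_mult_distrib[symmetric] intro!: power_mono)
  qed auto
qed fact

lemma L2_mult_bounded:
  assumes "f \<in> L2" and [measurable]: "m \<in> borel_measurable borel" and "\<And>x. cmod (m x) \<le> C"
  shows "(\<lambda>x. m x * f x) \<in> L2"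
proof (rule L2_dominated[OF assms(1)])
  have [measurable]: "f \<in> borel_measurable borel" using assms by measurable
  show "(\<lambda>x. m x * f x) \<in> borel_measurable borel" by simp
  show "AE x in lborel. cmod (m x * f x) \<le> C * cmod (f x)"
    by (auto simp: norm_mult intro!: mult_right_mono assms)
qed

lemma cmod_add_power2_le: "(cmod (a + b))\<^sup>2 \<le> 2 * (cmod a)\<^sup>2 + 2 * (cmod b)\<^sup>2"
proof -
  have "(cmod (a + b))\<^sup>2 \<le> (cmod a + cmod b)\<^sup>2"
    by (intro power_mono norm_triangle_ineq norm_ge_zero)
  also have "\<dots> \<le> 2 * (cmod a)\<^sup>2 + 2 * (cmod b)\<^sup>2"
    using sum_squares_bound[of "cmod a" "cmod b"] by (simp add: power2_sum)
  finally show ?thesis .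
qed

lemma L2_zero [simp]: "(\<lambda>x. 0) \<in> L2"
  by (rule L2I) auto

lemma L2_scale: "f \<in> L2 \<Longrightarrow> (\<lambda>x. c * f x) \<in> L2"
  by (rule L2_mult_bounded[where m="\<lambda>_. c" and C="cmod c"]) auto

lemma L2_add:
  assumes f: "f \<in> L2" and g: "g \<in> L2" shows "(\<lambda>x. f x + g x) \<in> L2"
proof (rule L2I)
  have [measurable]: "f \<in> borel_measurable borel" "g \<in> borel_measurable borel"
    using assms by measurable
  show "(\<lambda>x. f x + g x) \<in> borel_measurable borel" by simp
  show "integrable lborel (\<lambda>x. (cmod (f x + g x))\<^sup>2)"
  proof (rule Bochner_Integration.integrable_bound)
    show "integrable lborel (\<lambda>x. 2 * (cmod (f x))\<^sup>2 + 2 * (cmod (g x))\<^sup>2)"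
      by (intro Bochner_Integration.integrable_add integrable_mult_right L2_integrable f g)
  qed (auto simp: cmod_add_power2_le)
qed

lemma L2_diff: "f \<in> L2 \<Longrightarrow> g \<in> L2 \<Longrightarrow> (\<lambda>x. f x - g x) \<in> L2"
  using L2_add[of f "\<lambda>x. (-1) * g x"] L2_scale[of g "-1"] by simp

lemma L2_sum: "(\<And>i. i \<in> J \<Longrightarrow> f i \<in> L2) \<Longrightarrow> (\<lambda>x. \<Sum>i\<in>J. f i x) \<in> L2"
  by (induction J rule: infinite_finite_induct) (auto intro: L2_add)

lemma L2_cnj: "f \<in> L2 \<Longrightarrow> (\<lambda>x. cnj (f x)) \<in> L2"
  using measurable_compose[OF _ borel_measurable_cnj] by (auto simp: L2_def)

lemma L2_norm_cnj [simp]: "L2_norm (\<lambda>x. cnj (f x)) = L2_norm f"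
  by (simp add: L2_norm_def)

lemma L2_norm_scale: "L2_norm (\<lambda>x. c * f x) = cmod c * L2_norm f"
  by (simp add: L2_norm_def norm_mult power_mult_distrib real_sqrt_mult)

lemma L2_norm_minus_commute: "L2_norm (\<lambda>x. f x - g x) = L2_norm (\<lambda>x. g x - f x)"
  by (simp add: L2_norm_def norm_minus_commute)

lemma L2_inner_integrable:
  assumes f: "f \<in> L2" and g: "g \<in> L2"
  shows "integrable lborel (\<lambda>x. f x * cnj (g x))"
proof (rule Bochner_Integration.integrable_bound)
  have [measurable]: "f \<in> borel_measurable borel" "g \<in> borel_measurable borel"
    using assms by measurable
  show "integrable lborel (\<lambda>x. (cmod (f x))\<^sup>2 + (cmod (g x))\<^sup>2)"
    using f g by (auto intro: L2_integrable)
  show "(\<lambda>x. f x * cnj (g x)) \<in> borel_measurable lborel" by simp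
  show "AE x in lborel. norm (f x * cnj (g x)) \<le> norm ((cmod (f x))\<^sup>2 + (cmod (g x))\<^sup>2)"
  proof (rule AE_I2)
    fix x
    have "2 * (cmod (f x) * cmod (g x)) \<le> (cmod (f x))\<^sup>2 + (cmod (g x))\<^sup>2"
      using sum_squares_bound[of "cmod (f x)" "cmod (g x)"] by (simp add: mult.assoc)
    moreover have "0 \<le> cmod (f x) * cmod (g x)" by simp
    ultimately show "norm (f x * cnj (g x)) \<le> norm ((cmod (f x))\<^sup>2 + (cmod (g x))\<^sup>2)"
      unfolding norm_mult complex_mod_cnj real_norm_def by linarith
  qed
qed

lemma L2_inner_cong_AE:
  assumes "AE x in lborel. f x = f' x" "AE x in lborel. g x = g' x"
    and "f \<in> L2" "g \<in> L2" "f' \<in> L2" "g' \<in> L2"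
  shows "L2_inner f g = L2_inner f' g'"
proof -
  have [measurable]: "f \<in> borel_measurable borel" "g \<in> borel_measurable borel"
    "f' \<in> borel_measurable borel" "g' \<in> borel_measurable borel"
    using assms by measurable
  show ?thesis unfolding L2_inner_def
    by (rule integral_cong_AE) (use assms(1,2) in auto)
qed

lemma L2_inner_commute: "L2_inner g f = cnj (L2_inner f g)"
  unfolding L2_inner_def Bochner_Integration.integral_cnj[symmetric] by (simp add: mult.commute)

lemma L2_inner_add_left:
  "f \<in> L2 \<Longrightarrow> g \<in> L2 \<Longrightarrow> h \<in> L2 \<Longrightarrow>
    L2_inner (\<lambda>x. f x + g x) h = L2_inner f h + L2_inner g h"
  unfolding L2_inner_def by (simp add: ring_distribs L2_inner_integrable)

lemma L2_inner_diff_left: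
  "f \<in> L2 \<Longrightarrow> g \<in> L2 \<Longrightarrow> h \<in> L2 \<Longrightarrow>
    L2_inner (\<lambda>x. f x - g x) h = L2_inner f h - L2_inner g h"
  unfolding L2_inner_def by (simp add: ring_distribs L2_inner_integrable)

lemma L2_inner_scale_left: "L2_inner (\<lambda>x. c * f x) h = c * L2_inner f h"
  unfolding L2_inner_def by (simp add: mult.assoc)

lemma L2_inner_add_right:
  "f \<in> L2 \<Longrightarrow> g \<in> L2 \<Longrightarrow> h \<in> L2 \<Longrightarrow>
    L2_inner h (\<lambda>x. f x + g x) = L2_inner h f + L2_inner h g"
  by (subst (1 2 3) L2_inner_commute) (simp add: L2_inner_add_left)

lemma L2_inner_diff_right:
  "f \<in> L2 \<Longrightarrow> g \<in> L2 \<Longrightarrow> h \<in> L2 \<Longrightarrow>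
    L2_inner h (\<lambda>x. f x - g x) = L2_inner h f - L2_inner h g"
  by (subst (1 2 3) L2_inner_commute) (simp add: L2_inner_diff_left)

lemma L2_inner_scale_right: "L2_inner h (\<lambda>x. c * f x) = cnj c * L2_inner h f"
  by (subst (1 2) L2_inner_commute) (simp add: L2_inner_scale_left)

lemma L2_inner_sum_right:
  "(\<And>i. i \<in> J \<Longrightarrow> f i \<in> L2) \<Longrightarrow> h \<in> L2 \<Longrightarrow>
    L2_inner h (\<lambda>x. \<Sum>i\<in>J. f i x) = (\<Sum>i\<in>J. L2_inner h (f i))"
proof (induction J rule: infinite_finite_induct)
  case (insert i J)
  then show ?case by (simp add: L2_inner_add_right L2_sum)
qed (auto simp: L2_inner_def)

lemma L2_inner_self: "L2_inner f f = complex_of_real ((L2_norm f)\<^sup>2)"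
  unfolding L2_inner_def L2_norm_power2 complex_norm_square[symmetric]
  by (simp flip: of_real_power)

lemma L2_norm_add_scale_power2:
  assumes f: "f \<in> L2" and g: "g \<in> L2"
  shows "(L2_norm (\<lambda>x. f x + c * g x))\<^sup>2 =
    (L2_norm f)\<^sup>2 + (cmod c)\<^sup>2 * (L2_norm g)\<^sup>2 + 2 * Re (cnj c * L2_inner f g)"
proof -
  have "complex_of_real ((L2_norm (\<lambda>x. f x + c * g x))\<^sup>2) =
    L2_inner f f + c * cnj c * L2_inner g g + (cnj c * L2_inner f g + c * L2_inner g f)"
    unfolding L2_inner_self[symmetric] using f g L2_scale[OF g]
    by (simp add: L2_inner_add_left L2_inner_add_right L2_inner_scale_left L2_inner_scale_right
        L2_add algebra_simps)
  also have "cnj c * L2_inner f g + c * L2_inner g f =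
      complex_of_real (2 * Re (cnj c * L2_inner f g))"
    by (subst L2_inner_commute[of g]) (simp add: complex_eq_iff)
  also have "c * cnj c = complex_of_real ((cmod c)\<^sup>2)" by (rule complex_norm_square[symmetric])
  finally show ?thesis
    unfolding L2_inner_self of_real_mult[symmetric] of_real_add[symmetric] of_real_eq_iff .
qed

lemma L2_norm_diff_power2:
  assumes f: "f \<in> L2" and g: "g \<in> L2"
  shows "(L2_norm (\<lambda>x. f x - g x))\<^sup>2 = (L2_norm f)\<^sup>2 + (L2_norm g)\<^sup>2 - 2 * Re (L2_inner f g)"
  using L2_norm_add_scale_power2[OF f g, of "-1"] by simp

text \<open>
  The norm determines the inner product. Below, this turns every identity between norms (Plancherel,
  tightness of a frame) into the corresponding identity between inner products.
\<close>

lemma L2_polarization: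
  assumes f: "f \<in> L2" and g: "g \<in> L2"
  shows "4 * L2_inner f g = Complex
     ((L2_norm (\<lambda>x. f x + 1 * g x))\<^sup>2 - (L2_norm (\<lambda>x. f x + (-1) * g x))\<^sup>2)
     ((L2_norm (\<lambda>x. f x + \<i> * g x))\<^sup>2 - (L2_norm (\<lambda>x. f x + (-\<i>) * g x))\<^sup>2)"
  unfolding L2_norm_add_scale_power2[OF f g] by (simp add: complex_eq_iff)

lemma L2_Cauchy_Schwarz:
  assumes f: "f \<in> L2" and g: "g \<in> L2"
  shows "cmod (L2_inner f g) \<le> L2_norm f * L2_norm g"
proof -
  have [measurable]: "f \<in> borel_measurable borel" "g \<in> borel_measurable borel"
    using assms by measurable
  have int: "integrable lborel (\<lambda>x. cmod (f x) * cmod (g x))"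
    using integrable_norm[OF L2_inner_integrable[OF f g]] by (simp add: norm_mult)
  have "cmod (L2_inner f g) \<le> (\<integral>x. cmod (f x) * cmod (g x) \<partial>lborel)"
    unfolding L2_inner_def
    using integral_norm_bound[of lborel "\<lambda>x. f x * cnj (g x)"] by (simp add: norm_mult)
  also have "(\<integral>x. cmod (f x) * cmod (g x) \<partial>lborel) \<le> L2_norm f * L2_norm g"
  proof (rule power2_le_imp_le)
    have "ennreal ((\<integral>x. cmod (f x) * cmod (g x) \<partial>lborel)\<^sup>2) =
        (\<integral>\<^sup>+x. ennreal (cmod (f x)) * ennreal (cmod (g x)) \<partial>lborel)\<^sup>2"
      using int by (simp add: ennreal_mult[symmetric] nn_integral_eq_integral ennreal_power)
    also have "\<dots> \<le> (\<integral>\<^sup>+x. ennreal (cmod (f x))^2 \<partial>lborel) * (\<integral>\<^sup>+x. ennreal (cmod (g x))^2 \<partial>lborel)"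
      by (rule Cauchy_Schwarz_nn_integral) auto
    also have "\<dots> = ennreal ((L2_norm f * L2_norm g)\<^sup>2)"
      using nn_integral_L2[OF f] nn_integral_L2[OF g]
      by (simp add: ennreal_power ennreal_mult[symmetric] power_mult_distrib)
    finally show "(\<integral>x. cmod (f x) * cmod (g x) \<partial>lborel)\<^sup>2 \<le> (L2_norm f * L2_norm g)\<^sup>2"
      by (simp add: ennreal_le_iff)
  qed simp
  finally show ?thesis .
qed

lemma L2_norm_triangle:
  assumes f: "f \<in> L2" and g: "g \<in> L2"
  shows "L2_norm (\<lambda>x. f x + g x) \<le> L2_norm f + L2_norm g"
proof (rule power2_le_imp_le)
  have "Re (L2_inner f g) \<le> L2_norm f * L2_norm g"
    using complex_Re_le_cmod L2_Cauchy_Schwarz[OF f g] by (rule order_trans)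
  then show "(L2_norm (\<lambda>x. f x + g x))\<^sup>2 \<le> (L2_norm f + L2_norm g)\<^sup>2"
    using L2_norm_add_scale_power2[OF f g, of 1] by (simp add: power2_sum)
qed simp

lemma L2_norm_triangle_diff:
  assumes f: "f \<in> L2" and g: "g \<in> L2" and h: "h \<in> L2"
  shows "L2_norm (\<lambda>x. f x - h x) \<le> L2_norm (\<lambda>x. f x - g x) + L2_norm (\<lambda>x. g x - h x)"
  using L2_norm_triangle[OF L2_diff[OF f g] L2_diff[OF g h]] by simp

lemma L2_norm_triangle_sub:
  assumes f: "f \<in> L2" and g: "g \<in> L2"
  shows "\<bar>L2_norm f - L2_norm g\<bar> \<le> L2_norm (\<lambda>x. f x - g x)"
  using L2_norm_triangle[OF L2_diff[OF f g] g] L2_norm_triangle[OF L2_diff[OF g f] f]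
    L2_norm_minus_commute[of f g] by simp

lemma L2_norm_eq_0_iff:
  assumes f: "f \<in> L2" shows "L2_norm f = 0 \<longleftrightarrow> (AE x in lborel. f x = 0)"
  unfolding L2_norm_def
  using integral_nonneg_eq_0_iff_AE[OF L2_integrable[OF f]] by simp

lemma L2_norm_diff_eq_0_iff:
  assumes f: "f \<in> L2" and g: "g \<in> L2"
  shows "L2_norm (\<lambda>x. f x - g x) = 0 \<longleftrightarrow> (AE x in lborel. f x = g x)"
  using L2_norm_eq_0_iff[OF L2_diff[OF f g]] by simp

text \<open>
  For elements of \<open>L\<^sup>2\<close>, convergence in the sense of extended nonnegative integrals is convergence of
  the real-valued norm, to which the triangle inequality applies.
\<close>

lemma L2_tendsto_iff:
  assumes g: "\<forall>\<^sub>F n in F. g n \<in> L2" and f: "f \<in> L2"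
  shows "L2_tendsto g f F \<longleftrightarrow> ((\<lambda>n. L2_norm (\<lambda>x. g n x - f x)) \<longlongrightarrow> 0) F"
proof -
  have "L2_tendsto g f F \<longleftrightarrow> ((\<lambda>n. ennreal ((L2_norm (\<lambda>x. g n x - f x))\<^sup>2)) \<longlongrightarrow> ennreal 0) F"
    unfolding L2_tendsto_def ennreal_0
    by (rule tendsto_cong) (use g in \<open>auto elim!: eventually_mono simp: nn_integral_L2 L2_diff f\<close>)
  also have "\<dots> \<longleftrightarrow> ((\<lambda>n. (L2_norm (\<lambda>x. g n x - f x))\<^sup>2) \<longlongrightarrow> 0) F"
    by (subst tendsto_ennreal_iff) auto
  also have "\<dots> \<longleftrightarrow> ((\<lambda>n. L2_norm (\<lambda>x. g n x - f x)) \<longlongrightarrow> 0) F" (is "?a \<longleftrightarrow> ?b")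
  proof
    assume ?a
    from tendsto_real_sqrt[OF this] show ?b by simp
  next
    assume ?b
    from tendsto_power[OF this, of 2] show ?a by simp
  qed
  finally show ?thesis .
qed

lemma L2_norm_limit:
  assumes "\<And>n. f n \<in> L2" "g \<in> L2" "(\<lambda>n. L2_norm (\<lambda>x. f n x - g x)) \<longlonglongrightarrow> 0"
  shows "(\<lambda>n. L2_norm (f n)) \<longlonglongrightarrow> L2_norm g"
proof (rule LIM_zero_cancel, rule Lim_null_comparison[OF _ assms(3)])
  show "\<forall>\<^sub>F n in sequentially. norm (L2_norm (f n) - L2_norm g) \<le> L2_norm (\<lambda>x. f n x - g x)"
    using L2_norm_triangle_sub[OF assms(1,2)] by simp
qed

lemma L2_inner_limit:
  assumes f: "\<And>n. f n \<in> L2" "f' \<in> L2" "(\<lambda>n. L2_norm (\<lambda>x. f n x - f' x)) \<longlonglongrightarrow> 0"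
    and g: "\<And>n. g n \<in> L2" "g' \<in> L2" "(\<lambda>n. L2_norm (\<lambda>x. g n x - g' x)) \<longlonglongrightarrow> 0"
  shows "(\<lambda>n. L2_inner (f n) (g n)) \<longlonglongrightarrow> L2_inner f' g'"
proof (rule LIM_zero_cancel, rule Lim_null_comparison)
  let ?b = "\<lambda>n. L2_norm (\<lambda>x. f n x - f' x) * L2_norm (g n) + L2_norm f' * L2_norm (\<lambda>x. g n x - g' x)"
  have "?b \<longlonglongrightarrow> 0 * L2_norm g' + L2_norm f' * 0"
    by (intro tendsto_intros L2_norm_limit f g)
  then show "?b \<longlonglongrightarrow> 0" by simp
  show "\<forall>\<^sub>F n in sequentially. norm (L2_inner (f n) (g n) - L2_inner f' g') \<le> ?b n"
  proof (rule always_eventually, rule allI)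
    fix n
    have "L2_inner (f n) (g n) - L2_inner f' g' =
        L2_inner (\<lambda>x. f n x - f' x) (g n) + L2_inner f' (\<lambda>x. g n x - g' x)"
      using f g by (simp add: L2_inner_diff_left L2_inner_diff_right)
    also have "norm \<dots> \<le> norm (L2_inner (\<lambda>x. f n x - f' x) (g n)) + norm (L2_inner f' (\<lambda>x. g n x - g' x))"
      by (rule norm_triangle_ineq)
    also have "\<dots> \<le> ?b n"
      by (intro add_mono L2_Cauchy_Schwarz L2_diff f g)
    finally show "norm (L2_inner (f n) (g n) - L2_inner f' g') \<le> ?b n" .
  qed
qed

text \<open>
  The Riesz--Fischer theorem. A subsequence whose increments \<open>d\<^sub>k\<close> have norm at most \<open>2^(-k)\<close> converges
  almost everywhere, and Fatou's lemma shows that its pointwise limit is the limit in norm.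
\<close>

theorem L2_complete:
  assumes f: "\<And>n. f n \<in> L2"
    and Cauchy: "\<And>e. e > 0 \<Longrightarrow> \<exists>N. \<forall>m\<ge>N. \<forall>n\<ge>N. L2_norm (\<lambda>x. f m x - f n x) < e"
  obtains F where "F \<in> L2" "(\<lambda>n. L2_norm (\<lambda>x. f n x - F x)) \<longlonglongrightarrow> 0"
proof -
  have [measurable]: "f n \<in> borel_measurable borel" for n using f by measurable
  have "\<exists>N. \<forall>k. \<forall>m\<ge>N k. \<forall>n\<ge>N k. L2_norm (\<lambda>x. f m x - f n x) < (1/2)^k"
    by (rule choice, rule allI, rule Cauchy) simp
  then obtain N where N: "\<And>k m n. m \<ge> N k \<Longrightarrow> n \<ge> N k \<Longrightarrow> L2_norm (\<lambda>x. f m x - f n x) < (1/2)^k"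
    by blast
  define r where "r k = (\<Sum>i\<le>k. N i)" for k
  have rN: "r k \<ge> N k" for k unfolding r_def by (rule member_le_sum) auto
  have rmono: "r k \<le> r (Suc k)" for k unfolding r_def by simp
  define d where "d k x = f (r (Suc k)) x - f (r k) x" for k x
  have [measurable]: "d k \<in> borel_measurable borel" for k unfolding d_def by measurable
  have dL2: "d k \<in> L2" for k unfolding d_def by (intro L2_diff f)
  have dnorm: "(L2_norm (d k))\<^sup>2 \<le> (1/4)^k" for k
  proof -
    have "L2_norm (d k) \<le> (1/2)^k"
      unfolding d_def using N[of k "r (Suc k)" "r k"] rN[of k] rmono[of k] by simp
    then have "(L2_norm (d k))\<^sup>2 \<le> ((1/2)^k)\<^sup>2" by (intro power_mono) auto
    also have "((1/2::real)^k)\<^sup>2 = (1/4)^k" by (simp add: power_mult[symmetric] mult.commute power_mult power2_eq_square flip: power_mult_distrib)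
    finally show ?thesis .
  qed
  \<comment> \<open>The weight \<open>2^k\<close> is small enough for \<open>\<Sum>k. 2^k |d\<^sub>k|\<^sup>2\<close> to be integrable and large enough for
      its finiteness at a point to force \<open>\<Sum>k. |d\<^sub>k| < \<infinity>\<close> there, as \<open>2 |d\<^sub>k| \<le> 2^k |d\<^sub>k|\<^sup>2 + 2^(-k)\<close>.\<close>
  have "(\<integral>\<^sup>+x. (\<Sum>k. ennreal (2^k * (cmod (d k x))\<^sup>2)) \<partial>lborel) =
      (\<Sum>k. \<integral>\<^sup>+x. ennreal (2^k * (cmod (d k x))\<^sup>2) \<partial>lborel)"
    by (rule nn_integral_suminf) auto
  also have "\<dots> \<le> (\<Sum>k. ennreal ((1/2)^k))"
  proof (rule suminf_le)
    fix k
    have "(\<integral>\<^sup>+x. ennreal (2^k * (cmod (d k x))\<^sup>2) \<partial>lborel) = ennreal (2^k * (L2_norm (d k))\<^sup>2)"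
      using nn_integral_L2[OF dL2] by (simp add: ennreal_mult nn_integral_cmult)
    also have "\<dots> \<le> ennreal (2^k * (1/4)^k)" by (intro ennreal_leI mult_left_mono dnorm) auto
    also have "2^k * (1/4)^k = (1/2::real)^k" by (simp flip: power_mult_distrib)
    finally show "(\<integral>\<^sup>+x. ennreal (2^k * (cmod (d k x))\<^sup>2) \<partial>lborel) \<le> ennreal ((1/2)^k)" .
  qed auto
  also have "\<dots> = ennreal (\<Sum>k. (1/2)^k)" by (rule suminf_ennreal2) (auto intro: summable_geometric)
  also have "\<dots> < \<infinity>" by simp
  finally have "AE x in lborel. (\<Sum>k. ennreal (2^k * (cmod (d k x))\<^sup>2)) \<noteq> \<infinity>"
    by (intro nn_integral_PInf_AE) auto
  then have conv: "AE x in lborel. convergent (\<lambda>k. f (r k) x)"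
  proof eventually_elim
    fix x assume "(\<Sum>k. ennreal (2^k * (cmod (d k x))\<^sup>2)) \<noteq> \<infinity>"
    then have s: "summable (\<lambda>k. 2^k * (cmod (d k x))\<^sup>2)"
      by (intro summable_suminf_not_top) (auto simp: top_unique)
    have "summable (\<lambda>k. d k x)"
    proof (rule summable_comparison_test')
      show "summable (\<lambda>k. 2^k * (cmod (d k x))\<^sup>2 + (1/2)^k)"
        by (intro summable_add s summable_geometric) auto
      fix k
      have "2 * cmod (d k x) = 2 * (2^k * cmod (d k x)) * (1/2)^k"
        by (simp add: power_one_over)
      have "0 \<le> (2^k * cmod (d k x) - 1)\<^sup>2" by simp
      then have "2 * (2^k * cmod (d k x)) \<le> (2^k * cmod (d k x))\<^sup>2 + 1"
        by (simp add: power2_diff)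
      then have "2 * (2^k * cmod (d k x)) * (1/2)^k \<le> ((2^k * cmod (d k x))\<^sup>2 + 1) * (1/2)^k"
        by (rule mult_right_mono) auto
      also have "\<dots> = 2^k * (cmod (d k x))\<^sup>2 + (1/2)^k"
        by (simp add: field_simps power2_eq_square)
      finally have "2 * cmod (d k x) \<le> 2^k * (cmod (d k x))\<^sup>2 + (1/2)^k"
        by (simp add: power_one_over)
      then show "norm (d k x) \<le> 2^k * (cmod (d k x))\<^sup>2 + (1/2)^k"
        using norm_ge_zero[of "d k x"] by linarith
    qed
    then have "convergent (\<lambda>n. \<Sum>k<n. d k x)" by (simp add: summable_iff_convergent)
    moreover have "(\<Sum>k<n. d k x) = f (r n) x - f (r 0) x" for n
      unfolding d_def by (rule sum_lessThan_telescope)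
    ultimately have "convergent (\<lambda>n. f (r n) x - f (r 0) x)" by simp
    from convergent_add[OF this convergent_const[of "f (r 0) x"]]
    show "convergent (\<lambda>k. f (r k) x)" by simp
  qed
  define F where "F x = lim (\<lambda>k. f (r k) x)" for x
  have [measurable]: "F \<in> borel_measurable borel"
    unfolding F_def by measurable
  have lim: "AE x in lborel. (\<lambda>k. f (r k) x) \<longlonglongrightarrow> F x"
    using conv by eventually_elim (simp add: F_def convergent_LIMSEQ_iff)
  have bound: "(\<integral>\<^sup>+x. ennreal ((cmod (f n x - F x))\<^sup>2) \<partial>lborel) \<le> ennreal (((1/2)^K)\<^sup>2)"
    if n: "n \<ge> N K" for n K
  proof -
    have "(\<integral>\<^sup>+x. ennreal ((cmod (f n x - F x))\<^sup>2) \<partial>lborel) =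
      (\<integral>\<^sup>+x. liminf (\<lambda>k. ennreal ((cmod (f n x - f (r k) x))\<^sup>2)) \<partial>lborel)"
    proof (rule nn_integral_cong_AE)
      show "AE x in lborel. ennreal ((cmod (f n x - F x))\<^sup>2) =
          liminf (\<lambda>k. ennreal ((cmod (f n x - f (r k) x))\<^sup>2))"
        using lim
      proof eventually_elim
        fix x assume "(\<lambda>k. f (r k) x) \<longlonglongrightarrow> F x"
        then have "(\<lambda>k. ennreal ((cmod (f n x - f (r k) x))\<^sup>2)) \<longlonglongrightarrow> ennreal ((cmod (f n x - F x))\<^sup>2)"
          by (intro tendsto_intros)
        from lim_imp_Liminf[OF sequentially_bot this] show "ennreal ((cmod (f n x - F x))\<^sup>2) =
          liminf (\<lambda>k. ennreal ((cmod (f n x - f (r k) x))\<^sup>2))" by simp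
      qed
    qed
    also have "\<dots> \<le> liminf (\<lambda>k. \<integral>\<^sup>+x. ennreal ((cmod (f n x - f (r k) x))\<^sup>2) \<partial>lborel)"
      by (rule nn_integral_liminf) auto
    also have "\<dots> \<le> ennreal (((1/2)^K)\<^sup>2)"
    proof (rule Liminf_le)
      show "\<forall>\<^sub>F k in sequentially. (\<integral>\<^sup>+x. ennreal ((cmod (f n x - f (r k) x))\<^sup>2) \<partial>lborel) \<le> ennreal (((1/2)^K)\<^sup>2)"
        using eventually_ge_at_top[of K]
      proof eventually_elim
        fix k assume "k \<ge> K"
        have "r k \<ge> r K" using \<open>k \<ge> K\<close> by (rule lift_Suc_mono_le[of r, OF rmono])
        then have "r k \<ge> N K" using rN[of K] by simp
        then have "L2_norm (\<lambda>x. f n x - f (r k) x) \<le> (1/2)^K" using N[OF n] by (simp add: less_imp_le)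
        then show "(\<integral>\<^sup>+x. ennreal ((cmod (f n x - f (r k) x))\<^sup>2) \<partial>lborel) \<le> ennreal (((1/2)^K)\<^sup>2)"
          by (subst nn_integral_L2) (auto intro!: L2_diff f ennreal_leI power_mono)
      qed
    qed simp
    finally show ?thesis .
  qed
  have diffL2: "(\<lambda>x. f n x - F x) \<in> L2" if "n \<ge> N K" for n K
    using bound[OF that] by (subst L2_iff_nn_integral) (auto intro: order_le_less_trans)
  have FL2: "F \<in> L2"
    using L2_diff[OF f diffL2[OF order_refl], of "N 0" 0] by simp
  have "(\<lambda>n. L2_norm (\<lambda>x. f n x - F x)) \<longlonglongrightarrow> 0"
  proof (rule LIMSEQ_I)
    fix e :: real assume "e > 0"
    then obtain K where K: "(1/2)^K < e" using real_arch_pow_inv[of e "1/2"] by auto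
    have "norm (L2_norm (\<lambda>x. f n x - F x) - 0) < e" if "n \<ge> N K" for n
    proof -
      have "(L2_norm (\<lambda>x. f n x - F x))\<^sup>2 \<le> ((1/2)^K)\<^sup>2"
        using bound[OF that] nn_integral_L2[OF diffL2[OF that]] by simp
      then have "L2_norm (\<lambda>x. f n x - F x) \<le> (1/2)^K" by (rule power2_le_imp_le) simp
      then show ?thesis using K by simp
    qed
    then show "\<exists>no. \<forall>n\<ge>no. norm (L2_norm (\<lambda>x. f n x - F x) - 0) < e" by blast
  qed
  with FL2 that show ?thesis by blast
qed

section \<open>Continuity of translation in the mean\<close>

lemma nn_integral_lborel_affine:
  fixes f :: "'a::euclidean_space \<Rightarrow> ennreal"
  assumes [measurable]: "f \<in> borel_measurable borel" and c: "c \<noteq> 0"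
  shows "(\<integral>\<^sup>+x. f x \<partial>lborel) = ennreal (\<bar>c\<bar>^DIM('a)) * (\<integral>\<^sup>+x. f (t + c *\<^sub>R x) \<partial>lborel)"
  by (subst lborel_affine[OF c, of t])
     (simp add: nn_integral_density nn_integral_distr nn_integral_cmult)

lemma integrable_lborel_affine:
  fixes f :: "'a::euclidean_space \<Rightarrow> 'b::{banach, second_countable_topology}"
  assumes f: "integrable lborel f" and c: "c \<noteq> 0"
  shows "integrable lborel (\<lambda>x. f (t + c *\<^sub>R x))"
  using f f[THEN borel_measurable_integrable] c unfolding integrable_iff_bounded
  by (subst (asm) nn_integral_lborel_affine[where c=c and t=t]) (auto simp: ennreal_mult_less_top)

lemma integral_lborel_affine:
  fixes f :: "'a::euclidean_space \<Rightarrow> 'b::{banach, second_countable_topology}"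
  assumes f: "integrable lborel f" and c: "c \<noteq> 0"
  shows "(\<integral>x. f x \<partial>lborel) = \<bar>c\<bar>^DIM('a) *\<^sub>R (\<integral>x. f (t + c *\<^sub>R x) \<partial>lborel)"
  using c f f[THEN borel_measurable_integrable] integrable_lborel_affine[OF f c, of t]
  by (subst lborel_affine[OF c, of t]) (simp add: integral_density integral_distr)

lemma nn_integral_lborel_translate:
  fixes f :: "'a::euclidean_space \<Rightarrow> ennreal"
  assumes "f \<in> borel_measurable borel"
  shows "(\<integral>\<^sup>+x. f (x - z) \<partial>lborel) = (\<integral>\<^sup>+x. f x \<partial>lborel)"
  using nn_integral_lborel_affine[OF assms, of 1 "-z"] by simp

lemma L2_translate:
  assumes f: "f \<in> L2" shows "(\<lambda>x. f (x - z)) \<in> L2"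
proof -
  have [measurable]: "f \<in> borel_measurable borel" using f by measurable
  show ?thesis using f nn_integral_lborel_translate[of "\<lambda>x. ennreal ((cmod (f x))\<^sup>2)" z]
    by (simp add: L2_iff_nn_integral)
qed

lemma L2_norm_translate:
  assumes f: "f \<in> L2" shows "L2_norm (\<lambda>x. f (x - z)) = L2_norm f"
proof -
  have [measurable]: "f \<in> borel_measurable borel" using f by measurable
  have "ennreal ((L2_norm (\<lambda>x. f (x - z)))\<^sup>2) = ennreal ((L2_norm f)\<^sup>2)"
    using nn_integral_lborel_translate[of "\<lambda>x. ennreal ((cmod (f x))\<^sup>2)" z]
    by (simp add: nn_integral_L2[symmetric] f L2_translate)
  then show ?thesis by simp
qed

text \<open>
  Continuity of translation along a fixed sequence \<open>z\<close>, which will tend to 0; sequences suffice for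
  the dominated convergence arguments in which the notion is used.
\<close>

definition translation_continuous :: "(nat \<Rightarrow> 'a::euclidean_space) \<Rightarrow> ('a \<Rightarrow> complex) \<Rightarrow> bool" where
  "translation_continuous z f \<longleftrightarrow> (\<lambda>n. L2_norm (\<lambda>x. f (x - z n) - f x)) \<longlonglongrightarrow> 0"

text \<open>
  Translations are isometries, so the property passes to limits in norm. It therefore suffices to
  treat indicators of open sets, then of measurable sets, then simple functions.
\<close>

lemma translation_continuous_closed:
  assumes f: "f \<in> L2"
    and approx: "\<And>e. e > 0 \<Longrightarrow> \<exists>g\<in>L2. L2_norm (\<lambda>x. f x - g x) < e \<and> translation_continuous z g"
  shows "translation_continuous z f"
  unfolding translation_continuous_def
proof (rule LIMSEQ_I)
  fix e :: real assume "e > 0"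
  then obtain g where g: "g \<in> L2" "L2_norm (\<lambda>x. f x - g x) < e/3" "translation_continuous z g"
    using approx[of "e/3"] by auto
  from LIMSEQ_D[OF g(3)[unfolded translation_continuous_def], of "e/3"] \<open>e > 0\<close>
  obtain N where N: "\<And>n. n \<ge> N \<Longrightarrow> L2_norm (\<lambda>x. g (x - z n) - g x) < e/3" by auto
  have "L2_norm (\<lambda>x. f (x - z n) - f x) < e" if "n \<ge> N" for n
  proof -
    let ?f = "\<lambda>x. f (x - z n)" and ?g = "\<lambda>x. g (x - z n)"
    have "L2_norm (\<lambda>x. ?f x - f x) \<le> L2_norm (\<lambda>x. ?f x - ?g x) + L2_norm (\<lambda>x. ?g x - f x)"
      by (intro L2_norm_triangle_diff L2_translate f g)
    also have "L2_norm (\<lambda>x. ?g x - f x) \<le> L2_norm (\<lambda>x. ?g x - g x) + L2_norm (\<lambda>x. g x - f x)"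
      by (intro L2_norm_triangle_diff L2_translate f g)
    also have "L2_norm (\<lambda>x. ?f x - ?g x) = L2_norm (\<lambda>x. f x - g x)"
      using L2_norm_translate[OF L2_diff[OF f g(1)]] by simp
    also have "L2_norm (\<lambda>x. g x - f x) = L2_norm (\<lambda>x. f x - g x)"
      by (rule L2_norm_minus_commute)
    finally show ?thesis using g(2) N[OF that] by simp
  qed
  then show "\<exists>no. \<forall>n\<ge>no. norm (L2_norm (\<lambda>x. f (x - z n) - f x) - 0) < e" by auto
qed

lemma translation_continuous_add:
  assumes f: "f \<in> L2" "translation_continuous z f" and g: "g \<in> L2" "translation_continuous z g"
  shows "translation_continuous z (\<lambda>x. f x + g x)"
  unfolding translation_continuous_def
proof (rule Lim_null_comparison[OF always_eventually], rule allI)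
  show "(\<lambda>n. L2_norm (\<lambda>x. f (x - z n) - f x) + L2_norm (\<lambda>x. g (x - z n) - g x)) \<longlonglongrightarrow> 0"
    using tendsto_add[OF f(2)[unfolded translation_continuous_def] g(2)[unfolded translation_continuous_def]]
    by simp
  show "norm (L2_norm (\<lambda>x. f (x - z n) + g (x - z n) - (f x + g x)))
      \<le> L2_norm (\<lambda>x. f (x - z n) - f x) + L2_norm (\<lambda>x. g (x - z n) - g x)" for n
    using L2_norm_triangle[OF L2_diff[OF L2_translate[OF f(1)] f(1)] L2_diff[OF L2_translate[OF g(1)] g(1)], of "z n" "z n"]
    by (simp add: algebra_simps)
qed

lemma translation_continuous_scale:
  assumes "translation_continuous z f"
  shows "translation_continuous z (\<lambda>x. c * f x)"
proof -
  have "L2_norm (\<lambda>x. c * f (x - z n) - c * f x) = cmod c * L2_norm (\<lambda>x. f (x - z n) - f x)" for n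
    using L2_norm_scale[of c "\<lambda>x. f (x - z n) - f x"] by (simp add: ring_distribs)
  then show ?thesis using tendsto_mult_right_zero[OF assms[unfolded translation_continuous_def], of "cmod c"]
    by (simp add: translation_continuous_def)
qed

lemma L2_indicator:
  assumes [measurable]: "A \<in> sets borel" and "emeasure lborel A < \<infinity>"
  shows "(\<lambda>x. indicator A x :: complex) \<in> L2"
proof -
  have "(\<integral>\<^sup>+x. ennreal ((cmod (indicator A x))\<^sup>2) \<partial>lborel) = (\<integral>\<^sup>+x. indicator A x \<partial>lborel)"
    by (rule nn_integral_cong) (auto simp: indicator_def)
  then show ?thesis using assms by (subst L2_iff_nn_integral) auto
qed

text \<open>
  For an open set \<open>U\<close>, the product \<open>1\<^sub>U(x - z\<^sub>n) 1\<^sub>U(x)\<close> tends to \<open>1\<^sub>U(x)\<close> at every point: a point of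
  \<open>U\<close> remains in \<open>U\<close> after a small shift, and outside \<open>U\<close> the second factor vanishes. So the inner
  product of \<open>1\<^sub>U\<close> with its translates tends to the square of its norm.
\<close>

lemma translation_continuous_indicator_open:
  assumes U: "open U" "emeasure lborel U < \<infinity>" and z: "z \<longlonglongrightarrow> 0"
  shows "translation_continuous z (indicator U)"
proof -
  have [measurable]: "U \<in> sets borel" using U by simp
  note L2 = L2_indicator[OF \<open>U \<in> sets borel\<close> U(2)]
  let ?u = "indicator U :: 'a \<Rightarrow> complex"
  have "(\<lambda>n. L2_inner (\<lambda>x. ?u (x - z n)) ?u) \<longlonglongrightarrow> L2_inner ?u ?u"
    unfolding L2_inner_def
  proof (rule integral_dominated_convergence[where w="indicator U"])
    show "AE x in lborel. (\<lambda>n. ?u (x - z n) * cnj (?u x)) \<longlonglongrightarrow> ?u x * cnj (?u x)"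
    proof (rule AE_I2)
      fix x
      show "(\<lambda>n. ?u (x - z n) * cnj (?u x)) \<longlonglongrightarrow> ?u x * cnj (?u x)"
      proof (cases "x \<in> U")
        case True
        have "(\<lambda>n. x - z n) \<longlonglongrightarrow> x" using tendsto_diff[OF tendsto_const[of x] z] by simp
        then have "eventually (\<lambda>n. x - z n \<in> U) sequentially"
          using topological_tendstoD[OF _ U(1) True] by blast
        then have "eventually (\<lambda>n. ?u (x - z n) * cnj (?u x) = ?u x * cnj (?u x)) sequentially"
          by eventually_elim (simp add: True)
        then show ?thesis by (rule tendsto_eventually)
      qed simp
    qed
    show "integrable lborel (indicat_real U)" using U by simp
  qed (auto simp: indicator_def)
  then have "(\<lambda>n. (L2_norm ?u)\<^sup>2 + (L2_norm ?u)\<^sup>2 - 2 * Re (L2_inner (\<lambda>x. ?u (x - z n)) ?u)) \<longlonglongrightarrow>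
      (L2_norm ?u)\<^sup>2 + (L2_norm ?u)\<^sup>2 - 2 * Re (L2_inner ?u ?u)"
    by (intro tendsto_intros)
  then have "(\<lambda>n. (L2_norm (\<lambda>x. ?u (x - z n) - ?u x))\<^sup>2) \<longlonglongrightarrow> 0"
    using L2_norm_diff_power2[OF L2_translate[OF L2] L2] L2_norm_translate[OF L2]
    by (simp add: L2_inner_self)
  from tendsto_real_sqrt[OF this] show ?thesis by (simp add: translation_continuous_def)
qed

lemma translation_continuous_indicator:
  assumes A: "A \<in> sets borel" "emeasure lborel A < \<infinity>" and z: "z \<longlonglongrightarrow> 0"
  shows "translation_continuous z (indicator A)"
proof (rule translation_continuous_closed)
  note [measurable] = A(1)
  show "indicator A \<in> L2" using L2_indicator[OF A] .
  fix e :: real assume "e > 0"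
  then obtain U where U: "open U" "A \<subseteq> U" "emeasure lborel (U - A) < ennreal (e\<^sup>2)"
    using outer_regular_lborel[OF A(1), of "e\<^sup>2"] by auto
  have [measurable]: "U \<in> sets borel" using U by simp
  have "emeasure lborel U = emeasure lborel A + emeasure lborel (U - A)"
    using plus_emeasure[of A lborel "U - A"] U(2) by (simp add: Un_absorb1)
  also have "\<dots> < \<infinity>" using U(3) A(2) by (auto simp: less_top[symmetric] top_unique)
  finally have fin: "emeasure lborel U < \<infinity>" .
  have "ennreal ((L2_norm (\<lambda>x. indicator A x - indicator U x))\<^sup>2) =
      (\<integral>\<^sup>+x. indicator (U - A) x \<partial>lborel)"
    unfolding nn_integral_L2[OF L2_diff[OF L2_indicator[OF A] L2_indicator[OF \<open>U \<in> sets borel\<close> fin]], symmetric]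
    by (rule nn_integral_cong) (use U(2) in \<open>auto simp: indicator_def\<close>)
  also have "\<dots> < ennreal (e\<^sup>2)" using U by simp
  finally have "(L2_norm (\<lambda>x. indicator A x - indicator U x))\<^sup>2 < e\<^sup>2"
    by (simp add: ennreal_less_iff)
  then have "L2_norm (\<lambda>x. indicator A x - indicator U x) < e"
    by (rule power2_less_imp_less) (use \<open>e > 0\<close> in simp)
  then show "\<exists>g\<in>L2. L2_norm (\<lambda>x. indicator A x - g x) < e \<and> translation_continuous z g"
    using L2_indicator[OF \<open>U \<in> sets borel\<close> fin] translation_continuous_indicator_open[OF U(1) fin z] by blast
qed

lemma translation_continuous_L2:
  assumes f: "f \<in> L2" and z: "z \<longlonglongrightarrow> 0"
  shows "translation_continuous z f"
proof (rule translation_continuous_closed[OF f])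
  have [measurable]: "f \<in> borel_measurable borel" using f by measurable
  have simple: "s \<in> L2 \<and> translation_continuous z s"
    if "simple_function lborel s" "emeasure lborel {y \<in> space lborel. s y \<noteq> 0} \<noteq> \<infinity>" for s
    using that
  proof (induction s rule: integrable_simple_function_induct)
    case (cong f g)
    then have "f = g" by (auto simp: fun_eq_iff)
    with cong show ?case by simp
  next
    case (indicator A y)
    have "(\<lambda>x. indicat_real A x *\<^sub>R y) = (\<lambda>x. y * indicator A x)"
      by (auto simp: indicator_def)
    then show ?case
      using L2_scale[OF L2_indicator[of A], of y] indicator
        translation_continuous_scale[OF translation_continuous_indicator[of A z], of y] z by simp
  next
    case (add f g)
    then show ?case by (auto intro: L2_add translation_continuous_add)
  qed
  obtain s where s: "\<And>i. simple_function lborel (s i)" "\<And>x. (\<lambda>i. s i x) \<longlonglongrightarrow> f x"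
      "\<And>i x. cmod (s i x) \<le> 2 * cmod (f x)"
    using borel_measurable_implies_sequence_metric[of f lborel 0] by auto
  have [measurable]: "s i \<in> borel_measurable borel" for i
    using borel_measurable_simple_function[OF s(1)] by simp
  have sL2: "s i \<in> L2" for i
    by (rule L2_dominated[OF f, of _ 2]) (auto simp: s)
  have tc: "translation_continuous z (s i)" for i
  proof (rule simple[OF s(1), THEN conjunct2])
    have "simple_function lborel (\<lambda>x. (s i x)\<^sup>2)" by (rule simple_function_compose1[OF s(1)])
    moreover have "(\<integral>\<^sup>+x. ennreal (norm ((s i x)\<^sup>2)) \<partial>lborel) < \<infinity>"
      using sL2[of i] by (simp add: norm_power L2_iff_nn_integral)
    ultimately have "Bochner_Integration.simple_bochner_integrable lborel (\<lambda>x. (s i x)\<^sup>2)"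
      using simple_bochner_integrableI_bounded[of lborel "\<lambda>x. (s i x)\<^sup>2"] by blast
    then show "emeasure lborel {y \<in> space lborel. s i y \<noteq> 0} \<noteq> \<infinity>"
      by (auto simp: Bochner_Integration.simple_bochner_integrable.simps)
  qed
  have "(\<lambda>i. \<integral>x. (cmod (f x - s i x))\<^sup>2 \<partial>lborel) \<longlonglongrightarrow> (\<integral>x. 0 \<partial>(lborel :: 'a measure))"
  proof (rule integral_dominated_convergence[where w="\<lambda>x. 9 * (cmod (f x))\<^sup>2"])
    show "AE x in lborel. (\<lambda>i. (cmod (f x - s i x))\<^sup>2) \<longlonglongrightarrow> 0"
    proof (rule AE_I2)
      fix x
      have "(\<lambda>i. (cmod (f x - s i x))\<^sup>2) \<longlonglongrightarrow> (cmod (f x - f x))\<^sup>2"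
        by (intro tendsto_intros s)
      then show "(\<lambda>i. (cmod (f x - s i x))\<^sup>2) \<longlonglongrightarrow> 0" by simp
    qed
    show "AE x in lborel. norm ((cmod (f x - s i x))\<^sup>2) \<le> 9 * (cmod (f x))\<^sup>2" for i
    proof (rule AE_I2)
      fix x
      have "cmod (f x - s i x) \<le> 3 * cmod (f x)"
        using norm_triangle_ineq4[of "f x" "s i x"] s(3)[of i x] by linarith
      then have "(cmod (f x - s i x))\<^sup>2 \<le> (3 * cmod (f x))\<^sup>2" by (rule power_mono) simp
      then show "norm ((cmod (f x - s i x))\<^sup>2) \<le> 9 * (cmod (f x))\<^sup>2" by (simp add: power_mult_distrib)
    qed
  qed (auto intro: L2_integrable f)
  then have "(\<lambda>i. L2_norm (\<lambda>x. f x - s i x)) \<longlonglongrightarrow> 0"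
    unfolding L2_norm_def using tendsto_real_sqrt[of _ 0] by simp
  then show "\<exists>g\<in>L2. L2_norm (\<lambda>x. f x - g x) < e \<and> translation_continuous z g" if "e > 0" for e
  proof -
    obtain i where "norm (L2_norm (\<lambda>x. f x - s i x) - 0) < e"
      using LIMSEQ_D[OF \<open>(\<lambda>i. L2_norm (\<lambda>x. f x - s i x)) \<longlonglongrightarrow> 0\<close> \<open>e > 0\<close>] by blast
    then show ?thesis using sL2[of i] tc[of i] by (intro bexI[of _ "s i"]) auto
  qed
qed

section \<open>Gaussians and their Fourier transform\<close>

lemma integrable_prod_Basis:
  fixes f :: "'a::euclidean_space \<Rightarrow> real \<Rightarrow> 'b::{real_normed_field,banach,second_countable_topology}"
  assumes f: "\<And>b. b \<in> Basis \<Longrightarrow> integrable lborel (f b)"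
  shows "integrable lborel (\<lambda>x. \<Prod>b\<in>Basis. f b (x \<bullet> b))"
    and integral_prod_Basis: "(\<integral>x. (\<Prod>b\<in>Basis. f b (x \<bullet> b)) \<partial>lborel) = (\<Prod>b\<in>Basis. \<integral>x. f b x \<partial>lborel)"
proof -
  interpret product_sigma_finite "\<lambda>_::'a. lborel :: real measure" ..
  have [measurable]: "b \<in> Basis \<Longrightarrow> f b \<in> borel_measurable borel" for b
    using borel_measurable_integrable[OF f] by simp
  have *: "(\<Prod>b\<in>Basis. f b ((\<Sum>b\<in>Basis. x b *\<^sub>R b) \<bullet> b)) = (\<Prod>b\<in>Basis. f b (x b))" for x
    by (rule prod.cong) auto
  have m: "(\<lambda>f. \<Sum>b\<in>Basis. f b *\<^sub>R b) \<in> (\<Pi>\<^sub>M b\<in>Basis. lborel) \<rightarrow>\<^sub>M (borel::'a measure)"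
    by measurable
  have m2: "(\<lambda>x. \<Prod>b\<in>Basis. f b (x \<bullet> b)) \<in> borel_measurable borel" by measurable
  show "integrable lborel (\<lambda>x. \<Prod>b\<in>Basis. f b (x \<bullet> b))"
    unfolding lborel_eq[where 'a='a] using product_integrable_prod[of Basis f, OF _ f]
    by (subst integrable_distr_eq[OF m m2]) (simp_all add: *)
  show "(\<integral>x. (\<Prod>b\<in>Basis. f b (x \<bullet> b)) \<partial>lborel) = (\<Prod>b\<in>Basis. \<integral>x. f b x \<partial>lborel)"
    unfolding lborel_eq[where 'a='a] using product_integral_prod[of Basis f, OF _ f]
    by (subst integral_distr[OF m m2]) (simp_all add: *)
qed

text \<open>
  The density of the standard normal distribution on a Euclidean space.
\<close>

definition gauss :: "'a::euclidean_space \<Rightarrow> real" where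
  "gauss x = (\<Prod>b\<in>Basis. std_normal_density (x \<bullet> b))"

lemma gauss_measurable [measurable]: "gauss \<in> borel_measurable borel"
  unfolding gauss_def[abs_def] by measurable

lemma gauss_nonneg: "gauss x \<ge> 0"
  unfolding gauss_def by (intro prod_nonneg) auto

lemma gauss_minus [simp]: "gauss (- x) = gauss x"
  unfolding gauss_def by (simp add: normal_density_def)

lemma gauss_eq: "gauss (x::'a::euclidean_space) = exp (- (norm x)\<^sup>2 / 2) / sqrt (2 * pi) ^ DIM('a)"
  unfolding gauss_def std_normal_density_def
  by (simp add: prod_dividef exp_sum[symmetric] sum_divide_distrib[symmetric] sum_negf
      norm_eq_sqrt_inner euclidean_inner[of x x] power2_eq_square real_sqrt_mult sum_nonneg)

lemma integrable_gauss: "integrable lborel (gauss :: 'a::euclidean_space \<Rightarrow> real)"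
  unfolding gauss_def[abs_def] by (rule integrable_prod_Basis) auto

lemma integral_gauss: "(\<integral>x. gauss (x::'a::euclidean_space) \<partial>lborel) = 1"
  unfolding gauss_def by (subst integral_prod_Basis) auto

lemma cis_sum: "finite I \<Longrightarrow> cis (\<Sum>i\<in>I. f i) = (\<Prod>i\<in>I. cis (f i))"
  by (induction I rule: finite_induct) (auto simp flip: cis_mult)

lemma cis_measurable [measurable]: "cis \<in> borel_measurable borel"
  by (intro borel_measurable_continuous_onI continuous_intros)

text \<open>
  The integrand is a product over the coordinates, which reduces the formula to the characteristic
  function of the standard normal distribution on the line.
\<close>

lemma char_gauss:
  "(\<integral>x. complex_of_real (gauss x) * cis (x \<bullet> t) \<partial>lborel) =
     complex_of_real (sqrt (2 * pi) ^ DIM('a) * gauss (t::'a::euclidean_space))"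
proof -
  have int: "integrable lborel (\<lambda>x. complex_of_real (std_normal_density x) * cis (x * s))" for s
    by (rule Bochner_Integration.integrable_bound[OF integrable_normal_density[where \<mu>=0 and \<sigma>=1]])

       (auto simp: norm_mult)
  have one: "(\<integral>x. complex_of_real (std_normal_density x) * cis (x * s) \<partial>lborel) =
      complex_of_real (exp (- s\<^sup>2 / 2))" for s
  proof -
    have "complex_of_real (exp (- s\<^sup>2 / 2)) = char std_normal_distribution s"
      by (simp add: char_std_normal_distribution)
    also have "\<dots> = (\<integral>x. std_normal_density x *\<^sub>R iexp (s * x) \<partial>lborel)"
      unfolding char_def by (subst integral_density) auto
    finally show ?thesis
      by (simp add: scaleR_conv_of_real cis_conv_exp mult.commute)
  qed
  have "complex_of_real (gauss x) * cis (x \<bullet> t) =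
      (\<Prod>b\<in>Basis. complex_of_real (std_normal_density (x \<bullet> b)) * cis ((x \<bullet> b) * (t \<bullet> b)))" for x
    unfolding gauss_def by (subst euclidean_inner) (simp add: cis_sum prod.distrib)
  then have "(\<integral>x. complex_of_real (gauss x) * cis (x \<bullet> t) \<partial>lborel) =
      (\<Prod>b\<in>Basis. complex_of_real (exp (- (t \<bullet> b)\<^sup>2 / 2)))"
    by (simp add: integral_prod_Basis[OF int] one)
  also have "\<dots> = complex_of_real (exp (- (norm t)\<^sup>2 / 2))"
    unfolding of_real_prod[symmetric]
    by (simp add: exp_sum[symmetric] sum_divide_distrib[symmetric] sum_negf
      norm_eq_sqrt_inner euclidean_inner[of t t] power2_eq_square real_sqrt_mult sum_nonneg)
  finally show ?thesis by (simp add: gauss_eq)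
qed

section \<open>Plancherel's theorem for integrable functions\<close>

lemma integrable_mult_bounded:
  fixes f :: "'b \<Rightarrow> complex"
  assumes "integrable M f" and [measurable]: "u \<in> borel_measurable M" and "\<And>x. cmod (u x) \<le> C"
  shows "integrable M (\<lambda>x. f x * u x)"
proof (rule Bochner_Integration.integrable_bound)
  show "integrable M (\<lambda>x. C * norm (f x))" using assms(1) by simp
  show "(\<lambda>x. f x * u x) \<in> borel_measurable M" using borel_measurable_integrable[OF assms(1)] by simp
  show "AE x in M. norm (f x * u x) \<le> norm (C * norm (f x))"
  proof (rule AE_I2)
    fix x
    have "C \<ge> 0" using assms(3)[of x] norm_ge_zero[of "u x"] by linarith
    then show "norm (f x * u x) \<le> norm (C * norm (f x))"
      using mult_right_mono[OF assms(3)[of x], of "cmod (f x)"] by (simp add: norm_mult mult.commute)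
  qed
qed

lemma integrable_pair_mult_bounded:
  fixes f h :: "'a::euclidean_space \<Rightarrow> complex"
  assumes f: "integrable lborel f" and h: "integrable lborel h"
    and [measurable]: "(\<lambda>(x, y). u x y) \<in> borel_measurable (borel \<Otimes>\<^sub>M borel)"
    and u: "\<And>x y. cmod (u x y) \<le> 1"
  shows "integrable (lborel \<Otimes>\<^sub>M lborel) (\<lambda>(x, y). f x * h y * u x y)"
proof -
  have [measurable]: "f \<in> borel_measurable borel" "h \<in> borel_measurable borel"
    using f h borel_measurable_integrable by fastforce+
  have "integrable (lborel \<Otimes>\<^sub>M lborel) (\<lambda>z. f (fst z) * h (snd z))"
  proof (rule lborel_pair.Fubini_integrable)
    show "integrable lborel (\<lambda>x. \<integral>y. cmod (f (fst (x, y)) * h (snd (x, y))) \<partial>lborel)"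
      using f by (simp add: norm_mult)
    show "AE x in lborel. integrable lborel (\<lambda>y. f (fst (x, y)) * h (snd (x, y)))"
      using h by simp
  qed measurable
  from integrable_mult_bounded[OF this, of "\<lambda>z. u (fst z) (snd z)" 1]
  show ?thesis using u by (simp add: case_prod_unfold)
qed

lemma fourier_integrand:
  "integrable lborel f \<Longrightarrow> integrable lborel (\<lambda>x. f x * cis (- 2 * pi * (x \<bullet> \<xi>)))"
  by (rule integrable_mult_bounded[where C=1]) auto

lemma fourier_measurable [measurable]:
  assumes [measurable]: "f \<in> borel_measurable borel"
  shows "fourier f \<in> borel_measurable borel"
  unfolding fourier_def[abs_def] by measurable

lemma fourier_bound: "cmod (fourier f \<xi>) \<le> (\<integral>x. cmod (f x) \<partial>lborel)"
  unfolding fourier_def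
  using integral_norm_bound[of lborel "\<lambda>x. f x * cis (- 2 * pi * (x \<bullet> \<xi>))"] by (simp add: norm_mult)

lemma fourier_multiplication_formula:
  fixes f h :: "'a::euclidean_space \<Rightarrow> complex"
  assumes f: "integrable lborel f" and h: "integrable lborel h"
  shows "(\<integral>\<xi>. fourier f \<xi> * h \<xi> \<partial>lborel) = (\<integral>x. f x * fourier h x \<partial>lborel)"
proof -
  have "integrable (lborel \<Otimes>\<^sub>M lborel) (\<lambda>(x::'a, \<xi>). f x * h \<xi> * cis (- 2 * pi * (x \<bullet> \<xi>)))"
    by (rule integrable_pair_mult_bounded[OF f h]) auto
  from lborel_pair.Fubini_integral[OF this]
  have "(\<integral>\<xi>. (\<integral>x. f x * h \<xi> * cis (- 2 * pi * (x \<bullet> \<xi>)) \<partial>lborel) \<partial>lborel) =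
    (\<integral>x. (\<integral>\<xi>. f x * h \<xi> * cis (- 2 * pi * (x \<bullet> \<xi>)) \<partial>lborel) \<partial>lborel)" .
  moreover have "(\<integral>x. f x * h \<xi> * cis (- 2 * pi * (x \<bullet> \<xi>)) \<partial>lborel) = fourier f \<xi> * h \<xi>" for \<xi>
    unfolding fourier_def integral_mult_left_zero[symmetric] by (simp add: mult_ac)
  moreover have "(\<integral>\<xi>. f x * h \<xi> * cis (- 2 * pi * (x \<bullet> \<xi>)) \<partial>lborel) = f x * fourier h x" for x
    unfolding fourier_def integral_mult_right_zero[symmetric] by (simp add: mult_ac inner_commute)
  ultimately show ?thesis by simp
qed

text \<open>
  The weight increases to 1 as \<open>\<epsilon>\<close> decreases to 0, and its Fourier transform is the rescaled
  Gaussian \<open>\<epsilon>^(-d) gauss (z / \<epsilon>)\<close> in dimension \<open>d\<close>, an approximate identity of integral 1.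
\<close>

definition gauss_weight :: "real \<Rightarrow> 'a::euclidean_space \<Rightarrow> real" where
  "gauss_weight \<epsilon> \<xi> = exp (- (2 * pi * \<epsilon> * norm \<xi>)\<^sup>2 / 2)"

lemma gauss_weight_measurable [measurable]: "gauss_weight \<epsilon> \<in> borel_measurable borel"
  unfolding gauss_weight_def[abs_def] by measurable

lemma gauss_weight_eq:
  "\<epsilon> > 0 \<Longrightarrow> gauss_weight \<epsilon> (\<xi>::'a::euclidean_space) = sqrt (2 * pi) ^ DIM('a) * gauss ((2 * pi * \<epsilon>) *\<^sub>R \<xi>)"
  by (simp add: gauss_weight_def gauss_eq abs_mult)

lemma integrable_gauss_weight:
  assumes "\<epsilon> > 0" shows "integrable lborel (gauss_weight \<epsilon> :: 'a::euclidean_space \<Rightarrow> real)"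
proof -
  have "integrable lborel (\<lambda>x::'a. gauss (0 + (2 * pi * \<epsilon>) *\<^sub>R x))"
    by (rule integrable_lborel_affine[OF integrable_gauss]) (use assms in auto)
  then have "integrable lborel (\<lambda>x::'a. sqrt (2 * pi) ^ DIM('a) * gauss ((2 * pi * \<epsilon>) *\<^sub>R x))"
    by simp
  then show ?thesis unfolding gauss_weight_eq[OF assms, abs_def] .
qed

lemma integral_gauss_weight_cis:
  fixes z :: "'a::euclidean_space"
  assumes \<epsilon>: "\<epsilon> > 0"
  shows "(\<integral>\<xi>. complex_of_real (gauss_weight \<epsilon> \<xi>) * cis (2 * pi * (\<xi> \<bullet> z)) \<partial>lborel) =
    complex_of_real (gauss ((1 / \<epsilon>) *\<^sub>R z) / \<epsilon> ^ DIM('a))"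
proof -
  let ?F = "\<lambda>v::'a. complex_of_real (gauss v) * cis (v \<bullet> ((1 / \<epsilon>) *\<^sub>R z))"
  let ?c = "2 * pi * \<epsilon>"
  let ?s = "sqrt (2 * pi) ^ DIM('a)"
  have ss: "?s * ?s = (2 * pi) ^ DIM('a)"
    unfolding power_mult_distrib[symmetric] real_sqrt_mult_self by simp
  have "integrable lborel ?F"
    by (rule integrable_mult_bounded[where C=1]) (use integrable_gauss in auto)
  then have "(\<integral>v. ?F v \<partial>lborel) = \<bar>?c\<bar> ^ DIM('a) *\<^sub>R (\<integral>\<xi>. ?F (0 + ?c *\<^sub>R \<xi>) \<partial>lborel)"
    by (rule integral_lborel_affine) (use \<epsilon> in simp)
  moreover have "?F (0 + ?c *\<^sub>R \<xi>) = complex_of_real (gauss (?c *\<^sub>R \<xi>)) * cis (2 * (pi * (\<xi> \<bullet> z)))" for \<xi>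
    using \<epsilon> by simp
  moreover have "\<bar>?c\<bar> = ?c" using \<epsilon> by simp
  ultimately have "complex_of_real (?s * gauss ((1 / \<epsilon>) *\<^sub>R z)) = complex_of_real (?c ^ DIM('a)) *
     (\<integral>\<xi>. complex_of_real (gauss (?c *\<^sub>R \<xi>)) * cis (2 * (pi * (\<xi> \<bullet> z))) \<partial>lborel)"
    by (simp only: char_gauss scaleR_conv_of_real)
  then have "complex_of_real ?s * complex_of_real (?s * gauss ((1 / \<epsilon>) *\<^sub>R z)) = complex_of_real (?c ^ DIM('a)) * (complex_of_real ?s *
     (\<integral>\<xi>. complex_of_real (gauss (?c *\<^sub>R \<xi>)) * cis (2 * (pi * (\<xi> \<bullet> z))) \<partial>lborel))"
    by (simp only: mult.left_commute)
  also have "complex_of_real ?s * (\<integral>\<xi>. complex_of_real (gauss (?c *\<^sub>R \<xi>)) * cis (2 * (pi * (\<xi> \<bullet> z))) \<partial>lborel) =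
      (\<integral>\<xi>. complex_of_real (gauss_weight \<epsilon> \<xi>) * cis (2 * pi * (\<xi> \<bullet> z)) \<partial>lborel)"
    unfolding integral_mult_right_zero[symmetric] gauss_weight_eq[OF \<epsilon>] of_real_mult mult.assoc ..
  also have "complex_of_real ?s * complex_of_real (?s * gauss ((1 / \<epsilon>) *\<^sub>R z)) =
     complex_of_real ((2 * pi) ^ DIM('a)) * complex_of_real (gauss ((1 / \<epsilon>) *\<^sub>R z))"
    unfolding ss[symmetric] by (simp only: of_real_mult mult.assoc)
  also have "complex_of_real (?c ^ DIM('a)) = complex_of_real ((2 * pi) ^ DIM('a)) * complex_of_real (\<epsilon> ^ DIM('a))"
    by (simp add: power_mult_distrib)
  finally have "complex_of_real (gauss ((1 / \<epsilon>) *\<^sub>R z)) = complex_of_real (\<epsilon> ^ DIM('a)) *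
      (\<integral>\<xi>. complex_of_real (gauss_weight \<epsilon> \<xi>) * cis (2 * pi * (\<xi> \<bullet> z)) \<partial>lborel)"
    unfolding mult.assoc by (subst (asm) mult_left_cancel) auto
  then show ?thesis using \<epsilon> by simp
qed

text \<open>
  Writing \<open>|g^|\<^sup>2 w = g^ h\<close> with \<open>h = w cnj g^\<close> for the weight \<open>w\<close>, the multiplication formula moves the
  transform from \<open>g\<close> to \<open>h\<close>. The transform of \<open>h\<close> is the convolution of \<open>cnj g\<close> with the
  approximate identity, and so the left-hand side is an average of autocorrelations of \<open>g\<close>
  over shifts of size \<open>\<epsilon>\<close>.
\<close>

lemma gauss_regularized_Plancherel:
  fixes g :: "'a::euclidean_space \<Rightarrow> complex"
  assumes g: "integrable lborel g" "g \<in> L2" and \<epsilon>: "\<epsilon> > 0"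
  shows "complex_of_real (\<integral>\<xi>. (cmod (fourier g \<xi>))\<^sup>2 * gauss_weight \<epsilon> \<xi> \<partial>lborel) =
    (\<integral>u. complex_of_real (gauss u) * L2_inner g (\<lambda>x. g (x - \<epsilon> *\<^sub>R u)) \<partial>lborel)"
proof -
  have [measurable]: "g \<in> borel_measurable borel" using g by measurable
  define h where "h \<xi> = complex_of_real (gauss_weight \<epsilon> \<xi>) * cnj (fourier g \<xi>)" for \<xi>
  have int_w: "integrable lborel (\<lambda>\<xi>::'a. complex_of_real (gauss_weight \<epsilon> \<xi>))"
    by (intro integrable_of_real integrable_gauss_weight \<epsilon>)
  have int_h: "integrable lborel h" unfolding h_def[abs_def]
    by (rule integrable_mult_bounded[OF int_w, where C="\<integral>x. cmod (g x) \<partial>lborel"]) (auto simp: fourier_bound)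
  have int_cg: "integrable lborel (\<lambda>y. cnj (g y))" using g by simp
  have fh: "fourier h x = (\<integral>u. cnj (g (x - \<epsilon> *\<^sub>R u)) * complex_of_real (gauss u) \<partial>lborel)" for x
  proof -
    let ?k = "\<lambda>y \<xi>. cnj (g y) * complex_of_real (gauss_weight \<epsilon> \<xi>) * cis (2 * pi * (\<xi> \<bullet> (y - x)))"
    have "fourier h x = (\<integral>\<xi>. (\<integral>y. ?k y \<xi> \<partial>lborel) \<partial>lborel)"
    proof -
      have "h \<xi> * cis (- 2 * pi * (\<xi> \<bullet> x)) = (\<integral>y. ?k y \<xi> \<partial>lborel)" for \<xi>
      proof -
        have "cnj (fourier g \<xi>) = (\<integral>y. cnj (g y) * cis (2 * pi * (y \<bullet> \<xi>)) \<partial>lborel)"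
          unfolding fourier_def Bochner_Integration.integral_cnj[symmetric] by (simp add: cis_cnj)
        then have "h \<xi> * cis (- 2 * pi * (\<xi> \<bullet> x)) = (\<integral>y. cnj (g y) * cis (2 * pi * (y \<bullet> \<xi>)) *
            (complex_of_real (gauss_weight \<epsilon> \<xi>) * cis (- 2 * pi * (\<xi> \<bullet> x))) \<partial>lborel)"
          unfolding h_def integral_mult_left_zero by simp
        also have "\<dots> = (\<integral>y. ?k y \<xi> \<partial>lborel)"
        proof (rule Bochner_Integration.integral_cong[OF refl])
          fix y
          have "cis (2 * pi * (\<xi> \<bullet> (y - x))) = cis (2 * pi * (y \<bullet> \<xi>)) * cis (- 2 * pi * (\<xi> \<bullet> x))"
            unfolding cis_mult by (simp add: inner_diff_right inner_commute algebra_simps)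
          then show "cnj (g y) * cis (2 * pi * (y \<bullet> \<xi>)) * (complex_of_real (gauss_weight \<epsilon> \<xi>) * cis (- 2 * pi * (\<xi> \<bullet> x)))
            = ?k y \<xi>" by simp
        qed
        finally show ?thesis .
      qed
      then show ?thesis unfolding fourier_def by simp
    qed
    also have "\<dots> = (\<integral>y. (\<integral>\<xi>. ?k y \<xi> \<partial>lborel) \<partial>lborel)"
      by (rule lborel_pair.Fubini_integral, rule integrable_pair_mult_bounded[OF int_cg int_w]) auto
    also have "\<dots> = (\<integral>y. cnj (g y) * complex_of_real (gauss ((1 / \<epsilon>) *\<^sub>R (y - x)) / \<epsilon> ^ DIM('a)) \<partial>lborel)"
      unfolding mult.assoc[of "cnj (g _)"] integral_mult_right_zero integral_gauss_weight_cis[OF \<epsilon>] ..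
    also have "\<dots> = \<bar>-\<epsilon>\<bar> ^ DIM('a) *\<^sub>R (\<integral>u. cnj (g (x + (-\<epsilon>) *\<^sub>R u)) *
        complex_of_real (gauss ((1 / \<epsilon>) *\<^sub>R (x + (-\<epsilon>) *\<^sub>R u - x)) / \<epsilon> ^ DIM('a)) \<partial>lborel)"
    proof (rule integral_lborel_affine)
      show "integrable lborel (\<lambda>y. cnj (g y) * complex_of_real (gauss ((1 / \<epsilon>) *\<^sub>R (y - x)) / \<epsilon> ^ DIM('a)))"
      proof (rule integrable_mult_bounded[OF int_cg])
        show "cmod (complex_of_real (gauss ((1 / \<epsilon>) *\<^sub>R (y - x)) / \<epsilon> ^ DIM('a))) \<le>
           1 / sqrt (2 * pi) ^ DIM('a) / \<epsilon> ^ DIM('a)" for y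
          unfolding norm_of_real using \<epsilon> gauss_nonneg[of "(1 / \<epsilon>) *\<^sub>R (y - x)"]
          by (simp only: abs_of_nonneg divide_nonneg_nonneg zero_le_power less_imp_le)
             (auto simp: gauss_eq intro!: divide_right_mono)
      qed measurable
    qed (use \<epsilon> in auto)
    also have "\<dots> = (\<integral>u. cnj (g (x - \<epsilon> *\<^sub>R u)) * complex_of_real (gauss u) \<partial>lborel)"
      using \<epsilon> by (simp add: scaleR_conv_of_real power_abs)
    finally show ?thesis .
  qed
  have "complex_of_real (\<integral>\<xi>. (cmod (fourier g \<xi>))\<^sup>2 * gauss_weight \<epsilon> \<xi> \<partial>lborel) =
      (\<integral>\<xi>. fourier g \<xi> * h \<xi> \<partial>lborel)"
    unfolding h_def integral_complex_of_real[symmetric] of_real_mult complex_norm_square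
    by (simp only: mult_ac)
  also have "\<dots> = (\<integral>x. g x * fourier h x \<partial>lborel)"
    by (rule fourier_multiplication_formula[OF g(1) int_h])
  also have "\<dots> = (\<integral>x. (\<integral>u. complex_of_real (gauss u) * (g x * cnj (g (x - \<epsilon> *\<^sub>R u))) \<partial>lborel) \<partial>lborel)"
    unfolding fh integral_mult_right_zero[symmetric] by (simp add: mult_ac)
  also have "\<dots> = (\<integral>u. (\<integral>x. complex_of_real (gauss u) * (g x * cnj (g (x - \<epsilon> *\<^sub>R u))) \<partial>lborel) \<partial>lborel)"
  proof (rule lborel_pair.Fubini_integral, rule lborel_pair.Fubini_integrable)
    let ?F = "\<lambda>(u, x). complex_of_real (gauss u) * (g x * cnj (g (x - \<epsilon> *\<^sub>R u)))"
    show m: "?F \<in> borel_measurable (lborel \<Otimes>\<^sub>M lborel)" by measurable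
    have int2: "integrable lborel (\<lambda>x. g x * cnj (g (x - z)))" for z
      using L2_inner_integrable[OF g(2) L2_translate[OF g(2)]] by simp
    then show "AE u in lborel. integrable lborel (\<lambda>x. ?F (u, x))" by simp
    show "integrable lborel (\<lambda>u. \<integral>x. norm (?F (u, x)) \<partial>lborel)"
    proof (rule Bochner_Integration.integrable_bound)
      show "integrable lborel (\<lambda>u::'a. gauss u * (L2_norm g)\<^sup>2)"
        by (intro integrable_mult_left integrable_gauss)
      have "(\<integral>x. cmod (g x * cnj (g (x - \<epsilon> *\<^sub>R u))) \<partial>lborel) \<le> (L2_norm g)\<^sup>2" for u
      proof -
        have 1: "(\<integral>x. cmod (g x * cnj (g (x - \<epsilon> *\<^sub>R u))) \<partial>lborel) =
            Re (L2_inner (\<lambda>x. complex_of_real (cmod (g x))) (\<lambda>x. complex_of_real (cmod (g (x - \<epsilon> *\<^sub>R u)))))"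
          unfolding L2_inner_def by (simp add: norm_mult flip: of_real_mult)
        have 2: "(\<lambda>x. complex_of_real (cmod (g x))) \<in> L2"
          by (rule L2_dominated[OF g(2), of _ 1]) auto
        have 3: "(\<lambda>x. complex_of_real (cmod (g (x - \<epsilon> *\<^sub>R u)))) \<in> L2"
          using L2_translate[OF 2] .
        have "Re (L2_inner (\<lambda>x. complex_of_real (cmod (g x))) (\<lambda>x. complex_of_real (cmod (g (x - \<epsilon> *\<^sub>R u)))))
          \<le> L2_norm (\<lambda>x. complex_of_real (cmod (g x))) * L2_norm (\<lambda>x. complex_of_real (cmod (g (x - \<epsilon> *\<^sub>R u))))"
          using complex_Re_le_cmod L2_Cauchy_Schwarz[OF 2 3] by (rule order_trans)
        also have "\<dots> = (L2_norm g)\<^sup>2"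
          using L2_norm_translate[OF 2] by (simp add: L2_norm_def)
        finally show ?thesis using 1 by simp
      qed
      then show "AE u in lborel. norm (\<integral>x. norm (?F (u, x)) \<partial>lborel) \<le> norm (gauss u * (L2_norm g)\<^sup>2)"
        by (auto simp: norm_mult[of "complex_of_real _"] gauss_nonneg abs_mult intro!: mult_left_mono)
    qed measurable
  qed
  also have "\<dots> = (\<integral>u. complex_of_real (gauss u) * L2_inner g (\<lambda>x. g (x - \<epsilon> *\<^sub>R u)) \<partial>lborel)"
    unfolding L2_inner_def by simp
  finally show ?thesis .
qed

text \<open>
  Let \<open>\<epsilon>\<close> tend to 0 in the regularised identity: the left-hand side converges monotonically and the
  right-hand side by continuity of translations.
\<close>

theorem Plancherel_L1_L2:
  fixes g :: "'a::euclidean_space \<Rightarrow> complex"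
  assumes g: "integrable lborel g" "g \<in> L2"
  shows "fourier g \<in> L2" and "L2_norm (fourier g) = L2_norm g"
proof -
  have [measurable]: "g \<in> borel_measurable borel" using g by measurable
  define e where "e n = 1 / real (Suc n)" for n
  have e: "e n > 0" "e n \<le> 1" for n by (auto simp: e_def)
  have e0: "e \<longlonglongrightarrow> 0" unfolding e_def by (rule LIMSEQ_Suc) (rule lim_1_over_n)
  let ?I = "\<lambda>n u. complex_of_real (gauss u) * L2_inner g (\<lambda>x. g (x - e n *\<^sub>R u))"
  have "(\<lambda>n. \<integral>u. ?I n u \<partial>lborel) \<longlonglongrightarrow> (\<integral>u. complex_of_real (gauss u) * L2_inner g g \<partial>(lborel :: 'a measure))"
  proof (rule integral_dominated_convergence)
    show "integrable lborel (\<lambda>u::'a. gauss u * (L2_norm g)\<^sup>2)"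
      by (intro integrable_mult_left integrable_gauss)
    show "AE u in lborel. norm (?I n u) \<le> gauss u * (L2_norm g)\<^sup>2" for n
      using L2_Cauchy_Schwarz[OF g(2) L2_translate[OF g(2)]]
      by (auto simp: norm_mult gauss_nonneg L2_norm_translate[OF g(2)] power2_eq_square intro!: mult_left_mono)
    show "AE u in lborel. (\<lambda>n. ?I n u) \<longlonglongrightarrow> complex_of_real (gauss u) * L2_inner g g"
    proof (rule AE_I2, rule tendsto_mult_left)
      fix u :: 'a
      have "(\<lambda>n. e n *\<^sub>R u) \<longlonglongrightarrow> 0" using tendsto_scaleR[OF e0 tendsto_const[of u]] by simp
      from translation_continuous_L2[OF g(2) this]
      show "(\<lambda>n. L2_inner g (\<lambda>x. g (x - e n *\<^sub>R u))) \<longlonglongrightarrow> L2_inner g g"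
        unfolding translation_continuous_def
        by (intro L2_inner_limit g L2_translate) (simp_all add: L2_norm_def)
    qed
  qed (auto simp: L2_inner_def)
  also have "(\<integral>u. complex_of_real (gauss u) * L2_inner g g \<partial>(lborel :: 'a measure)) = complex_of_real ((L2_norm g)\<^sup>2)"
    by (simp add: integral_gauss L2_inner_self)
  finally have "(\<lambda>n. complex_of_real (\<integral>\<xi>. (cmod (fourier g \<xi>))\<^sup>2 * gauss_weight (e n) \<xi> \<partial>lborel)) \<longlonglongrightarrow>
      complex_of_real ((L2_norm g)\<^sup>2)"
    using gauss_regularized_Plancherel[OF g e(1)] by simp
  then have lim: "(\<lambda>n. \<integral>\<xi>. (cmod (fourier g \<xi>))\<^sup>2 * gauss_weight (e n) \<xi> \<partial>lborel) \<longlonglongrightarrow> (L2_norm g)\<^sup>2"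
    by (simp only: tendsto_of_real_iff)
  have int: "integrable lborel (\<lambda>\<xi>. (cmod (fourier g \<xi>))\<^sup>2 * gauss_weight (e n) \<xi>)" for n
  proof (rule Bochner_Integration.integrable_bound)
    show "integrable lborel (\<lambda>\<xi>::'a. (\<integral>x. cmod (g x) \<partial>lborel)\<^sup>2 * gauss_weight (e n) \<xi>)"
      by (intro integrable_mult_right integrable_gauss_weight e)
    show "AE \<xi> in lborel. norm ((cmod (fourier g \<xi>))\<^sup>2 * gauss_weight (e n) \<xi>) \<le>
       norm ((\<integral>x. cmod (g x) \<partial>lborel)\<^sup>2 * gauss_weight (e n) \<xi>)"
      by (auto simp: abs_mult intro!: mult_right_mono power_mono fourier_bound)
  qed measurable
  have mono: "mono (\<lambda>n. (cmod (fourier g \<xi>))\<^sup>2 * gauss_weight (e n) \<xi>)" for \<xi>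
  proof (rule monoI, rule mult_left_mono)
    fix m n :: nat assume "m \<le> n"
    then have "e n \<le> e m" by (simp add: e_def frac_le)
    then show "gauss_weight (e m) \<xi> \<le> gauss_weight (e n) \<xi>"
      unfolding gauss_weight_def using e by (auto intro!: power_mono mult_right_mono divide_right_mono simp: less_imp_le)
  qed simp
  have conv: "(\<lambda>n. (cmod (fourier g \<xi>))\<^sup>2 * gauss_weight (e n) \<xi>) \<longlonglongrightarrow> (cmod (fourier g \<xi>))\<^sup>2" for \<xi>
  proof -
    have "(\<lambda>n. (cmod (fourier g \<xi>))\<^sup>2 * gauss_weight (e n) \<xi>) \<longlonglongrightarrow>
        (cmod (fourier g \<xi>))\<^sup>2 * exp (- (2 * pi * 0 * norm \<xi>)\<^sup>2 / 2)"
      unfolding gauss_weight_def by (intro tendsto_intros e0) auto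
    then show ?thesis by simp
  qed
  have m: "(\<lambda>\<xi>. (cmod (fourier g \<xi>))\<^sup>2) \<in> borel_measurable lborel" by measurable
  have "integrable lborel (\<lambda>\<xi>. (cmod (fourier g \<xi>))\<^sup>2)"
    by (rule integrable_monotone_convergence[OF int _ _ lim m]) (use mono conv in auto)
  then show "fourier g \<in> L2" by (intro L2I) measurable
  have "(\<integral>\<xi>. (cmod (fourier g \<xi>))\<^sup>2 \<partial>lborel) = (L2_norm g)\<^sup>2"
    by (rule integral_monotone_convergence[OF int _ _ lim m]) (use mono conv in auto)
  then have "(L2_norm (fourier g))\<^sup>2 = (L2_norm g)\<^sup>2" by (simp add: L2_norm_power2)
  then show "L2_norm (fourier g) = L2_norm g" by simp
qed

section \<open>The Fourier transform on square-integrable functions\<close>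

lemma fourier_add_scale:
  assumes "integrable lborel f" "integrable lborel g"
  shows "fourier (\<lambda>x. f x + c * g x) \<xi> = fourier f \<xi> + c * fourier g \<xi>"
proof -
  have "fourier (\<lambda>x. f x + c * g x) \<xi> =
      (\<integral>x. f x * cis (- 2 * pi * (x \<bullet> \<xi>)) + c * (g x * cis (- 2 * pi * (x \<bullet> \<xi>))) \<partial>lborel)"
    unfolding fourier_def by (rule Bochner_Integration.integral_cong) (auto simp: algebra_simps)
  also have "\<dots> = fourier f \<xi> + c * fourier g \<xi>"
    unfolding fourier_def using fourier_integrand[OF assms(1), of \<xi>] fourier_integrand[OF assms(2), of \<xi>]
    by (subst Bochner_Integration.integral_add) auto
  finally show ?thesis .
qed

lemma has_fourier_L2_iff:
  "has_fourier_L2 f F \<longleftrightarrow> f \<in> L2 \<and> F \<in> L2 \<and>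
     (\<exists>g. (\<forall>n. integrable lborel (g n) \<and> g n \<in> L2) \<and>
       (\<lambda>n. L2_norm (\<lambda>x. g n x - f x)) \<longlonglongrightarrow> 0 \<and>
       (\<lambda>n. L2_norm (\<lambda>\<xi>. fourier (g n) \<xi> - F \<xi>)) \<longlonglongrightarrow> 0)"
proof -
  have "L2_tendsto g f sequentially \<longleftrightarrow> (\<lambda>n. L2_norm (\<lambda>x. g n x - f x)) \<longlonglongrightarrow> 0"
       "L2_tendsto (\<lambda>n. fourier (g n)) F sequentially \<longleftrightarrow>
          (\<lambda>n. L2_norm (\<lambda>\<xi>. fourier (g n) \<xi> - F \<xi>)) \<longlonglongrightarrow> 0"
    if "\<forall>n. integrable lborel (g n) \<and> g n \<in> L2" "f \<in> L2" "F \<in> L2" for g :: "nat \<Rightarrow> 'a \<Rightarrow> complex"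
    using that by (auto intro!: L2_tendsto_iff always_eventually Plancherel_L1_L2)
  then show ?thesis unfolding has_fourier_L2_def by blast
qed

lemma has_fourier_L2D:
  assumes "has_fourier_L2 f F" shows "f \<in> L2" "F \<in> L2"
  using assms by (simp_all add: has_fourier_L2_def)

lemma has_fourier_L2_add_scale:
  fixes f :: "'a::euclidean_space \<Rightarrow> complex"
  assumes "has_fourier_L2 f F" and "has_fourier_L2 g G"
  shows "has_fourier_L2 (\<lambda>x. f x + c * g x) (\<lambda>\<xi>. F \<xi> + c * G \<xi>)"
proof -
  note L2 = has_fourier_L2D[OF assms(1)] has_fourier_L2D[OF assms(2)]
  from assms(1) obtain u where u: "\<And>n. integrable lborel (u n)" "\<And>n. u n \<in> L2"
      "(\<lambda>n. L2_norm (\<lambda>x. u n x - f x)) \<longlonglongrightarrow> 0" "(\<lambda>n. L2_norm (\<lambda>\<xi>. fourier (u n) \<xi> - F \<xi>)) \<longlonglongrightarrow> 0"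
    unfolding has_fourier_L2_iff by blast
  from assms(2) obtain v where v: "\<And>n. integrable lborel (v n)" "\<And>n. v n \<in> L2"
      "(\<lambda>n. L2_norm (\<lambda>x. v n x - g x)) \<longlonglongrightarrow> 0" "(\<lambda>n. L2_norm (\<lambda>\<xi>. fourier (v n) \<xi> - G \<xi>)) \<longlonglongrightarrow> 0"
    unfolding has_fourier_L2_iff by blast
  have lim: "(\<lambda>n. L2_norm (\<lambda>x. a n x + c * b n x - (a' x + c * b' x))) \<longlonglongrightarrow> 0"
    if a: "\<And>n. a n \<in> L2" "a' \<in> L2" "(\<lambda>n. L2_norm (\<lambda>x. a n x - a' x)) \<longlonglongrightarrow> 0"
      and b: "\<And>n. b n \<in> L2" "b' \<in> L2" "(\<lambda>n. L2_norm (\<lambda>x. b n x - b' x)) \<longlonglongrightarrow> 0"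
    for a b :: "nat \<Rightarrow> 'a \<Rightarrow> complex" and a' b'
  proof (rule Lim_null_comparison[OF always_eventually], rule allI)
    fix n
    have "L2_norm (\<lambda>x. (a n x - a' x) + c * (b n x - b' x)) \<le>
        L2_norm (\<lambda>x. a n x - a' x) + L2_norm (\<lambda>x. c * (b n x - b' x))"
      by (intro L2_norm_triangle L2_scale L2_diff a b)
    then show "norm (L2_norm (\<lambda>x. a n x + c * b n x - (a' x + c * b' x))) \<le>
        L2_norm (\<lambda>x. a n x - a' x) + cmod c * L2_norm (\<lambda>x. b n x - b' x)"
      unfolding L2_norm_scale by (simp add: algebra_simps)
  next
    show "(\<lambda>n. L2_norm (\<lambda>x. a n x - a' x) + cmod c * L2_norm (\<lambda>x. b n x - b' x)) \<longlonglongrightarrow> 0"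
      using tendsto_add[OF a(3) tendsto_mult_left[OF b(3), of "cmod c"]] by simp
  qed
  have fe: "fourier (\<lambda>x. u n x + c * v n x) = (\<lambda>\<xi>. fourier (u n) \<xi> + c * fourier (v n) \<xi>)" for n
    using fourier_add_scale[OF u(1) v(1)] by auto
  show ?thesis unfolding has_fourier_L2_iff
  proof (intro conjI exI[of _ "\<lambda>n x. u n x + c * v n x"] allI)
    show "(\<lambda>n. L2_norm (\<lambda>x. u n x + c * v n x - (f x + c * g x))) \<longlonglongrightarrow> 0"
      by (intro lim u v L2)
    show "(\<lambda>n. L2_norm (\<lambda>\<xi>. fourier (\<lambda>x. u n x + c * v n x) \<xi> - (F \<xi> + c * G \<xi>))) \<longlonglongrightarrow> 0"
      unfolding fe by (intro lim Plancherel_L1_L2 u v L2)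
  qed (intro L2_add L2_scale Bochner_Integration.integrable_add integrable_mult_right u v L2)+
qed

lemma has_fourier_L2_norm:
  assumes "has_fourier_L2 f F" shows "L2_norm F = L2_norm f"
proof -
  note L2 = has_fourier_L2D[OF assms]
  from assms obtain u where u: "\<And>n. integrable lborel (u n)" "\<And>n. u n \<in> L2"
      "(\<lambda>n. L2_norm (\<lambda>x. u n x - f x)) \<longlonglongrightarrow> 0" "(\<lambda>n. L2_norm (\<lambda>\<xi>. fourier (u n) \<xi> - F \<xi>)) \<longlonglongrightarrow> 0"
    unfolding has_fourier_L2_iff by blast
  have "(\<lambda>n. L2_norm (fourier (u n))) \<longlonglongrightarrow> L2_norm F"
    by (rule L2_norm_limit) (intro Plancherel_L1_L2 u L2)+
  moreover have "(\<lambda>n. L2_norm (u n)) \<longlonglongrightarrow> L2_norm f"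
    by (rule L2_norm_limit) (intro u L2)+
  ultimately show ?thesis
    using Plancherel_L1_L2(2)[OF u(1,2)] by (auto dest: LIMSEQ_unique)
qed

theorem has_fourier_L2_inner:
  assumes "has_fourier_L2 f F" and "has_fourier_L2 g G"
  shows "L2_inner F G = L2_inner f g"
proof -
  have "L2_norm (\<lambda>\<xi>. F \<xi> + c * G \<xi>) = L2_norm (\<lambda>x. f x + c * g x)" for c
    by (rule has_fourier_L2_norm[OF has_fourier_L2_add_scale[OF assms]])
  then have "4 * L2_inner F G = 4 * L2_inner f g"
    using has_fourier_L2D[OF assms(1)] has_fourier_L2D[OF assms(2)]
    by (simp only: L2_polarization)
  then show ?thesis by simp
qed

lemma has_fourier_L2_unique:
  assumes "has_fourier_L2 f F" and "has_fourier_L2 f G"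
  shows "AE \<xi> in lborel. F \<xi> = G \<xi>"
proof -
  have "L2_norm (\<lambda>\<xi>. F \<xi> + (-1) * G \<xi>) = L2_norm (\<lambda>x. f x + (-1) * f x)"
    by (rule has_fourier_L2_norm[OF has_fourier_L2_add_scale[OF assms]])
  then have "L2_norm (\<lambda>\<xi>. F \<xi> - G \<xi>) = 0" by (simp add: L2_norm_def)
  then show ?thesis using has_fourier_L2D[OF assms(1)] has_fourier_L2D[OF assms(2)]
    by (simp add: L2_norm_diff_eq_0_iff)
qed

lemma has_fourier_L2_cong_AE:
  fixes f :: "'a::euclidean_space \<Rightarrow> complex"
  assumes "has_fourier_L2 f F" and "AE \<xi> in lborel. F \<xi> = G \<xi>" and G: "G \<in> L2"
  shows "has_fourier_L2 f G"
proof -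
  note L2 = has_fourier_L2D[OF assms(1)]
  have *: "L2_norm (\<lambda>\<xi>. h \<xi> - F \<xi>) = L2_norm (\<lambda>\<xi>. h \<xi> - G \<xi>)" if "h \<in> L2" for h
  proof (rule L2_norm_cong_AE)
    show "AE x in lborel. cmod (h x - F x) = cmod (h x - G x)" using assms(2) by eventually_elim simp
  qed (intro L2_measurable L2_diff that L2 G)+
  have "L2_norm (\<lambda>\<xi>. fourier u \<xi> - F \<xi>) = L2_norm (\<lambda>\<xi>. fourier u \<xi> - G \<xi>)"
    if "integrable lborel u" "u \<in> L2" for u
    by (rule *) (intro Plancherel_L1_L2 that)
  then have "(\<lambda>n. L2_norm (\<lambda>\<xi>. fourier (u n) \<xi> - F \<xi>)) = (\<lambda>n. L2_norm (\<lambda>\<xi>. fourier (u n) \<xi> - G \<xi>))"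
    if "\<forall>n. integrable lborel (u n) \<and> u n \<in> L2" for u :: "nat \<Rightarrow> 'a \<Rightarrow> complex"
    using that by blast
  moreover obtain u where "\<forall>n. integrable lborel (u n) \<and> u n \<in> L2"
      "(\<lambda>n. L2_norm (\<lambda>x. u n x - f x)) \<longlonglongrightarrow> 0" "(\<lambda>n. L2_norm (\<lambda>\<xi>. fourier (u n) \<xi> - F \<xi>)) \<longlonglongrightarrow> 0"
    using assms(1) unfolding has_fourier_L2_iff by blast
  ultimately show ?thesis unfolding has_fourier_L2_iff using L2 G by (intro conjI exI[of _ u]) simp_all
qed

lemma L2_integrable_on_finite:
  fixes f :: "'a::euclidean_space \<Rightarrow> complex"
  assumes f: "f \<in> L2" and A: "A \<in> sets borel" "emeasure lborel A < \<infinity>"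
  shows "integrable lborel (\<lambda>x. f x * indicator A x)"
proof -
  have "cnj (indicator A x) = indicator A x" for x :: 'a by (simp add: indicator_def)
  then show ?thesis using L2_inner_integrable[OF f L2_indicator[OF A]] by simp
qed

text \<open>
  The truncations of \<open>f\<close> to balls are integrable and converge to \<open>f\<close>. By Plancherel's theorem their
  transforms form a Cauchy sequence.
\<close>

theorem has_fourier_L2_exists:
  fixes f :: "'a::euclidean_space \<Rightarrow> complex"
  assumes f: "f \<in> L2" shows "\<exists>F. has_fourier_L2 f F"
proof -
  have [measurable]: "f \<in> borel_measurable borel" using f by measurable
  define u where "u n x = f x * indicator (cball 0 (real n)) x" for n x
  have [measurable]: "u n \<in> borel_measurable borel" for n
    unfolding u_def[abs_def] by (intro borel_measurable_times borel_measurable_indicator) auto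
  have u1: "integrable lborel (u n)" for n
    unfolding u_def by (rule L2_integrable_on_finite[OF f]) (use emeasure_lborel_cball_finite in auto)
  have u2: "u n \<in> L2" for n
    by (rule L2_dominated[OF f, where C=1]) (auto simp: u_def indicator_def)
  have "(\<lambda>n. \<integral>x. (cmod (u n x - f x))\<^sup>2 \<partial>lborel) \<longlonglongrightarrow> (\<integral>x. 0 \<partial>(lborel :: 'a measure))"
  proof (rule integral_dominated_convergence[where w="\<lambda>x. (cmod (f x))\<^sup>2"])
    show "AE x in lborel. (\<lambda>n. (cmod (u n x - f x))\<^sup>2) \<longlonglongrightarrow> 0"
    proof (rule AE_I2)
      fix x :: 'a
      obtain N :: nat where N: "norm x \<le> real N" using real_arch_simple by blast
      have "eventually (\<lambda>n. (cmod (u n x - f x))\<^sup>2 = 0) sequentially"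
        using eventually_ge_at_top[of N]
        by eventually_elim (use N in \<open>auto simp: u_def indicator_def\<close>)
      then show "(\<lambda>n. (cmod (u n x - f x))\<^sup>2) \<longlonglongrightarrow> 0" by (rule tendsto_eventually)
    qed
  qed (auto simp: u_def indicator_def intro: L2_integrable f)
  then have lim: "(\<lambda>n. L2_norm (\<lambda>x. u n x - f x)) \<longlonglongrightarrow> 0"
    unfolding L2_norm_def using tendsto_real_sqrt[of _ 0] by simp
  have diff: "L2_norm (\<lambda>\<xi>. fourier (u m) \<xi> - fourier (u n) \<xi>) = L2_norm (\<lambda>x. u m x - u n x)" for m n
  proof -
    have "fourier (\<lambda>x. u m x + (-1) * u n x) = (\<lambda>\<xi>. fourier (u m) \<xi> + (-1) * fourier (u n) \<xi>)"
      using fourier_add_scale[OF u1 u1] by blast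
    then show ?thesis
      using Plancherel_L1_L2(2)[of "\<lambda>x. u m x + (-1) * u n x"] u1 u2 by (simp add: L2_diff)
  qed
  obtain F where F: "F \<in> L2" "(\<lambda>n. L2_norm (\<lambda>\<xi>. fourier (u n) \<xi> - F \<xi>)) \<longlonglongrightarrow> 0"
  proof (rule L2_complete[of "\<lambda>n. fourier (u n)"])
    show "fourier (u n) \<in> L2" for n by (intro Plancherel_L1_L2 u1 u2)
    fix e :: real assume "e > 0"
    then obtain N where N: "\<And>n. n \<ge> N \<Longrightarrow> L2_norm (\<lambda>x. u n x - f x) < e/2"
      using LIMSEQ_D[OF lim, of "e/2"] by auto
    have "L2_norm (\<lambda>x. u m x - u n x) < e" if "m \<ge> N" "n \<ge> N" for m n
      using L2_norm_triangle_diff[OF u2 f u2, of m n] N[OF that(1)] N[OF that(2)]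
        L2_norm_minus_commute[of f "u n"] by simp
    then show "\<exists>N. \<forall>m\<ge>N. \<forall>n\<ge>N. L2_norm (\<lambda>\<xi>. fourier (u m) \<xi> - fourier (u n) \<xi>) < e"
      unfolding diff by blast
  qed
  then show ?thesis unfolding has_fourier_L2_iff using f u1 u2 lim by blast
qed

text \<open>
  The multiplication formula extends to \<open>L\<^sup>2\<close> by continuity and identifies the adjoint \<open>T\<^sup>*\<close> of the
  Fourier transform \<open>T\<close> as \<open>g \<mapsto> cnj (T (cnj g))\<close>.
\<close>

lemma has_fourier_L2_adjoint:
  fixes f :: "'a::euclidean_space \<Rightarrow> complex"
  assumes "has_fourier_L2 f F" and "has_fourier_L2 (\<lambda>x. cnj (g x)) G"
  shows "L2_inner F g = L2_inner f (\<lambda>x. cnj (G x))"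
proof -
  have g: "g \<in> L2" using L2_cnj[OF has_fourier_L2D(1)[OF assms(2)]] by simp
  note L2 = has_fourier_L2D[OF assms(1)] has_fourier_L2D[OF assms(2)] g
  from assms(1) obtain u where u: "\<And>n. integrable lborel (u n)" "\<And>n. u n \<in> L2"
      "(\<lambda>n. L2_norm (\<lambda>x. u n x - f x)) \<longlonglongrightarrow> 0" "(\<lambda>n. L2_norm (\<lambda>\<xi>. fourier (u n) \<xi> - F \<xi>)) \<longlonglongrightarrow> 0"
    unfolding has_fourier_L2_iff by blast
  from assms(2) obtain v where v: "\<And>n. integrable lborel (v n)" "\<And>n. v n \<in> L2"
      "(\<lambda>n. L2_norm (\<lambda>x. v n x - cnj (g x))) \<longlonglongrightarrow> 0" "(\<lambda>n. L2_norm (\<lambda>\<xi>. fourier (v n) \<xi> - G \<xi>)) \<longlonglongrightarrow> 0"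
    unfolding has_fourier_L2_iff by blast
  have c: "L2_norm (\<lambda>x. cnj (a x) - cnj (b x)) = L2_norm (\<lambda>x. a x - b x)" for a b :: "'a \<Rightarrow> complex"
    using L2_norm_cnj[of "\<lambda>x. a x - b x"] by simp
  have c': "L2_norm (\<lambda>x. cnj (a x) - b x) = L2_norm (\<lambda>x. a x - cnj (b x))" for a b :: "'a \<Rightarrow> complex"
    using c[of a "\<lambda>x. cnj (b x)"] by simp
  have "L2_inner (fourier (u n)) (\<lambda>x. cnj (v n x)) = L2_inner (u n) (\<lambda>x. cnj (fourier (v n) x))" for n
    unfolding L2_inner_def using fourier_multiplication_formula[OF u(1) v(1)] by simp
  moreover have "(\<lambda>n. L2_inner (fourier (u n)) (\<lambda>x. cnj (v n x))) \<longlonglongrightarrow> L2_inner F g"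
    by (intro L2_inner_limit Plancherel_L1_L2 u L2_cnj v L2) (use v(3) in \<open>simp add: c'\<close>)
  moreover have "(\<lambda>n. L2_inner (u n) (\<lambda>x. cnj (fourier (v n) x))) \<longlonglongrightarrow> L2_inner f (\<lambda>x. cnj (G x))"
    by (intro L2_inner_limit Plancherel_L1_L2 u L2_cnj v L2) (use v(4) in \<open>simp add: c\<close>)
  ultimately show ?thesis using LIMSEQ_unique by auto
qed

text \<open>
  Both \<open>T\<close> and \<open>T\<^sup>*\<close> are isometries, so for \<open>H = T (T\<^sup>* F)\<close> one has \<open>\<parallel>H\<parallel> = \<parallel>F\<parallel>\<close> and
  \<open>\<langle>H, F\<rangle> = \<parallel>T\<^sup>* F\<parallel>\<^sup>2 = \<parallel>F\<parallel>\<^sup>2\<close>. Hence \<open>\<parallel>H - F\<parallel> = 0\<close>, and \<open>T\<^sup>* F\<close> is a preimage of \<open>F\<close>.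
\<close>

theorem has_fourier_L2_surj:
  assumes F: "F \<in> L2" shows "\<exists>f. has_fourier_L2 f F"
proof -
  obtain G where G: "has_fourier_L2 (\<lambda>x. cnj (F x)) G"
    using has_fourier_L2_exists[OF L2_cnj[OF F]] by blast
  have f: "(\<lambda>x. cnj (G x)) \<in> L2" using has_fourier_L2D(2)[OF G] by (rule L2_cnj)
  obtain H where H: "has_fourier_L2 (\<lambda>x. cnj (G x)) H"
    using has_fourier_L2_exists[OF f] by blast
  have "L2_norm G = L2_norm F" using has_fourier_L2_norm[OF G] by simp
  moreover have "L2_norm H = L2_norm G" using has_fourier_L2_norm[OF H] by simp
  moreover have "L2_inner H F = complex_of_real ((L2_norm G)\<^sup>2)"
    using has_fourier_L2_adjoint[OF H G] L2_inner_self[of "\<lambda>x. cnj (G x)"] by simp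
  ultimately have "(L2_norm (\<lambda>x. H x - F x))\<^sup>2 = 0"
    using L2_norm_diff_power2[OF has_fourier_L2D(2)[OF H] F] by simp
  then have "AE x in lborel. H x = F x"
    using L2_norm_diff_eq_0_iff[OF has_fourier_L2D(2)[OF H] F] by simp
  from has_fourier_L2_cong_AE[OF H this F] show ?thesis by blast
qed

lemma has_fourier_L2_fourier_L2: "f \<in> L2 \<Longrightarrow> has_fourier_L2 f (fourier_L2 f)"
  unfolding fourier_L2_def using someI_ex[OF has_fourier_L2_exists] .

lemma has_fourier_L2_inv_fourier_L2: "F \<in> L2 \<Longrightarrow> has_fourier_L2 (inv_fourier_L2 F) F"
  unfolding inv_fourier_L2_def using someI_ex[OF has_fourier_L2_surj] .

lemma fourier_L2_in_L2: "f \<in> L2 \<Longrightarrow> fourier_L2 f \<in> L2"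
  using has_fourier_L2D(2)[OF has_fourier_L2_fourier_L2] .

lemma inv_fourier_L2_in_L2: "F \<in> L2 \<Longrightarrow> inv_fourier_L2 F \<in> L2"
  using has_fourier_L2D(1)[OF has_fourier_L2_inv_fourier_L2] .

lemma L2_norm_fourier_L2: "f \<in> L2 \<Longrightarrow> L2_norm (fourier_L2 f) = L2_norm f"
  by (rule has_fourier_L2_norm[OF has_fourier_L2_fourier_L2])

lemma fourier_L2_inv_fourier_L2:
  "F \<in> L2 \<Longrightarrow> AE \<xi> in lborel. fourier_L2 (inv_fourier_L2 F) \<xi> = F \<xi>"
  by (rule has_fourier_L2_unique[OF has_fourier_L2_fourier_L2 has_fourier_L2_inv_fourier_L2])
     (auto intro: inv_fourier_L2_in_L2)

section \<open>Fourier series on the unit cube\<close>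

lemma L2_Bessel:
  assumes e: "\<And>k. k \<in> J \<Longrightarrow> e k \<in> L2" and J: "finite J"
    and orth: "\<And>k m. k \<in> J \<Longrightarrow> m \<in> J \<Longrightarrow> L2_inner (e k) (e m) = (if k = m then 1 else 0)"
    and h: "h \<in> L2"
  shows "(\<Sum>k\<in>J. (cmod (L2_inner h (e k)))\<^sup>2) \<le> (L2_norm h)\<^sup>2"
proof -
  define c where "c k = L2_inner h (e k)" for k
  define p where "p = (\<lambda>x. \<Sum>k\<in>J. c k * e k x)"
  let ?s = "\<Sum>k\<in>J. (cmod (c k))\<^sup>2"
  have p: "p \<in> L2" unfolding p_def by (intro L2_sum L2_scale e)
  have inner_p: "L2_inner g p = (\<Sum>k\<in>J. cnj (c k) * L2_inner g (e k))" if "g \<in> L2" for g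
    unfolding p_def using that e
    by (subst L2_inner_sum_right) (auto intro: L2_scale simp: L2_inner_scale_right)
  have hp: "L2_inner h p = complex_of_real ?s"
    unfolding inner_p[OF h] of_real_sum complex_norm_square c_def by (simp add: mult.commute)
  have ep: "L2_inner (e m) p = cnj (c m)" if "m \<in> J" for m
  proof -
    have "L2_inner (e m) p = (\<Sum>k\<in>J. if k = m then cnj (c k) else 0)"
      unfolding inner_p[OF e[OF that]] by (rule sum.cong) (auto simp: orth that)
    also have "\<dots> = cnj (c m)" using that J by simp
    finally show ?thesis .
  qed
  have "L2_inner p p = (\<Sum>k\<in>J. cnj (c k) * cnj (L2_inner (e k) p))"
    unfolding inner_p[OF p] by (rule sum.cong[OF refl], subst L2_inner_commute) simp
  also have "\<dots> = complex_of_real ?s"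
    unfolding of_real_sum complex_norm_square by (rule sum.cong) (auto simp: ep mult.commute)
  finally have "(L2_norm p)\<^sup>2 = ?s"
    unfolding L2_inner_self of_real_eq_iff .
  then have "(L2_norm (\<lambda>x. h x - p x))\<^sup>2 = (L2_norm h)\<^sup>2 - ?s"
    using L2_norm_diff_power2[OF h p] hp by simp
  moreover have "0 \<le> (L2_norm (\<lambda>x. h x - p x))\<^sup>2" by simp
  ultimately show ?thesis unfolding c_def by linarith
qed

definition int_vec :: "int^'n \<Rightarrow> real^'n" where
  "int_vec k = (\<chi> i. real_of_int (k $ i))"

text \<open>
  Two fundamental domains of the integer lattice are used: \<open>cube\<close>, which carries the functions to be
  expanded, and the half-open \<open>tile\<close> below, whose translates partition the frequency space.
\<close>

definition cube :: "(real^'n) set" where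
  "cube = {x. \<forall>i. \<bar>x $ i\<bar> \<le> 1/2}"

lemma cube_eq_cbox: "cube = cbox (\<chi> i. -1/2) (\<chi> i. 1/2)"
proof -
  have "\<bar>a\<bar> \<le> 1/2 \<longleftrightarrow> -1/2 \<le> a \<and> a \<le> 1/2" for a :: real by linarith
  then show ?thesis by (simp only: cube_def set_eq_iff mem_Collect_eq mem_box_cart vec_lambda_beta simp_thms)
qed

lemma cube_sets [measurable]: "cube \<in> sets borel"
  unfolding cube_eq_cbox by simp

lemma emeasure_cube_finite: "emeasure lborel cube < \<infinity>"
  unfolding cube_eq_cbox by (simp add: emeasure_lborel_cbox_eq)

lemma integral_unit_interval_cis:
  "(\<integral>t. indicator {-1/2..1/2} t * cis (2 * pi * (t * of_int m)) \<partial>lborel) = (if m = 0 then 1 else 0)"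
proof (cases "m = 0")
  case True
  have "(\<integral>t. indicator {-1/2..1/2::real} t \<partial>lborel) = complex_of_real (\<integral>t. indicator {-1/2..1/2::real} t \<partial>lborel)"
    unfolding integral_complex_of_real[symmetric] by (rule Bochner_Integration.integral_cong) (auto simp: indicator_def)
  with True show ?thesis by simp
next
  case False
  let ?F = "\<lambda>t. cis (2 * pi * m * t) / (2 * pi * m * \<i>)"
  have "(\<integral>t. indicator {-1/2..1/2} t *\<^sub>R cis (2 * pi * m * t) \<partial>lborel) = ?F (1/2) - ?F (-1/2)"
  proof (rule integral_FTC_atLeastAtMost)
    show "(?F has_vector_derivative cis (2 * pi * m * t)) (at t within {-1/2..1/2})" for t
    proof -
      have "(?F has_vector_derivative ((2 * pi * m) *\<^sub>R (\<i> * cis (2 * pi * m * t))) / (2 * pi * m * \<i>)) (at t within {-1/2..1/2})"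
        by (rule has_vector_derivative_divide)
           (auto intro!: derivative_eq_intros simp: has_vector_derivative_def mult_ac)
      then show ?thesis using False by (simp add: scaleR_conv_of_real)
    qed
    show "continuous_on {-1/2..1/2} (\<lambda>t. cis (2 * pi * m * t))" by (intro continuous_intros)
  qed simp
  moreover have "cis (2 * pi * m * (1/2)) = cis (2 * pi * m * (-1/2))"
  proof -
    have "cis (2 * pi * m * (1/2)) = cis (2 * pi * m * (-1/2) + 2 * pi * m)" by (simp add: algebra_simps)
    also have "\<dots> = cis (2 * pi * m * (-1/2)) * cis (2 * pi * m)" unfolding cis_mult ..
    also have "cis (2 * pi * m) = 1" by (rule cis_multiple_2pi) simp
    finally show ?thesis by simp
  qed
  moreover have "(\<integral>t. indicator {-1/2..1/2} t * cis (2 * pi * (t * of_int m)) \<partial>lborel) =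
      (\<integral>t. indicator {-1/2..1/2} t *\<^sub>R cis (2 * pi * m * t) \<partial>lborel)"
    by (rule Bochner_Integration.integral_cong) (auto simp: indicator_def mult_ac)
  ultimately show ?thesis using False by (simp only: diff_self if_False)
qed

text \<open>
  Orthonormality of the exponentials: the integrand factors over the coordinates.
\<close>

lemma integral_cube_cis:
  fixes k :: "int^'n"
  shows
  "(\<integral>x. indicator cube x * cis (2 * pi * (x \<bullet> int_vec k)) \<partial>lborel) = (if k = 0 then 1 else 0)"
proof -
  let ?f = "\<lambda>b t. indicator {-1/2..1/2} t * cis (2 * pi * (t * of_int (k $ axis_index b)))"
  have ind: "indicator cube x = (\<Prod>b\<in>Basis. indicator {-1/2..1/2} (x \<bullet> b) :: complex)" for x :: "real^'n"
  proof (cases "x \<in> cube")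
    case True
    have "indicator {-1/2..1/2} (x \<bullet> b) = (1::complex)" if "b \<in> Basis" for b
    proof -
      from that obtain i where "b = axis i 1" by (auto simp: Basis_vec_def)
      moreover have "\<bar>x $ i\<bar> \<le> 1/2" using True by (simp add: cube_def)
      then have "x $ i \<in> {-1/2..1/2}" unfolding atLeastAtMost_iff by linarith
      ultimately show ?thesis by (simp add: inner_axis)
    qed
    then show ?thesis using True by simp
  next
    case False
    then obtain i where "\<not> \<bar>x $ i\<bar> \<le> 1/2" by (auto simp: cube_def)
    then have "x $ i \<notin> {-1/2..1/2}" unfolding atLeastAtMost_iff by linarith
    then have "indicator {-1/2..1/2} (x \<bullet> axis i 1) = (0::complex)"
      by (simp add: inner_axis)
    moreover have "axis i 1 \<in> (Basis :: (real^'n) set)" by (simp add: axis_in_Basis_iff)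
    ultimately have "(\<Prod>b\<in>Basis. indicator {-1/2..1/2} (x \<bullet> b) :: complex) = 0"
      by (intro prod_zero) auto
    with False show ?thesis by simp
  qed
  have int_vec: "int_vec k \<bullet> b = of_int (k $ axis_index b)" if "b \<in> Basis" for b
    using axis_inverse[OF that] by (auto simp: inner_axis int_vec_def axis_index_axis)
  have "indicator cube x * cis (2 * pi * (x \<bullet> int_vec k)) = (\<Prod>b\<in>Basis. ?f b (x \<bullet> b))" for x
    unfolding ind by (subst euclidean_inner) (simp add: sum_distrib_left cis_sum prod.distrib int_vec)
  then have "(\<integral>x. indicator cube x * cis (2 * pi * (x \<bullet> int_vec k)) \<partial>lborel) =
      (\<integral>x. (\<Prod>b\<in>(Basis::(real^'n) set). ?f b (x \<bullet> b)) \<partial>lborel)" by simp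
  also have "\<dots> = (\<Prod>b\<in>(Basis::(real^'n) set). \<integral>t. ?f b t \<partial>lborel)"
  proof (rule integral_prod_Basis, rule integrable_mult_bounded[where C=1])
    have "integrable lborel (\<lambda>t. complex_of_real (indicator {-1/2..1/2::real} t))"
      by (intro integrable_of_real integrable_real_indicator) auto
    moreover have "(\<lambda>t. complex_of_real (indicator {-1/2..1/2::real} t)) = indicator {-1/2..1/2}"
      by (auto simp: indicator_def)
    ultimately show "integrable lborel (indicator {-1/2..1/2::real} :: real \<Rightarrow> complex)"
      by (simp only:)
  qed auto
  also have "\<dots> = (\<Prod>b\<in>(Basis::(real^'n) set). if k $ axis_index b = 0 then 1 else 0)"
    unfolding integral_unit_interval_cis ..
  also have "\<dots> = (if k = 0 then 1 else 0)"
  proof (cases "k = 0")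
    case False
    then obtain i where "k $ i \<noteq> 0" by (auto simp: vec_eq_iff)
    moreover have "axis i 1 \<in> (Basis :: (real^'n) set)" by (simp add: axis_in_Basis_iff)
    ultimately have "(\<Prod>b\<in>(Basis::(real^'n) set). if k $ axis_index b = 0 then 1 else (0::complex)) = 0"
      by (intro prod_zero bexI[of _ "axis i 1"]) (auto simp: axis_index_axis)
    with False show ?thesis by simp
  qed simp
  finally show ?thesis .
qed

lemma fourier_coefficients_Bessel:
  fixes h :: "real^'n \<Rightarrow> complex"
  assumes h: "h \<in> L2" "\<And>x. x \<notin> cube \<Longrightarrow> h x = 0" and J: "finite J"
  shows "(\<Sum>k\<in>J. (cmod (fourier h (int_vec k)))\<^sup>2) \<le> (L2_norm h)\<^sup>2"
proof -
  define e :: "int^'n \<Rightarrow> real^'n \<Rightarrow> complex" where "e k x = cis (2 * pi * (x \<bullet> int_vec k)) * indicator cube x" for k x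
  have e: "e k \<in> L2" for k
    unfolding e_def by (rule L2_mult_bounded[OF L2_indicator[OF cube_sets emeasure_cube_finite], where C=1]) auto
  have "L2_inner (e k) (e m) = (if k = m then 1 else 0)" for k m
  proof -
    have "int_vec (k - m) = int_vec k - int_vec m" by (simp add: int_vec_def vec_eq_iff)
    then have "e k x * cnj (e m x) = indicator cube x * cis (2 * pi * (x \<bullet> int_vec (k - m)))" for x
      by (simp add: e_def indicator_def inner_diff_right cis_cnj cis_mult right_diff_distrib)
    then show ?thesis unfolding L2_inner_def by (simp add: integral_cube_cis)
  qed
  from L2_Bessel[OF e J this h(1)]
  have "(\<Sum>k\<in>J. (cmod (L2_inner h (e k)))\<^sup>2) \<le> (L2_norm h)\<^sup>2" .
  moreover have "L2_inner h (e k) = fourier h (int_vec k)" for k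
    unfolding L2_inner_def fourier_def
    by (rule Bochner_Integration.integral_cong) (use h(2) in \<open>auto simp: e_def indicator_def cis_cnj\<close>)
  ultimately show ?thesis by simp
qed

definition tile :: "(real^'n) set" where
  "tile = {x. \<forall>i. 0 \<le> x $ i \<and> x $ i < 1}"

lemma tile_sets [measurable]: "tile \<in> sets borel"
proof -
  have "tile = (\<Inter>i\<in>UNIV. {x. 0 \<le> x $ i \<and> x $ i < 1})" by (auto simp: tile_def)
  also have "\<dots> \<in> sets borel" by (intro sets.finite_INT) auto
  finally show ?thesis .
qed

lemma diff_int_vec_in_tile_iff: "x - int_vec k \<in> tile \<longleftrightarrow> k = (\<chi> i. \<lfloor>x $ i\<rfloor>)"
proof -
  have "0 \<le> a - of_int m \<and> a - of_int m < 1 \<longleftrightarrow> m = \<lfloor>a\<rfloor>" for a :: real and m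
    using floor_eq_iff[of a m] by linarith
  then show ?thesis by (simp add: tile_def int_vec_def vec_eq_iff)
qed

lemma emeasure_tile_le: "emeasure lborel (tile :: (real^'n) set) \<le> 1"
proof -
  have "emeasure lborel (tile :: (real^'n) set) \<le> emeasure lborel (cbox 0 1 :: (real^'n) set)"
    by (rule emeasure_mono) (auto simp: tile_def mem_box_cart less_imp_le)
  also have "\<dots> = 1"
  proof -
    have "(1 :: real^'n) \<bullet> b = 1" if "b \<in> Basis" for b
      using that by (auto simp: Basis_vec_def inner_axis)
    then show ?thesis by (simp add: emeasure_lborel_cbox_eq)
  qed
  finally show ?thesis .
qed

lemma nn_integral_tiling:
  fixes u :: "real^'n \<Rightarrow> ennreal" and \<kappa> :: "nat \<Rightarrow> int^'n"
  assumes [measurable]: "u \<in> borel_measurable borel" and \<kappa>: "bij \<kappa>"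
  shows "(\<integral>\<^sup>+x. u x \<partial>lborel) = (\<integral>\<^sup>+y. (\<Sum>n. u (y + int_vec (\<kappa> n))) * indicator tile y \<partial>lborel)"
proof -
  have one: "(\<Sum>n. indicator tile (x - int_vec (\<kappa> n)) :: ennreal) = 1" for x
  proof -
    obtain n where n: "\<kappa> n = (\<chi> i. \<lfloor>x $ i\<rfloor>)" using \<kappa> by (metis bij_pointE)
    have "indicator tile (x - int_vec (\<kappa> m)) = (if m = n then 1 else (0::ennreal))" for m
      using bij_is_inj[OF \<kappa>] by (auto simp: indicator_def diff_int_vec_in_tile_iff n[symmetric] dest: injD)
    then show ?thesis using suminf_finite[of "{n}" "\<lambda>m. if m = n then 1 else (0::ennreal)"] by simp
  qed
  have "(\<integral>\<^sup>+x. u x \<partial>lborel) = (\<integral>\<^sup>+x. (\<Sum>n. u x * indicator tile (x - int_vec (\<kappa> n))) \<partial>lborel)"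
    by (simp add: one)
  also have "\<dots> = (\<Sum>n. \<integral>\<^sup>+x. u x * indicator tile (x - int_vec (\<kappa> n)) \<partial>lborel)"
    by (rule nn_integral_suminf) measurable
  also have "\<dots> = (\<Sum>n. \<integral>\<^sup>+y. u (y + int_vec (\<kappa> n)) * indicator tile y \<partial>lborel)"
  proof (rule suminf_cong)
    fix n
    show "(\<integral>\<^sup>+x. u x * indicator tile (x - int_vec (\<kappa> n)) \<partial>lborel) = (\<integral>\<^sup>+y. u (y + int_vec (\<kappa> n)) * indicator tile y \<partial>lborel)"
      using nn_integral_lborel_translate[of "\<lambda>y. u (y + int_vec (\<kappa> n)) * indicator tile y" "int_vec (\<kappa> n)"] by simp
  qed
  also have "\<dots> = (\<integral>\<^sup>+y. (\<Sum>n. u (y + int_vec (\<kappa> n)) * indicator tile y) \<partial>lborel)"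
    by (rule nn_integral_suminf[symmetric]) measurable
  finally show ?thesis by simp
qed

lemma cmod_cis_minus_1_le: "cmod (cis t - 1) \<le> \<bar>t\<bar>"
  using iexp_approx1[of t 0] by (simp add: cis_conv_exp)

text \<open>
  Let \<open>S y\<close> be the sum of \<open>|h^(y + k)|\<^sup>2\<close> over the lattice. These values are the Fourier coefficients
  of \<open>h\<close> modulated by the frequency \<open>y\<close>, so \<open>S y \<le> \<parallel>h\<parallel>\<^sup>2\<close> by Bessel's inequality. By Plancherel's
  theorem the integral of \<open>S\<close> over a tile of measure at most 1 is \<open>\<parallel>h\<parallel>\<^sup>2\<close>, hence \<open>S y = \<parallel>h\<parallel>\<^sup>2\<close> for
  almost every \<open>y\<close>. Finally the square root of \<open>S\<close> is Lipschitz at 0, since modulation by \<open>y\<close> moves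
  the compactly supported \<open>h\<close> by at most a multiple of \<open>norm y\<close>; this gives the claim at \<open>y = 0\<close>.
\<close>

theorem fourier_series_Parseval:
  fixes h :: "real^'n \<Rightarrow> complex"
  assumes h: "h \<in> L2" "\<And>x. x \<notin> cube \<Longrightarrow> h x = 0"
  shows "((\<lambda>k. (cmod (fourier h (int_vec k)))\<^sup>2) has_sum (L2_norm h)\<^sup>2) UNIV"
proof -
  have [measurable]: "h \<in> borel_measurable borel" using h by measurable
  have int_h: "integrable lborel h"
  proof -
    have "(\<lambda>x. h x * indicator cube x) = h" using h(2) by (auto simp: indicator_def fun_eq_iff)
    then show ?thesis using L2_integrable_on_finite[OF h(1) cube_sets emeasure_cube_finite] by simp
  qed
  obtain \<kappa> :: "nat \<Rightarrow> int^'n" where \<kappa>: "bij \<kappa>"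
  proof -
    have "inj (\<lambda>m. (\<chi> i. int m) :: int^'n)" by (simp add: inj_def vec_eq_iff)
    then have "infinite (range (\<lambda>m. (\<chi> i. int m) :: int^'n))" by (rule range_inj_infinite)
    then have "infinite (UNIV :: (int^'n) set)" by (rule infinite_super[OF subset_UNIV])
    from bij_betw_from_nat_into[OF countableI_type this] show ?thesis using that by blast
  qed
  define N where "N = L2_norm h"
  have N0: "N \<ge> 0" by (simp add: N_def)
  define modu where "modu y x = h x * cis (- 2 * pi * (x \<bullet> y))" for y x
  have modu: "modu y \<in> L2" "\<And>x. x \<notin> cube \<Longrightarrow> modu y x = 0" "L2_norm (modu y) = N" for y
  proof -
    have "(\<lambda>x. cis (- 2 * pi * (x \<bullet> y)) * h x) \<in> L2"
      by (rule L2_mult_bounded[OF h(1), where C=1]) auto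
    then show "modu y \<in> L2" by (simp only: modu_def[abs_def] mult.commute)
  qed (auto simp: modu_def h(2) L2_norm_def norm_mult N_def)
  have fourier_modu: "fourier (modu y) \<xi> = fourier h (y + \<xi>)" for y \<xi>
    unfolding fourier_def modu_def
    by (simp only: mult.assoc[of "h _"] cis_mult inner_add_right distrib_left)
  define s where "s = (\<Sum>\<^sub>\<infinity>k. (cmod (fourier h (int_vec k)))\<^sup>2)"
  have bdd: "(\<Sum>k\<in>J. (cmod (fourier h (int_vec k)))\<^sup>2) \<le> N\<^sup>2" if "finite J" for J
    unfolding N_def by (rule fourier_coefficients_Bessel[OF h that])
  have summable: "(\<lambda>k. (cmod (fourier h (int_vec k)))\<^sup>2) summable_on UNIV"
    by (rule nonneg_bdd_above_summable_on) (use bdd in \<open>auto intro!: bdd_aboveI2\<close>)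
  have hs: "((\<lambda>k. (cmod (fourier h (int_vec k)))\<^sup>2) has_sum s) UNIV"
    unfolding s_def by (rule has_sum_infsum[OF summable])
  have s0: "s \<ge> 0" unfolding s_def by (intro infsum_nonneg) simp
  have s_le: "s \<le> N\<^sup>2" unfolding s_def
    by (rule infsum_le_finite_sums[OF summable]) (use bdd in auto)
  have J_le: "(\<Sum>k\<in>J. (cmod (fourier h (int_vec k)))\<^sup>2) \<le> s" if "finite J" for J
    unfolding s_def by (rule finite_sum_le_infsum[OF summable that]) auto
  have "bounded (cube :: (real^'n) set)" unfolding cube_eq_cbox by simp
  then obtain M where M: "\<And>x :: real^'n. x \<in> cube \<Longrightarrow> norm x \<le> M" "M > 0"
    unfolding bounded_pos by auto
  define K where "K = 2 * pi * M * N"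
  have K0: "K \<ge> 0" using M(2) N0 by (simp add: K_def)
  have modu_close: "L2_norm (\<lambda>x. modu y x - h x) \<le> K * norm y" for y
  proof (rule power2_le_imp_le)
    have "(L2_norm (\<lambda>x. modu y x - h x))\<^sup>2 \<le> (\<integral>x. (2 * pi * M * norm y)\<^sup>2 * (cmod (h x))\<^sup>2 \<partial>lborel)"
      unfolding L2_norm_power2
    proof (rule integral_mono)
      show "integrable lborel (\<lambda>x. (cmod (modu y x - h x))\<^sup>2)"
        by (intro L2_integrable L2_diff modu h)
      show "integrable lborel (\<lambda>x. (2 * pi * M * norm y)\<^sup>2 * (cmod (h x))\<^sup>2)"
        using L2_integrable[OF h(1)] by simp
      fix x
      show "(cmod (modu y x - h x))\<^sup>2 \<le> (2 * pi * M * norm y)\<^sup>2 * (cmod (h x))\<^sup>2"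
      proof (cases "x \<in> cube")
        case True
        have "modu y x - h x = h x * (cis (- 2 * pi * (x \<bullet> y)) - 1)" by (simp add: modu_def algebra_simps)
        then have "cmod (modu y x - h x) = cmod (h x) * cmod (cis (- 2 * pi * (x \<bullet> y)) - 1)"
          by (simp add: norm_mult)
        also have "\<dots> \<le> cmod (h x) * (2 * pi * M * norm y)"
        proof (rule mult_left_mono)
          have "cmod (cis (- 2 * pi * (x \<bullet> y)) - 1) \<le> 2 * pi * \<bar>x \<bullet> y\<bar>"
            using cmod_cis_minus_1_le[of "- 2 * pi * (x \<bullet> y)"] by (simp add: abs_mult)
          also have "\<dots> \<le> 2 * pi * (norm x * norm y)" by (intro mult_left_mono Cauchy_Schwarz_ineq2) auto
          also have "\<dots> \<le> 2 * pi * (M * norm y)" by (intro mult_left_mono mult_right_mono M True) auto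
          finally show "cmod (cis (- 2 * pi * (x \<bullet> y)) - 1) \<le> 2 * pi * M * norm y" by (simp add: mult.assoc)
        qed simp
        finally have "(cmod (modu y x - h x))\<^sup>2 \<le> (cmod (h x) * (2 * pi * M * norm y))\<^sup>2"
          by (rule power_mono) simp
        then show ?thesis by (simp add: power_mult_distrib mult_ac)
      qed (simp add: modu_def h)
    qed
    also have "\<dots> = (K * norm y)\<^sup>2"
      by (simp add: L2_norm_power2[symmetric] K_def N_def power_mult_distrib)
    finally show "(L2_norm (\<lambda>x. modu y x - h x))\<^sup>2 \<le> (K * norm y)\<^sup>2" .
  qed (use K0 in simp)
  define S where "S y = (\<Sum>n. ennreal ((cmod (fourier h (y + int_vec (\<kappa> n))))\<^sup>2))" for y
  have [measurable]: "S \<in> borel_measurable borel" unfolding S_def[abs_def] by measurable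
  have partial: "(\<Sum>n<m. ennreal ((cmod (fourier h (y + int_vec (\<kappa> n))))\<^sup>2)) =
      ennreal (\<Sum>k\<in>\<kappa> ` {..<m}. (cmod (fourier (modu y) (int_vec k)))\<^sup>2)" for y m
    using bij_is_inj[OF \<kappa>] by (subst sum.reindex) (auto simp: fourier_modu inj_on_def)
  have S_le: "S y \<le> ennreal (N\<^sup>2)" for y
    unfolding S_def
  proof (rule suminf_le_const[OF summableI])
    fix m
    show "(\<Sum>n<m. ennreal ((cmod (fourier h (y + int_vec (\<kappa> n))))\<^sup>2)) \<le> ennreal (N\<^sup>2)"
      unfolding partial using fourier_coefficients_Bessel[OF modu(1,2), of "\<kappa> ` {..<m}" y] modu(3)
      by (intro ennreal_leI) simp
  qed
  have S_le2: "S y \<le> ennreal ((sqrt s + K * norm y)\<^sup>2)" for y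
    unfolding S_def
  proof (rule suminf_le_const[OF summableI])
    fix m
    let ?J = "\<kappa> ` {..<m}"
    let ?d = "\<lambda>x. modu y x + (-1) * h x"
    have d: "?d \<in> L2" "\<And>x. x \<notin> cube \<Longrightarrow> ?d x = 0" using modu(1)[of y] modu(2)[of _ y] h by (auto intro: L2_diff)
    have int_modu: "integrable lborel (modu y)"
      unfolding modu_def[abs_def] by (rule fourier_integrand[OF int_h])
    have "L2_set (\<lambda>k. cmod (fourier (modu y) (int_vec k))) ?J \<le>
       L2_set (\<lambda>k. cmod (fourier h (int_vec k)) + cmod (fourier ?d (int_vec k))) ?J"
    proof (rule L2_set_mono)
      fix k
      have "fourier (modu y) (int_vec k) = fourier h (int_vec k) + fourier ?d (int_vec k)"
        using fourier_add_scale[OF int_modu int_h, of "-1" "int_vec k"] by simp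
      then show "cmod (fourier (modu y) (int_vec k)) \<le> cmod (fourier h (int_vec k)) + cmod (fourier ?d (int_vec k))"
        using norm_triangle_ineq by metis
    qed simp
    also have "\<dots> \<le> L2_set (\<lambda>k. cmod (fourier h (int_vec k))) ?J + L2_set (\<lambda>k. cmod (fourier ?d (int_vec k))) ?J"
      by (rule L2_set_triangle_ineq)
    also have "L2_set (\<lambda>k. cmod (fourier h (int_vec k))) ?J \<le> sqrt s"
      unfolding L2_set_def by (intro real_sqrt_le_mono J_le) simp
    also have "L2_set (\<lambda>k. cmod (fourier ?d (int_vec k))) ?J \<le> L2_norm ?d"
      unfolding L2_set_def using fourier_coefficients_Bessel[OF d, of ?J] by (intro real_le_lsqrt) (auto simp: sum_nonneg)
    also have "L2_norm ?d \<le> K * norm y" using modu_close[of y] by simp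
    finally have "(L2_set (\<lambda>k. cmod (fourier (modu y) (int_vec k))) ?J)\<^sup>2 \<le> (sqrt s + K * norm y)\<^sup>2"
      by (intro power_mono) auto
    then show "(\<Sum>n<m. ennreal ((cmod (fourier h (y + int_vec (\<kappa> n))))\<^sup>2)) \<le> ennreal ((sqrt s + K * norm y)\<^sup>2)"
      unfolding partial by (intro ennreal_leI) (simp add: L2_set_def sum_nonneg)
  qed
  have int_S: "(\<integral>\<^sup>+y. S y * indicator tile y \<partial>lborel) = ennreal (N\<^sup>2)"
  proof -
    have "ennreal (N\<^sup>2) = (\<integral>\<^sup>+\<xi>. ennreal ((cmod (fourier h \<xi>))\<^sup>2) \<partial>lborel)"
      using nn_integral_L2[OF Plancherel_L1_L2(1)[OF int_h h(1)]]
      by (simp only: Plancherel_L1_L2(2)[OF int_h h(1)] N_def)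
    also have "\<dots> = (\<integral>\<^sup>+y. S y * indicator tile y \<partial>lborel)"
      unfolding S_def by (rule nn_integral_tiling[OF _ \<kappa>]) measurable
    finally show ?thesis ..
  qed
  have int_N: "(\<integral>\<^sup>+y. ennreal (N\<^sup>2) * indicator tile y \<partial>(lborel :: (real^'n) measure)) \<le> ennreal (N\<^sup>2)"
    using mult_left_mono[OF emeasure_tile_le[where 'n='n], of "ennreal (N\<^sup>2)"] by (simp add: nn_integral_cmult)
  have "(\<integral>\<^sup>+y. ennreal (N\<^sup>2) * indicator tile y - S y * indicator tile y \<partial>lborel) =
      (\<integral>\<^sup>+y. ennreal (N\<^sup>2) * indicator tile y \<partial>(lborel :: (real^'n) measure)) - (\<integral>\<^sup>+y. S y * indicator tile y \<partial>lborel)"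
  proof (rule nn_integral_diff)
    show "(\<integral>\<^sup>+y. S y * indicator tile y \<partial>lborel) \<noteq> \<infinity>" unfolding int_S by simp
    show "AE y in lborel. S y * indicator tile y \<le> ennreal (N\<^sup>2) * indicator tile y"
      by (auto intro!: mult_right_mono S_le)
  qed measurable
  also have "\<dots> = 0" unfolding int_S using int_N order_le_less_trans[OF int_N ennreal_less_top]
    by (simp add: diff_eq_0_iff_ennreal)
  finally have int_0: "(\<integral>\<^sup>+y. ennreal (N\<^sup>2) * indicator tile y - S y * indicator tile y \<partial>lborel) = 0" .
  have "AE y in lborel. ennreal (N\<^sup>2) * indicator tile y - S y * indicator tile y = 0"
    by (rule nn_integral_0_iff_AE[THEN iffD1, OF _ int_0]) measurable
  then have ae: "AE y in lborel. y \<in> tile \<longrightarrow> ennreal (N\<^sup>2) \<le> S y"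
    by eventually_elim (auto simp: diff_eq_0_iff_ennreal)
  have "N \<le> sqrt s"
  proof (rule field_le_epsilon)
    fix e :: real assume e: "e > 0"
    \<comment> \<open>Every point of the open box with side \<open>r\<close> is in the tile and so close to 0 that the Lipschitz bound is at most \<open>e\<close>.\<close>
    define r where "r = min 1 (e / ((K + 1) * real CARD('n)))"
    have r: "r > 0" "r \<le> 1" using e K0 by (auto simp: r_def)
    let ?B = "box 0 (\<chi> i. r) :: (real^'n) set"
    have "?B \<noteq> {}" using r by (simp add: interval_ne_empty_cart)
    then have "\<not> negligible ?B" by (intro open_not_negligible) auto
    then have "?B \<notin> null_sets lborel"
      using null_sets_completionI[of ?B lborel] negligible_iff_null_sets[of ?B] by blast
    then have pos: "\<not> (AE y in lborel. y \<notin> ?B)"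
      using AE_iff_null_sets[of ?B lborel] by simp
    have "\<exists>y. y \<in> ?B \<and> (y \<in> tile \<longrightarrow> ennreal (N\<^sup>2) \<le> S y)"
    proof (rule ccontr)
      assume "\<not> ?thesis"
      with ae have "AE y in lborel. y \<notin> ?B" by (auto elim!: eventually_mono)
      with pos show False by contradiction
    qed
    then obtain y where y: "y \<in> ?B" "y \<in> tile \<longrightarrow> ennreal (N\<^sup>2) \<le> S y" by blast
    have yi: "0 < y $ i" "y $ i < r" for i using y(1) by (auto simp: mem_box_cart)
    have "y \<in> tile" using yi r by (auto simp: tile_def intro: less_imp_le less_le_trans)
    have "norm y \<le> (\<Sum>i\<in>UNIV. \<bar>y $ i\<bar>)" by (rule norm_le_l1_cart)
    also have "\<dots> \<le> (\<Sum>i\<in>(UNIV::'n set). r)" by (rule sum_mono) (use yi in \<open>auto simp: less_imp_le\<close>)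
    also have "\<dots> = real CARD('n) * r" by simp
    also have "\<dots> \<le> real CARD('n) * (e / ((K + 1) * real CARD('n)))"
      by (rule mult_left_mono) (simp_all only: r_def min.cobounded2 of_nat_0_le_iff)
    also have "\<dots> = e / (K + 1)" by simp
    finally have "K * norm y \<le> (K + 1) * (e / (K + 1))" using K0 e by (intro mult_mono) auto
    then have Ky: "K * norm y \<le> e" using K0 by simp
    have "ennreal (N\<^sup>2) \<le> ennreal ((sqrt s + K * norm y)\<^sup>2)"
      using y(2) \<open>y \<in> tile\<close> by (intro order_trans[OF _ S_le2]) blast
    then have "N\<^sup>2 \<le> (sqrt s + K * norm y)\<^sup>2" by (subst (asm) ennreal_le_iff) simp_all
    then have "N \<le> sqrt s + K * norm y" by (rule power2_le_imp_le) (use s0 K0 in auto)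
    with Ky show "N \<le> sqrt s + e" by simp
  qed
  then have "N\<^sup>2 \<le> (sqrt s)\<^sup>2" by (rule power_mono[OF _ N0])
  then have "s = N\<^sup>2" using s_le s0 by simp
  with hs show ?thesis by (simp add: N_def)
qed

section \<open>Linear substitutions and lattice exponentials\<close>

lemma vector_matrix_measurable [measurable]:
  "(\<lambda>x::real^'n. x v* M) \<in> borel_measurable borel"
proof -
  have "linear (\<lambda>x::real^'n. x v* M)"
    by (intro linearI) (simp_all add: vector_matrix_left_distrib scaleR_vector_matrix_assoc)
  then show ?thesis
    by (intro borel_measurable_continuous_onI linear_continuous_on linear_conv_bounded_linear[THEN iffD1])
qed

locale linear_substitution =
  fixes M N :: "real^'n::{finite,wellorder}^'n::{finite,wellorder}"
  assumes MN: "M ** N = mat 1" and NM: "N ** M = mat 1"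
begin

lemma inverse1 [simp]: "(x v* M) v* N = x" and inverse2 [simp]: "(x v* N) v* M = x"
  by (simp_all add: vector_matrix_mul_assoc MN NM)

lemma det_pos: "\<bar>det M\<bar> > 0"
proof -
  have "det M * det N = 1" using arg_cong[OF MN, of det] by (simp add: det_mul)
  then show ?thesis by auto
qed

lemma lborel_linear: "lborel = density (distr lborel borel (\<lambda>x. x v* M)) (\<lambda>_. \<bar>det M\<bar>)"
proof (rule lborel_eqI)
  let ?T = "\<lambda>x::real^'n::_. x v* M"
  let ?B = "Basis :: (real^'n::_) set"
  fix l u :: "real^'n::_" assume le: "\<And>b. b \<in> ?B \<Longrightarrow> l \<bullet> b \<le> u \<bullet> b"
  let ?S = "?T -` box l u"
  have linT: "linear (\<lambda>x::real^'n::_. x v* A)" for A :: "real^'n::_^'n::_"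
    by (intro linearI) (simp_all add: vector_matrix_left_distrib scaleR_vector_matrix_assoc)
  have S_eq: "?S = (\<lambda>x. x v* N) ` box l u"
  proof (intro subset_antisym subsetI)
    fix x assume "x \<in> ?S"
    then show "x \<in> (\<lambda>x. x v* N) ` box l u" by (intro image_eqI[of _ _ "x v* M"]) auto
  qed auto
  have TS: "?T ` ?S = box l u" unfolding S_eq image_image by simp
  have S_lm: "?S \<in> lmeasurable" unfolding S_eq
    by (intro measurable_linear_image linT) simp
  have S_sets: "?S \<in> sets borel" using measurable_sets[OF vector_matrix_measurable[of M], of "box l u"] by simp
  have "matrix ?T = transpose M"
    using matrix_of_matrix_vector_mul[of "transpose M"] by simp
  then have "measure lebesgue (box l u) = \<bar>det M\<bar> * measure lebesgue ?S"
    using measure_linear_image[OF linT S_lm, of M] TS by (simp add: det_transpose)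
  moreover have "emeasure lborel ?S = ennreal (measure lebesgue ?S)"
    using S_lm S_sets emeasure_eq_measure2[OF S_lm] by simp
  moreover have "emeasure (density (distr lborel borel ?T) (\<lambda>_. ennreal \<bar>det M\<bar>)) (box l u) = ennreal \<bar>det M\<bar> * emeasure lborel ?S"
    by (simp add: emeasure_density nn_integral_cmult emeasure_distr)
  ultimately have "emeasure (density (distr lborel borel ?T) (\<lambda>_. ennreal \<bar>det M\<bar>)) (box l u) = ennreal (measure lebesgue (box l u))"
    by (simp add: ennreal_mult)
  also have "\<dots> = (\<Prod>b\<in>?B. (u - l) \<bullet> b)"
    using le by (simp add: measure_lborel_box_eq inner_diff_left)
  finally show "emeasure (density (distr lborel borel ?T) (\<lambda>_. ennreal \<bar>det M\<bar>)) (box l u) = (\<Prod>b\<in>?B. (u - l) \<bullet> b)" .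
qed simp

lemma nn_integral_linear:
  assumes [measurable]: "f \<in> borel_measurable borel"
  shows "(\<integral>\<^sup>+x. f x \<partial>lborel) = ennreal \<bar>det M\<bar> * (\<integral>\<^sup>+x. f (x v* M) \<partial>lborel)"
  by (subst lborel_linear) (simp add: nn_integral_density nn_integral_distr nn_integral_cmult)

lemma integral_linear:
  fixes f :: "real^'n::_ \<Rightarrow> complex"
  assumes [measurable]: "f \<in> borel_measurable borel"
  shows "(\<integral>x. f x \<partial>lborel) = \<bar>det M\<bar> *\<^sub>R (\<integral>x. f (x v* M) \<partial>lborel)"
  by (subst lborel_linear) (simp add: integral_density integral_distr)

text \<open>
  The substitution \<open>y = x M\<close> transports Parseval's identity on the cube to the preimage of the cube;
  the factor \<open>sqrt |det M|\<close> in \<open>e\<close> compensates for the change of volume. The support condition is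
  only imposed almost everywhere because the windows to which it is applied are functions of a
  quotient of coordinates, whose value on the null set of zero denominators is a mere convention.
\<close>

lemma lattice_exponentials_Parseval:
  fixes G m :: "real^'n::_ \<Rightarrow> complex" and C :: real
  assumes G: "G \<in> L2" and [measurable]: "m \<in> borel_measurable borel"
    and m: "\<And>x. cmod (m x) \<le> C" and supp: "AE x in lborel. m x \<noteq> 0 \<longrightarrow> x v* M \<in> cube"
  defines "e \<equiv> \<lambda>k x. complex_of_real (sqrt \<bar>det M\<bar>) * m x * cis (2 * pi * ((x v* M) \<bullet> int_vec k))"
  shows "((\<lambda>k. (cmod (L2_inner G (e k)))\<^sup>2) has_sum (L2_norm (\<lambda>x. cnj (m x) * G x))\<^sup>2) UNIV"
proof -
  let ?d = "\<bar>det M\<bar>"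
  have [measurable]: "G \<in> borel_measurable borel" using G by measurable
  define F where "F x = indicator cube (x v* M) * (cnj (m x) * G x)" for x
  define h where "h y = F (y v* N)" for y
  have [measurable]: "F \<in> borel_measurable borel" unfolding F_def[abs_def] by measurable
  have [measurable]: "h \<in> borel_measurable borel" unfolding h_def[abs_def] by measurable
  have hF: "h (x v* M) = F x" for x by (simp add: h_def)
  have mG: "(\<lambda>x. cnj (m x) * G x) \<in> L2"
    by (rule L2_mult_bounded[OF G, where C=C]) (auto simp: m)
  have F: "F \<in> L2" unfolding F_def[abs_def]
    by (rule L2_mult_bounded[OF mG, where C=1]) (auto simp: indicator_def)
  have F_AE: "AE x in lborel. F x = cnj (m x) * G x"
    using supp by eventually_elim (auto simp: F_def)
  have nn_h: "(\<integral>\<^sup>+y. ennreal ((cmod (h y))\<^sup>2) \<partial>lborel) = ennreal (?d * (L2_norm F)\<^sup>2)"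
    by (subst nn_integral_linear) (simp_all add: hF nn_integral_L2[OF F] ennreal_mult)
  then have h: "h \<in> L2" by (simp add: L2_iff_nn_integral)
  with nn_h have norm_h: "(L2_norm h)\<^sup>2 = ?d * (L2_norm F)\<^sup>2"
    by (simp add: nn_integral_L2)
  have "h y = 0" if "y \<notin> cube" for y using that by (simp add: h_def F_def)
  from fourier_series_Parseval[OF h this]
  have "((\<lambda>k. (cmod (fourier h (int_vec k)))\<^sup>2) has_sum ?d * (L2_norm F)\<^sup>2) UNIV"
    unfolding norm_h .
  from has_sum_cmult_right[OF this, of "1 / ?d"] det_pos
  have hs: "((\<lambda>k. (cmod (fourier h (int_vec k)))\<^sup>2 / ?d) has_sum (L2_norm F)\<^sup>2) UNIV"
    by simp
  have "(cmod (L2_inner G (e k)))\<^sup>2 = (cmod (fourier h (int_vec k)))\<^sup>2 / ?d" for k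
  proof -
    have "L2_inner G (e k) = (\<integral>x. complex_of_real (sqrt ?d) * (F x * cis (- 2 * pi * ((x v* M) \<bullet> int_vec k))) \<partial>lborel)"
      unfolding L2_inner_def
    proof (rule integral_cong_AE)
      show "(\<lambda>x. G x * cnj (e k x)) \<in> borel_measurable lborel" unfolding e_def by measurable
      show "AE x in lborel. G x * cnj (e k x) = complex_of_real (sqrt ?d) * (F x * cis (- 2 * pi * ((x v* M) \<bullet> int_vec k)))"
        using F_AE by eventually_elim (simp add: e_def cis_cnj)
    qed measurable
    also have "\<dots> = complex_of_real (sqrt ?d) * (\<integral>x. h (x v* M) * cis (- 2 * pi * ((x v* M) \<bullet> int_vec k)) \<partial>lborel)"
      by (simp add: hF)
    finally have 1: "L2_inner G (e k) = complex_of_real (sqrt ?d) * (\<integral>x. h (x v* M) * cis (- 2 * pi * ((x v* M) \<bullet> int_vec k)) \<partial>lborel)" .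
    have "fourier h (int_vec k) = ?d *\<^sub>R (\<integral>x. h (x v* M) * cis (- 2 * pi * ((x v* M) \<bullet> int_vec k)) \<partial>lborel)"
      unfolding fourier_def by (rule integral_linear) measurable
    then have "complex_of_real (sqrt ?d) * L2_inner G (e k) = fourier h (int_vec k)"
      unfolding 1 by (simp add: scaleR_conv_of_real mult.assoc[symmetric] flip: of_real_mult)
    then have "(cmod (complex_of_real (sqrt ?d) * L2_inner G (e k)))\<^sup>2 = (cmod (fourier h (int_vec k)))\<^sup>2"
      by simp
    then have "?d * (cmod (L2_inner G (e k)))\<^sup>2 = (cmod (fourier h (int_vec k)))\<^sup>2"
      by (simp add: norm_mult power_mult_distrib)
    then show ?thesis using det_pos by (simp add: field_simps)
  qed
  moreover have "L2_norm F = L2_norm (\<lambda>x. cnj (m x) * G x)"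
    by (rule L2_norm_cong_AE) (use F_AE in auto)
  ultimately show ?thesis using hs by simp
qed

end

section \<open>Powers of the scaling and shear matrices\<close>

lemma matrix_inv_eqI:
  fixes A B :: "real^'n^'n"
  assumes "A ** B = mat 1" "B ** A = mat 1"
  shows "matrix_inv A = B"
proof -
  have "A ** matrix_inv A = mat 1 \<and> matrix_inv A ** A = mat 1"
    unfolding matrix_inv_def by (rule someI[of _ B]) (use assms in simp)
  then have "matrix_inv A = (B ** A) ** matrix_inv A" "B = B ** (A ** matrix_inv A)"
    using assms by simp_all
  then show ?thesis by (simp add: matrix_mul_assoc)
qed

text \<open>
  Integer powers are read off from a one-parameter group through the matrix.
\<close>

lemma mat_zpow_one_parameter:
  fixes P :: "real \<Rightarrow> real^'n^'n"
  assumes add: "\<And>s t. P s ** P t = P (s + t)" and zero: "P 0 = mat 1"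
  shows "mat_zpow (P t) z = P (of_int z * t)"
proof -
  have pow: "(((**) (P s)) ^^ n) (mat 1) = P (real n * s)" for s n
    by (induction n) (simp_all add: zero add algebra_simps)
  have inv: "matrix_inv (P t) = P (- t)"
    by (rule matrix_inv_eqI) (simp_all add: add zero)
  show ?thesis
    by (cases "0 \<le> z") (simp_all add: mat_zpow_def pow inv)
qed

lemma matrix_2_eq_iff: "(A :: 'a^2^2) = B \<longleftrightarrow>
    A$1$1 = B$1$1 \<and> A$1$2 = B$1$2 \<and> A$2$1 = B$2$1 \<and> A$2$2 = B$2$2"
  by (auto simp: vec_eq_iff forall_2)

fun scaling_exp :: "real \<Rightarrow> dir \<Rightarrow> real \<Rightarrow> real^2^2" where
  "scaling_exp \<alpha> Hor t = vector [vector [4 powr t, 0], vector [0, 2 powr (\<alpha> * t)]]"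
| "scaling_exp \<alpha> Ver t = vector [vector [2 powr (\<alpha> * t), 0], vector [0, 4 powr t]]"

fun shear_exp :: "dir \<Rightarrow> real \<Rightarrow> real^2^2" where
  "shear_exp Hor t = vector [vector [1, t], vector [0, 1]]"
| "shear_exp Ver t = vector [vector [1, 0], vector [t, 1]]"

lemma scaling_exp_add: "scaling_exp \<alpha> \<iota> s ** scaling_exp \<alpha> \<iota> t = scaling_exp \<alpha> \<iota> (s + t)"
  by (cases \<iota>) (simp_all add: matrix_2_eq_iff matrix_matrix_mult_def sum_2 powr_add algebra_simps)

lemma scaling_exp_0: "scaling_exp \<alpha> \<iota> 0 = mat 1"
  by (cases \<iota>) (simp_all add: matrix_2_eq_iff mat_def)

lemma shear_exp_add: "shear_exp \<iota> s ** shear_exp \<iota> t = shear_exp \<iota> (s + t)"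
  by (cases \<iota>) (simp_all add: matrix_2_eq_iff matrix_matrix_mult_def sum_2)

lemma shear_exp_0: "shear_exp \<iota> 0 = mat 1"
  by (cases \<iota>) (simp_all add: matrix_2_eq_iff mat_def)

lemma mat_zpow_scaling: "mat_zpow (scaling \<alpha> \<iota>) z = scaling_exp \<alpha> \<iota> (of_int z)"
proof -
  have "scaling \<alpha> \<iota> = scaling_exp \<alpha> \<iota> 1" by (cases \<iota>) simp_all
  then show ?thesis using mat_zpow_one_parameter[OF scaling_exp_add scaling_exp_0, of \<alpha> \<iota> 1 z] by simp
qed

lemma mat_zpow_shear: "mat_zpow (shear \<iota>) z = shear_exp \<iota> (of_int z)"
proof -
  have "shear \<iota> = shear_exp \<iota> 1" by (cases \<iota>) simp_all
  then show ?thesis using mat_zpow_one_parameter[OF shear_exp_add shear_exp_0, of \<iota> 1 z] by simp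
qed

text \<open>
  Naming the coordinates by their role makes it possible to treat the two cones simultaneously.
\<close>

fun main_axis :: "dir \<Rightarrow> 2" where "main_axis Hor = 1" | "main_axis Ver = 2"
fun cross_axis :: "dir \<Rightarrow> 2" where "cross_axis Hor = 2" | "cross_axis Ver = 1"

lemma forall_axes: "(\<forall>i. P i) \<longleftrightarrow> P (main_axis \<iota>) \<and> P (cross_axis \<iota>)"
  by (cases \<iota>) (auto simp: forall_2)

lemma V_eq: "V v \<iota> \<eta> = v (\<eta> $ cross_axis \<iota> / \<eta> $ main_axis \<iota>)"
  by (cases \<iota>) simp_all

lemma Cone_eq: "\<C> (Cone \<iota>) = {\<xi>. 1/8 \<le> \<bar>\<xi> $ main_axis \<iota>\<bar> \<and> \<bar>\<xi> $ cross_axis \<iota> / \<xi> $ main_axis \<iota>\<bar> \<le> 3/2}"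
  by (cases \<iota>) simp_all

lemma Cone_star_eq: "\<C>_star \<iota> = {\<xi>. 1/32 \<le> \<bar>\<xi> $ main_axis \<iota>\<bar> \<and> \<bar>\<xi> $ main_axis \<iota>\<bar> \<le> 1/4 \<and>
    \<bar>\<xi> $ cross_axis \<iota> / \<xi> $ main_axis \<iota>\<bar> \<le> 3/2}"
  by (cases \<iota>) simp_all

definition freq_mat :: "real \<Rightarrow> dir \<Rightarrow> nat \<Rightarrow> int \<Rightarrow> real^2^2" where
  "freq_mat \<alpha> \<iota> j l = mat_zpow (scaling \<alpha> \<iota>) (- int j) ** mat_zpow (shear \<iota>) (- l)"

definition freq_mat_inv :: "real \<Rightarrow> dir \<Rightarrow> nat \<Rightarrow> int \<Rightarrow> real^2^2" where
  "freq_mat_inv \<alpha> \<iota> j l = mat_zpow (shear \<iota>) l ** mat_zpow (scaling \<alpha> \<iota>) (int j)"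

lemma freq_mat_exp: "freq_mat \<alpha> \<iota> j l = scaling_exp \<alpha> \<iota> (- real j) ** shear_exp \<iota> (- of_int l)"
  unfolding freq_mat_def mat_zpow_scaling mat_zpow_shear by simp

lemma freq_mat_inv_exp: "freq_mat_inv \<alpha> \<iota> j l = shear_exp \<iota> (of_int l) ** scaling_exp \<alpha> \<iota> (real j)"
  unfolding freq_mat_inv_def mat_zpow_scaling mat_zpow_shear by simp

lemma linear_substitution_freq_mat: "linear_substitution (freq_mat \<alpha> \<iota> j l) (freq_mat_inv \<alpha> \<iota> j l)"
proof
  let ?A = "scaling_exp \<alpha> \<iota>" and ?S = "shear_exp \<iota>"
  have "freq_mat \<alpha> \<iota> j l ** freq_mat_inv \<alpha> \<iota> j l = ?A (- real j) ** (?S (- of_int l) ** ?S (of_int l)) ** ?A (real j)"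
    by (simp add: freq_mat_exp freq_mat_inv_exp matrix_mul_assoc)
  then show "freq_mat \<alpha> \<iota> j l ** freq_mat_inv \<alpha> \<iota> j l = mat 1"
    by (simp add: shear_exp_add shear_exp_0 scaling_exp_add scaling_exp_0)
  have "freq_mat_inv \<alpha> \<iota> j l ** freq_mat \<alpha> \<iota> j l = ?S (of_int l) ** (?A (real j) ** ?A (- real j)) ** ?S (- of_int l)"
    by (simp add: freq_mat_exp freq_mat_inv_exp matrix_mul_assoc)
  then show "freq_mat_inv \<alpha> \<iota> j l ** freq_mat \<alpha> \<iota> j l = mat 1"
    by (simp add: shear_exp_add shear_exp_0 scaling_exp_add scaling_exp_0)
qed

lemma four_powr: "(4::real) powr t = 2 powr (2 * t)"
proof -
  have "(2::real) powr (2 * t) = (2 powr 2) powr t" by (rule powr_powr[symmetric])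
  also have "(2::real) powr 2 = 4" by simp
  finally show ?thesis ..
qed

lemma powr_minus_nat: "(4::real) powr (- real j) = 1 / 4 ^ j"
  by (simp add: powr_minus_divide powr_realpow)

lemma vector_matrix_2: "(x v* A) $ i = A $ 1 $ i * x $ 1 + A $ 2 $ i * x $ 2" for A :: "real^2^2"
  by (simp add: vector_matrix_mult_def sum_2)

lemma matrix_matrix_2: "(A ** B) $ i $ k = A $ i $ 1 * B $ 1 $ k + A $ i $ 2 * B $ 2 $ k" for A :: "real^2^2"
  by (simp add: matrix_matrix_mult_def sum_2)

lemma freq_mat_main: "(\<xi> v* freq_mat \<alpha> \<iota> j l) $ main_axis \<iota> = \<xi> $ main_axis \<iota> / 4 ^ j"
proof (cases \<iota>)
  case Hor
  then show ?thesis
    by (simp add: freq_mat_exp vector_matrix_2 matrix_matrix_2 powr_minus_nat)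
next
  case Ver
  then show ?thesis
    by (simp add: freq_mat_exp vector_matrix_2 matrix_matrix_2 powr_minus_nat)
qed

lemma freq_mat_cross: "(\<xi> v* freq_mat \<alpha> \<iota> j l) $ cross_axis \<iota> =
    2 powr (- \<alpha> * real j) * \<xi> $ cross_axis \<iota> - of_int l * (\<xi> $ main_axis \<iota> / 4 ^ j)"
proof (cases \<iota>)
  case Hor
  then show ?thesis
    by (simp add: freq_mat_exp vector_matrix_2 matrix_matrix_2 powr_minus_nat)
next
  case Ver
  then show ?thesis
    by (simp add: freq_mat_exp vector_matrix_2 matrix_matrix_2 powr_minus_nat)
qed

lemma freq_mat_slope:
  assumes "\<xi> $ main_axis \<iota> \<noteq> 0"
  shows "(\<xi> v* freq_mat \<alpha> \<iota> j l) $ cross_axis \<iota> / (\<xi> v* freq_mat \<alpha> \<iota> j l) $ main_axis \<iota> =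
    2 powr ((2 - \<alpha>) * real j) * (\<xi> $ cross_axis \<iota> / \<xi> $ main_axis \<iota>) - of_int l"
proof -
  have "(4::real) ^ j = 2 powr (2 * real j)"
    unfolding four_powr[symmetric] by (simp add: powr_realpow)
  moreover have "(2 - \<alpha>) * real j = - \<alpha> * real j + 2 * real j" by (simp add: algebra_simps)
  ultimately have x: "2 powr ((2 - \<alpha>) * real j) = 2 powr (- \<alpha> * real j) * 4 ^ j"
    by (simp only: powr_add)
  have "(A * c - l' * (m / p)) / (m / p) = A * p * (c / m) - l'"
    if "m \<noteq> 0" "p \<noteq> 0" for A c l' m p :: real
    using that by (simp add: field_simps)
  then show ?thesis unfolding freq_mat_main freq_mat_cross x using assms by simp
qed

lemma det_freq_mat: "\<bar>det (freq_mat \<alpha> \<iota> j l)\<bar> = 2 powr (- (2 + \<alpha>) * real j)"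
proof -
  have "det (freq_mat \<alpha> \<iota> j l) = 4 powr (- real j) * 2 powr (- (\<alpha> * real j))"
    by (cases \<iota>; simp add: freq_mat_exp det_2 matrix_matrix_2)
  also have "\<dots> = 2 powr (2 * - real j + - (\<alpha> * real j))" unfolding four_powr powr_add ..
  also have "2 * - real j + - (\<alpha> * real j) = - (2 + \<alpha>) * real j" by (simp add: algebra_simps)
  finally show ?thesis by simp
qed

section \<open>The radial and the directional windows\<close>

lemma fsupp_zero:
  assumes "fsupp f \<subseteq> A" "x \<notin> A" shows "f x = 0"
proof (rule ccontr)
  assume "f x \<noteq> 0"
  then have "x \<in> fsupp f" unfolding fsupp_def by (intro subsetD[OF closure_subset]) simp
  with assms show False by auto
qed

text \<open>
  The Fourier transform of a radial generator is real, so for such generators this is \<open>Omega_hat\<close>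
  as a real number (\<open>Omega_hat_eq\<close>).
\<close>

definition Omega_re :: "(real \<Rightarrow> complex) \<Rightarrow> real^2 \<Rightarrow> real" where
  "Omega_re \<Xi> \<xi> = Re (fourier \<Xi> (\<xi> $ 1)) * Re (fourier \<Xi> (\<xi> $ 2))"

context
  fixes \<Xi> :: "real \<Rightarrow> complex"
  assumes gen: "radial_generator \<Xi>"
begin

lemma fourier_gen: "fourier \<Xi> t = complex_of_real (Re (fourier \<Xi> t))"
    "0 \<le> Re (fourier \<Xi> t)" "Re (fourier \<Xi> t) \<le> 1"
proof -
  have "fourier \<Xi> t \<in> complex_of_real ` {0..1}" using gen unfolding radial_generator_def by blast
  then show "fourier \<Xi> t = complex_of_real (Re (fourier \<Xi> t))"
    "0 \<le> Re (fourier \<Xi> t)" "Re (fourier \<Xi> t) \<le> 1" by auto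
qed

lemma fourier_gen_1:
  assumes "\<bar>t\<bar> \<le> 1/32" shows "fourier \<Xi> t = 1"
proof -
  have "t \<in> {-1/32..1/32}" using assms unfolding atLeastAtMost_iff by linarith
  then show ?thesis using gen unfolding radial_generator_def by blast
qed

lemma fourier_gen_0:
  assumes "\<bar>t\<bar> > 1/16" shows "fourier \<Xi> t = 0"
proof -
  have "fsupp (fourier \<Xi>) \<subseteq> {-1/16..1/16}" using gen unfolding radial_generator_def by blast
  moreover have "t \<notin> {-1/16..1/16}" using assms unfolding atLeastAtMost_iff by linarith
  ultimately show ?thesis by (rule fsupp_zero)
qed

lemma fourier_gen_measurable [measurable]: "fourier \<Xi> \<in> borel_measurable borel"
proof -
  \<comment> \<open>A non-integrable generator would have Fourier transform 0 at the origin, where the value is 1.\<close>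
  have "integrable lborel \<Xi>"
  proof (rule ccontr)
    assume "\<not> integrable lborel \<Xi>"
    then have "fourier \<Xi> 0 = 0" by (simp add: fourier_def not_integrable_integral_eq)
    then show False using fourier_gen_1[of 0] by simp
  qed
  then have [measurable]: "\<Xi> \<in> borel_measurable borel" using borel_measurable_integrable by simp
  show ?thesis by measurable
qed

lemma Omega_re_bounds: "0 \<le> Omega_re \<Xi> \<xi>" "Omega_re \<Xi> \<xi> \<le> 1"
  using fourier_gen(2,3) by (auto simp: Omega_re_def intro: mult_le_one)

lemma Omega_re_1: "(\<And>i. \<bar>\<xi> $ i\<bar> \<le> 1/32) \<Longrightarrow> Omega_re \<Xi> \<xi> = 1"
  by (simp add: Omega_re_def fourier_gen_1)

lemma Omega_re_0: "\<bar>\<xi> $ i\<bar> > 1/16 \<Longrightarrow> Omega_re \<Xi> \<xi> = 0"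
  using exhaust_2[of i] by (auto simp: Omega_re_def fourier_gen_0)

lemma Omega_re_measurable [measurable]: "Omega_re \<Xi> \<in> borel_measurable borel"
  unfolding Omega_re_def[abs_def] by measurable

lemma Omega_hat_eq: "Omega_hat \<Xi> \<xi> = complex_of_real (Omega_re \<Xi> \<xi>)"
  unfolding Omega_hat_def Omega_re_def of_real_mult
  by (rule arg_cong2[where f="(*)", OF fourier_gen(1) fourier_gen(1)])

text \<open>
  The radicand is nonnegative: \<open>Omega_re \<Xi>\<close> is at most 1, and where it does not vanish both
  coordinates are at most 1/16 in modulus, so that the value at \<open>\<xi>/4\<close> is 1.
\<close>

lemma W_power2: "(W \<Xi> \<xi>)\<^sup>2 = (Omega_re \<Xi> ((1/4) *\<^sub>R \<xi>))\<^sup>2 - (Omega_re \<Xi> \<xi>)\<^sup>2"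
proof -
  have "(Omega_re \<Xi> \<xi>)\<^sup>2 \<le> (Omega_re \<Xi> ((1/4) *\<^sub>R \<xi>))\<^sup>2"
  proof (cases "\<forall>i. \<bar>\<xi> $ i\<bar> \<le> 1/16")
    case True
    have "Omega_re \<Xi> ((1/4) *\<^sub>R \<xi>) = 1"
    proof (rule Omega_re_1)
      fix i show "\<bar>((1/4) *\<^sub>R \<xi>) $ i\<bar> \<le> 1/32" using True[rule_format, of i] by (simp add: abs_mult)
    qed
    then show ?thesis using Omega_re_bounds[of \<xi>] by (simp add: power_le_one)
  next
    case False
    then show ?thesis using Omega_re_0[of \<xi>] by (auto simp: not_le)
  qed
  then show ?thesis unfolding W_def Omega_hat_eq by (simp flip: of_real_power of_real_diff)
qed

lemma W_nonneg: "W \<Xi> \<xi> \<ge> 0"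
proof -
  have "Re ((Omega_hat \<Xi> ((1/4) *\<^sub>R \<xi>))\<^sup>2 - (Omega_hat \<Xi> \<xi>)\<^sup>2) = (Omega_re \<Xi> ((1/4) *\<^sub>R \<xi>))\<^sup>2 - (Omega_re \<Xi> \<xi>)\<^sup>2"
    unfolding Omega_hat_eq by (simp flip: of_real_power of_real_diff)
  also have "\<dots> \<ge> 0" unfolding W_power2[symmetric] by simp
  finally show ?thesis unfolding W_def by simp
qed

lemma Wj_power2: "(Wj \<Xi> j \<xi>)\<^sup>2 = (Omega_re \<Xi> ((1 / 4 ^ Suc j) *\<^sub>R \<xi>))\<^sup>2 - (Omega_re \<Xi> ((1 / 4 ^ j) *\<^sub>R \<xi>))\<^sup>2"
  unfolding Wj_def W_power2 by (simp add: power_mult)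

lemma sum_Wj_power2: "(\<Sum>j<n. (Wj \<Xi> j \<xi>)\<^sup>2) = (Omega_re \<Xi> ((1 / 4 ^ n) *\<^sub>R \<xi>))\<^sup>2 - (Omega_re \<Xi> \<xi>)\<^sup>2"
  unfolding Wj_power2 by (subst sum_lessThan_telescope) simp

lemma Wj_measurable [measurable]: "Wj \<Xi> j \<in> borel_measurable borel"
proof -
  have "Wj \<Xi> j = (\<lambda>\<xi>. sqrt ((Wj \<Xi> j \<xi>)\<^sup>2))"
    by (rule ext) (simp add: Wj_def W_nonneg)
  also have "\<dots> \<in> borel_measurable borel" unfolding Wj_power2 by measurable
  finally show ?thesis .
qed

lemma Wj_le_1: "\<bar>Wj \<Xi> j \<xi>\<bar> \<le> 1"
proof -
  have "(Wj \<Xi> j \<xi>)\<^sup>2 \<le> (Omega_re \<Xi> ((1 / 4 ^ Suc j) *\<^sub>R \<xi>))\<^sup>2" unfolding Wj_power2 by simp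
  also have "\<dots> \<le> 1" using Omega_re_bounds by (intro power_le_one)
  finally show ?thesis by (simp add: abs_square_le_1)
qed

lemma Wj_support: "Wj \<Xi> j \<xi> \<noteq> 0 \<Longrightarrow> \<bar>\<xi> $ i\<bar> / 4 ^ j \<le> 1/4"
proof (rule ccontr)
  assume W: "Wj \<Xi> j \<xi> \<noteq> 0" and *: "\<not> \<bar>\<xi> $ i\<bar> / 4 ^ j \<le> 1/4"
  then have "1/16 < \<bar>((1 / 4 ^ Suc j) *\<^sub>R \<xi>) $ i\<bar>" "1/16 < \<bar>((1 / 4 ^ j) *\<^sub>R \<xi>) $ i\<bar>"
    by (simp_all add: abs_mult)
  then have "(Wj \<Xi> j \<xi>)\<^sup>2 = 0" unfolding Wj_power2 using Omega_re_0 by simp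
  with W show False by simp
qed

lemma Omega_re_limit: "(\<lambda>n. Omega_re \<Xi> ((1 / 4 ^ n) *\<^sub>R \<xi>)) \<longlonglongrightarrow> 1"
proof (rule tendsto_eventually)
  have "(\<lambda>n. (1/4::real) ^ n * (\<bar>\<xi> $ 1\<bar> + \<bar>\<xi> $ 2\<bar>)) \<longlonglongrightarrow> 0"
    by (intro tendsto_mult_left_zero LIMSEQ_power_zero) simp
  then have "\<forall>\<^sub>F n in sequentially. (1/4::real) ^ n * (\<bar>\<xi> $ 1\<bar> + \<bar>\<xi> $ 2\<bar>) < 1/32"
    by (rule order_tendstoD) simp
  then show "\<forall>\<^sub>F n in sequentially. Omega_re \<Xi> ((1 / 4 ^ n) *\<^sub>R \<xi>) = 1"
  proof eventually_elim
    case (elim n)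
    show ?case
    proof (rule Omega_re_1)
      fix i :: 2
      have "\<bar>\<xi> $ i\<bar> \<le> \<bar>\<xi> $ 1\<bar> + \<bar>\<xi> $ 2\<bar>" using exhaust_2[of i] by auto
      then have "(1/4) ^ n * \<bar>\<xi> $ i\<bar> \<le> (1/4) ^ n * (\<bar>\<xi> $ 1\<bar> + \<bar>\<xi> $ 2\<bar>)" by (rule mult_left_mono) simp
      then have "(1/4) ^ n * \<bar>\<xi> $ i\<bar> \<le> 1/32" using elim by linarith
      then show "\<bar>((1 / 4 ^ n) *\<^sub>R \<xi>) $ i\<bar> \<le> 1/32"
        by (simp add: abs_mult power_one_over)
    qed
  qed
qed

end

lemma max_shear_0: "max_shear \<alpha> 0 = 2"
  by (simp add: max_shear_def)

context
  fixes v :: "real \<Rightarrow> complex"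
  assumes dw: "directional_window v"
begin

lemma window_continuous: "continuous_on UNIV v"
proof -
  have "v differentiable at x" for x
    using dw unfolding directional_window_def smooth_real_line_def by (metis funpow_0)
  then show ?thesis
    unfolding continuous_on_eq_continuous_at[OF open_UNIV]
    using differentiable_imp_continuous_within by blast
qed

lemma window_measurable [measurable]: "v \<in> borel_measurable borel"
  by (rule borel_measurable_continuous_onI[OF window_continuous])

lemma window_0:
  assumes "\<bar>t\<bar> > 3/2" shows "v t = 0"
proof -
  have "fsupp v \<subseteq> {-3/2..3/2}" using dw unfolding directional_window_def by blast
  moreover have "t \<notin> {-3/2..3/2}" using assms unfolding atLeastAtMost_iff by linarith
  ultimately show ?thesis by (rule fsupp_zero)
qed

lemma window_sum:
  assumes "\<bar>t\<bar> \<le> 3/2"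
  shows "(\<Sum>l\<in>{-2..2::int}. (cmod (v (t - of_int l)))\<^sup>2) = 1"
proof -
  have "t \<in> {-3/2..3/2}" using assms unfolding atLeastAtMost_iff by linarith
  then show ?thesis using dw unfolding directional_window_def by blast
qed

lemma window_le_1: "cmod (v t) \<le> 1"
proof (cases "\<bar>t\<bar> \<le> 3/2")
  case True
  have "(cmod (v (t - of_int 0)))\<^sup>2 \<le> (\<Sum>l\<in>{-2..2::int}. (cmod (v (t - of_int l)))\<^sup>2)"
    by (rule member_le_sum) auto
  then show ?thesis using window_sum[OF True] by (simp add: abs_square_le_1[of "cmod (v t)"])
qed (simp add: window_0)

text \<open>
  At most the five shears \<open>l\<close> within distance 2 of the integer \<open>m\<close> nearest to \<open>t\<close> contribute, and the
  normalisation of \<open>v\<close> gives the value 1 for these. With \<open>x = 2 powr ((2 - \<alpha>) * j)\<close>, shears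
  beyond \<open>max_shear\<close> have distance at least \<open>x/2 + 1\<close> from \<open>t\<close>, which exceeds 3/2 if \<open>x > 1\<close>. The
  remaining case \<open>x = 1\<close> occurs for \<open>j = 0\<close>, where the sum is the one in the normalisation.
\<close>

lemma window_sum_max_shear:
  assumes \<alpha>: "\<alpha> < 2" and t: "\<bar>t\<bar> \<le> 3/2 * 2 powr ((2 - \<alpha>) * real j)"
  shows "(\<Sum>l\<in>{- max_shear \<alpha> j..max_shear \<alpha> j}. (cmod (v (t - of_int l)))\<^sup>2) = 1"
proof (cases "j = 0")
  case True
  then show ?thesis using window_sum[of t] t by (simp add: max_shear_0)
next
  case False
  define x where "x = 2 powr ((2 - \<alpha>) * real j)"
  have x: "x > 1" unfolding x_def by (rule gr_one_powr) (use False \<alpha> in simp_all)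
  define L where "L = max_shear \<alpha> j"
  have L: "real_of_int L \<ge> 2 * x" unfolding L_def max_shear_def x_def by (rule le_of_int_ceiling)
  define m where "m = round t"
  have m: "\<bar>t - of_int m\<bar> \<le> 1/2" unfolding m_def using of_int_round_abs_le[of t] by (simp add: abs_minus_commute)
  have zero1: "v (t - of_int l) = 0" if "l \<notin> {m - 2..m + 2}" for l
  proof (rule window_0)
    from that have "l \<le> m - 3 \<or> l \<ge> m + 3" by auto
    then have "real_of_int l \<le> of_int m - 3 \<or> real_of_int l \<ge> of_int m + 3" by linarith
    with m show "3/2 < \<bar>t - of_int l\<bar>" by linarith
  qed
  have zero2: "v (t - of_int l) = 0" if "l \<notin> {-L..L}" for l
  proof (rule window_0)
    from that have "l \<ge> L + 1 \<or> l \<le> - L - 1" by auto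
    then have "real_of_int l \<ge> of_int L + 1 \<or> real_of_int l \<le> - of_int L - 1" by linarith
    with L x t show "3/2 < \<bar>t - of_int l\<bar>" unfolding x_def[symmetric] by linarith
  qed
  have "(\<Sum>l\<in>{-L..L}. (cmod (v (t - of_int l)))\<^sup>2) = (\<Sum>l\<in>{-L..L} \<inter> {m-2..m+2}. (cmod (v (t - of_int l)))\<^sup>2)"
    by (rule sum.mono_neutral_right) (auto simp: zero1)
  also have "\<dots> = (\<Sum>l\<in>{m-2..m+2}. (cmod (v (t - of_int l)))\<^sup>2)"
    by (rule sum.mono_neutral_left) (auto simp: zero2)
  also have "\<dots> = (\<Sum>l\<in>{-2..2::int}. (cmod (v ((t - of_int m) - of_int l)))\<^sup>2)"
    by (rule sum.reindex_bij_witness[of _ "\<lambda>l. l + m" "\<lambda>l. l - m"]) (auto simp: algebra_simps)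
  also have "\<dots> = 1" by (rule window_sum) (use m in linarith)
  finally show ?thesis unfolding L_def .
qed

end

section \<open>Shearlets form a tight frame on each cone\<close>

lemma has_sum_Sigma_nonneg:
  fixes f :: "'a \<times> 'b \<Rightarrow> real"
  assumes "\<And>x. x \<in> A \<Longrightarrow> ((\<lambda>y. f (x, y)) has_sum g x) (B x)" "(g has_sum S) A"
    and "\<And>x y. f (x, y) \<ge> 0"
  shows "(f has_sum S) (Sigma A B)"
  using assms by (intro has_sum_SigmaI[where g=g] summable_on_SigmaI[where g=g]) (auto simp: summable_on_def)

text \<open>
  The shearlet on the Fourier side without its exponential and its normalising constant.
\<close>

definition shearlet_amplitude ::
  "real \<Rightarrow> (real \<Rightarrow> complex) \<Rightarrow> (real \<Rightarrow> complex) \<Rightarrow> dir \<Rightarrow> nat \<Rightarrow> int \<Rightarrow> real^2 \<Rightarrow> complex" where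
  "shearlet_amplitude \<alpha> \<Xi> v \<iota> j l \<xi> = complex_of_real (Wj \<Xi> j \<xi>) * V v \<iota> (\<xi> v* freq_mat \<alpha> \<iota> j l)"

lemma shearlet_amplitude_measurable:
  assumes gen: "radial_generator \<Xi>" and dw: "directional_window v"
  shows "shearlet_amplitude \<alpha> \<Xi> v \<iota> j l \<in> borel_measurable borel"
proof -
  note [measurable] = Wj_measurable[OF gen] window_measurable[OF dw]
  have [measurable]: "V v \<iota> \<in> borel_measurable borel" unfolding V_eq[abs_def] by measurable
  show ?thesis unfolding shearlet_amplitude_def[abs_def] by measurable
qed

lemma shearlet_amplitude_le_1:
  assumes gen: "radial_generator \<Xi>" and dw: "directional_window v"
  shows "cmod (shearlet_amplitude \<alpha> \<Xi> v \<iota> j l \<xi>) \<le> 1"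
  using Wj_le_1[OF gen, of j \<xi>] window_le_1[OF dw]
  by (auto simp: shearlet_amplitude_def norm_mult V_eq intro!: mult_le_one)

lemma shearlet_hat_eq:
  "shearlet_hat \<alpha> \<Xi> v \<iota> j l k = (\<lambda>\<xi>. complex_of_real (sqrt \<bar>det (freq_mat \<alpha> \<iota> j l)\<bar>) *
      shearlet_amplitude \<alpha> \<Xi> v \<iota> j l \<xi> * cis (2 * pi * ((\<xi> v* freq_mat \<alpha> \<iota> j l) \<bullet> int_vec k)))"
proof -
  have sqrt_det: "sqrt \<bar>det (freq_mat \<alpha> \<iota> j l)\<bar> = 2 powr (- (2 + \<alpha>) * real j / 2)"
    unfolding det_freq_mat by (simp add: powr_half_sqrt[symmetric] powr_powr)
  show ?thesis
    unfolding sqrt_det shearlet_hat_def freq_mat_def[symmetric] shearlet_amplitude_def int_vec_def Let_def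
    by (simp only: mult.assoc)
qed

lemma shearlet_hat_in_L2:
  assumes gen: "radial_generator \<Xi>" and dw: "directional_window v"
  shows "shearlet_hat \<alpha> \<Xi> v \<iota> j l k \<in> L2"
proof -
  let ?B = "cbox (\<chi> i. - (4 ^ j)) (\<chi> i. 4 ^ j) :: (real^2) set"
  let ?c = "\<lambda>\<xi>. complex_of_real (sqrt \<bar>det (freq_mat \<alpha> \<iota> j l)\<bar>) * cis (2 * pi * ((\<xi> v* freq_mat \<alpha> \<iota> j l) \<bullet> int_vec k))"
  have B: "(\<lambda>\<xi>. indicator ?B \<xi> :: complex) \<in> L2"
    by (rule L2_indicator) (auto simp: emeasure_lborel_cbox_eq)
  have "shearlet_amplitude \<alpha> \<Xi> v \<iota> j l \<in> L2"
  proof (rule L2_dominated[OF B, where C=1])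
    show "AE \<xi> in lborel. cmod (shearlet_amplitude \<alpha> \<Xi> v \<iota> j l \<xi>) \<le> 1 * cmod (indicator ?B \<xi>)"
    proof (rule AE_I2)
      fix \<xi> :: "real^2"
      show "cmod (shearlet_amplitude \<alpha> \<Xi> v \<iota> j l \<xi>) \<le> 1 * cmod (indicator ?B \<xi>)"
      proof (cases "Wj \<Xi> j \<xi> = 0")
        case False
        have "\<bar>\<xi> $ i\<bar> \<le> 4 ^ j" for i
          using Wj_support[OF gen False, of i] by (simp add: divide_le_eq)
        then have "\<xi> \<in> ?B" by (simp add: mem_box_cart abs_le_iff minus_le_iff)
        then show ?thesis using shearlet_amplitude_le_1[OF gen dw] by simp
      qed (simp add: shearlet_amplitude_def)
    qed
  qed (rule shearlet_amplitude_measurable[OF gen dw])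
  then have "(\<lambda>\<xi>. ?c \<xi> * shearlet_amplitude \<alpha> \<Xi> v \<iota> j l \<xi>) \<in> L2"
    by (rule L2_mult_bounded[where C="sqrt \<bar>det (freq_mat \<alpha> \<iota> j l)\<bar>"]) (auto simp: norm_mult)
  then show ?thesis unfolding shearlet_hat_eq by (simp add: mult_ac)
qed

text \<open>
  The sum over \<open>k\<close> is Parseval's identity for the lattice exponentials, since the amplitude is supported
  where \<open>\<xi> M\<close> lies in the cube: the main coordinate of \<open>\<xi> M\<close> is at most 1/4 by the support of \<open>W\<^sub>j\<close>,
  and the quotient of the coordinates is at most 3/2 by that of \<open>v\<close>. The sum over \<open>l\<close> removes the
  directional window, because for \<open>\<xi>\<close> in the cone the relevant quotient satisfies the hypothesis of
  \<open>window_sum_max_shear\<close>. The sum over \<open>j\<close> telescopes, and the low-frequency term vanishes because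
  \<open>1/8 > 1/16\<close>.
\<close>

theorem shearlets_tight_on_cone:
  fixes \<alpha> :: real and \<Xi> v :: "real \<Rightarrow> complex" and G :: "real^2 \<Rightarrow> complex"
  assumes \<alpha>: "\<alpha> < 2" and gen: "radial_generator \<Xi>" and dw: "directional_window v"
    and G: "G \<in> L2" and supp: "AE \<xi> in lborel. \<xi> \<notin> \<C> (Cone \<iota>) \<longrightarrow> G \<xi> = 0"
  shows "((\<lambda>(j, l, k). (cmod (L2_inner G (shearlet_hat \<alpha> \<Xi> v \<iota> j l k)))\<^sup>2) has_sum (L2_norm G)\<^sup>2)
    (Sigma UNIV (\<lambda>j. {- max_shear \<alpha> j..max_shear \<alpha> j} \<times> UNIV))"
proof -
  note [measurable] = fourier_gen_measurable[OF gen] Omega_re_measurable[OF gen] Wj_measurable[OF gen] window_measurable[OF dw]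
  have [measurable]: "G \<in> borel_measurable borel" using G by measurable
  let ?amp = "shearlet_amplitude \<alpha> \<Xi> v \<iota>"
  have amp_meas [measurable]: "?amp j l \<in> borel_measurable borel" for j l
    by (rule shearlet_amplitude_measurable[OF gen dw])
  have amp_le: "cmod (?amp j l \<xi>) \<le> 1" for j l \<xi> by (rule shearlet_amplitude_le_1[OF gen dw])
  \<comment> \<open>Where the main coordinate vanishes, the quotient in \<open>V\<close> is 0 by convention and \<open>V\<close> need not be 0; this line is a null set.\<close>
  have axis_AE: "AE \<xi> in (lborel :: (real^2) measure). \<xi> $ main_axis \<iota> \<noteq> 0" for \<iota>
  proof -
    have "{\<xi> :: real^2. axis (main_axis \<iota>) 1 \<bullet> \<xi> = 0} \<in> null_sets lebesgue"
      unfolding negligible_iff_null_sets[symmetric] by (intro negligible_hyperplane) (simp add: axis_eq_0_iff)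
    then have "{\<xi> :: real^2. \<xi> $ main_axis \<iota> = 0} \<in> null_sets lebesgue" by (simp add: inner_axis')
    then have "{\<xi> :: real^2. \<xi> $ main_axis \<iota> = 0} \<in> null_sets lborel"
      by (subst (asm) null_sets_completion_iff) auto
    then show ?thesis by (subst (asm) AE_iff_null_sets) auto
  qed
  have amp_supp: "AE \<xi> in lborel. ?amp j l \<xi> \<noteq> 0 \<longrightarrow> \<xi> v* freq_mat \<alpha> \<iota> j l \<in> cube" for j l
    using axis_AE[of \<iota>]
  proof eventually_elim
    case (elim \<xi>)
    show ?case
    proof
      assume "?amp j l \<xi> \<noteq> 0"
      then have W: "Wj \<Xi> j \<xi> \<noteq> 0" and V: "V v \<iota> (\<xi> v* freq_mat \<alpha> \<iota> j l) \<noteq> 0" by (auto simp: shearlet_amplitude_def)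
      let ?\<eta> = "\<xi> v* freq_mat \<alpha> \<iota> j l"
      have 1: "\<bar>?\<eta> $ main_axis \<iota>\<bar> \<le> 1/4" using Wj_support[OF gen W, of "main_axis \<iota>"]
        by (simp add: freq_mat_main)
      have "?\<eta> $ main_axis \<iota> \<noteq> 0" using elim by (simp add: freq_mat_main)
      have "\<bar>?\<eta> $ cross_axis \<iota> / ?\<eta> $ main_axis \<iota>\<bar> \<le> 3/2"
        using V window_0[OF dw] unfolding V_eq by (meson not_le)
      then have "\<bar>?\<eta> $ cross_axis \<iota>\<bar> \<le> 3/2 * \<bar>?\<eta> $ main_axis \<iota>\<bar>"
        using \<open>?\<eta> $ main_axis \<iota> \<noteq> 0\<close> by (simp only: abs_divide pos_divide_le_eq zero_less_abs_iff not_False_eq_True)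
      with 1 have "\<bar>?\<eta> $ main_axis \<iota>\<bar> \<le> 1/2 \<and> \<bar>?\<eta> $ cross_axis \<iota>\<bar> \<le> 1/2" by linarith
      then show "?\<eta> \<in> cube" unfolding cube_def mem_Collect_eq forall_axes[where \<iota>=\<iota>] .
    qed
  qed
  define a where "a j l = (L2_norm (\<lambda>\<xi>. cnj (?amp j l \<xi>) * G \<xi>))\<^sup>2" for j l
  have sum_k: "((\<lambda>k. (cmod (L2_inner G (shearlet_hat \<alpha> \<Xi> v \<iota> j l k)))\<^sup>2) has_sum a j l) UNIV" for j l
    unfolding shearlet_hat_eq a_def
    by (rule linear_substitution.lattice_exponentials_Parseval[OF linear_substitution_freq_mat G amp_meas amp_le amp_supp])
  define b where "b j = (\<integral>\<xi>. (Wj \<Xi> j \<xi>)\<^sup>2 * (cmod (G \<xi>))\<^sup>2 \<partial>lborel)" for j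
  have int_b: "integrable lborel (\<lambda>\<xi>. u \<xi> * (cmod (G \<xi>))\<^sup>2)" if [measurable]: "u \<in> borel_measurable borel"
     and "\<And>\<xi>. \<bar>u \<xi>\<bar> \<le> 1" for u :: "real^2 \<Rightarrow> real"
    by (rule Bochner_Integration.integrable_bound[OF L2_integrable[OF G]])
      (use that in \<open>auto simp: abs_mult intro!: mult_left_le_one_le\<close>)
  have Wj2: "\<bar>(Wj \<Xi> j \<xi>)\<^sup>2\<bar> \<le> 1" for j \<xi> using Wj_le_1[OF gen, of j \<xi>] by (simp add: abs_square_le_1)
  have sum_l: "(\<Sum>l\<in>{- max_shear \<alpha> j..max_shear \<alpha> j}. a j l) = b j" for j
  proof -
    let ?L = "{- max_shear \<alpha> j..max_shear \<alpha> j}"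
    have "(\<Sum>l\<in>?L. a j l) = (\<integral>\<xi>. (\<Sum>l\<in>?L. (cmod (?amp j l \<xi>))\<^sup>2 * (cmod (G \<xi>))\<^sup>2) \<partial>lborel)"
      unfolding a_def L2_norm_power2 norm_mult power_mult_distrib complex_mod_cnj
      by (rule Bochner_Integration.integral_sum[symmetric], rule int_b) (auto simp: amp_le power_le_one)
    also have "\<dots> = b j" unfolding b_def
    proof (rule integral_cong_AE)
      show "AE \<xi> in lborel. (\<Sum>l\<in>?L. (cmod (?amp j l \<xi>))\<^sup>2 * (cmod (G \<xi>))\<^sup>2) = (Wj \<Xi> j \<xi>)\<^sup>2 * (cmod (G \<xi>))\<^sup>2"
        using supp
      proof eventually_elim
        case (elim \<xi>)
        show ?case
        proof (cases "\<xi> \<in> \<C> (Cone \<iota>)")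
          case True
          then have c: "1/8 \<le> \<bar>\<xi> $ main_axis \<iota>\<bar>" "\<bar>\<xi> $ cross_axis \<iota> / \<xi> $ main_axis \<iota>\<bar> \<le> 3/2"
            unfolding Cone_eq by auto
          then have nz: "\<xi> $ main_axis \<iota> \<noteq> 0" by auto
          let ?x = "2 powr ((2 - \<alpha>) * real j)"
          let ?t = "?x * (\<xi> $ cross_axis \<iota> / \<xi> $ main_axis \<iota>)"
          have V: "V v \<iota> (\<xi> v* freq_mat \<alpha> \<iota> j l) = v (?t - of_int l)" for l
            unfolding V_eq freq_mat_slope[OF nz] ..
          have "\<bar>?t\<bar> \<le> 3/2 * ?x" using c(2) mult_left_mono[OF c(2), of ?x] by (simp add: abs_mult mult.commute)
          from window_sum_max_shear[OF dw \<alpha> this]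
          have "(\<Sum>l\<in>?L. (cmod (V v \<iota> (\<xi> v* freq_mat \<alpha> \<iota> j l)))\<^sup>2) = 1" unfolding V .
          then have "(\<Sum>l\<in>?L. (cmod (?amp j l \<xi>))\<^sup>2) = (Wj \<Xi> j \<xi>)\<^sup>2"
            unfolding shearlet_amplitude_def norm_mult power_mult_distrib sum_distrib_left[symmetric] by simp
          then show ?thesis unfolding sum_distrib_right[symmetric] by simp
        next
          case False
          with elim show ?thesis by simp
        qed
      qed
    qed measurable
    finally show ?thesis .
  qed
  have sum_b: "(\<Sum>j<n. b j) = (\<integral>\<xi>. (Omega_re \<Xi> ((1 / 4 ^ n) *\<^sub>R \<xi>))\<^sup>2 * (cmod (G \<xi>))\<^sup>2 \<partial>lborel)" for n
  proof -
    have "(\<Sum>j<n. b j) = (\<integral>\<xi>. (\<Sum>j<n. (Wj \<Xi> j \<xi>)\<^sup>2 * (cmod (G \<xi>))\<^sup>2) \<partial>lborel)"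
      unfolding b_def by (rule Bochner_Integration.integral_sum[symmetric], rule int_b) (use Wj2 in auto)
    also have "\<dots> = (\<integral>\<xi>. (Omega_re \<Xi> ((1 / 4 ^ n) *\<^sub>R \<xi>))\<^sup>2 * (cmod (G \<xi>))\<^sup>2 \<partial>lborel)"
    proof (rule integral_cong_AE)
      show "AE \<xi> in lborel. (\<Sum>j<n. (Wj \<Xi> j \<xi>)\<^sup>2 * (cmod (G \<xi>))\<^sup>2) = (Omega_re \<Xi> ((1 / 4 ^ n) *\<^sub>R \<xi>))\<^sup>2 * (cmod (G \<xi>))\<^sup>2"
        using supp
      proof eventually_elim
        case (elim \<xi>)
        show ?case
        proof (cases "\<xi> \<in> \<C> (Cone \<iota>)")
          case True
          then have "1/16 < \<bar>\<xi> $ main_axis \<iota>\<bar>" unfolding Cone_eq by auto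
          from Omega_re_0[OF gen this] show ?thesis
            unfolding sum_distrib_right[symmetric] sum_Wj_power2[OF gen] by simp
        next
          case False
          with elim show ?thesis by simp
        qed
      qed
    qed measurable
    finally show ?thesis .
  qed
  have "(\<lambda>n. \<Sum>j<n. b j) \<longlonglongrightarrow> (\<integral>\<xi>. (cmod (G \<xi>))\<^sup>2 \<partial>lborel)"
    unfolding sum_b
  proof (rule integral_dominated_convergence[OF _ _ L2_integrable[OF G]])
    show "AE \<xi> in lborel. (\<lambda>n. (Omega_re \<Xi> ((1 / 4 ^ n) *\<^sub>R \<xi>))\<^sup>2 * (cmod (G \<xi>))\<^sup>2) \<longlonglongrightarrow> (cmod (G \<xi>))\<^sup>2"
    proof (rule AE_I2)
      fix \<xi>
      have "(\<lambda>n. (Omega_re \<Xi> ((1 / 4 ^ n) *\<^sub>R \<xi>))\<^sup>2 * (cmod (G \<xi>))\<^sup>2) \<longlonglongrightarrow> 1\<^sup>2 * (cmod (G \<xi>))\<^sup>2"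
        by (intro tendsto_intros Omega_re_limit[OF gen])
      then show "(\<lambda>n. (Omega_re \<Xi> ((1 / 4 ^ n) *\<^sub>R \<xi>))\<^sup>2 * (cmod (G \<xi>))\<^sup>2) \<longlonglongrightarrow> (cmod (G \<xi>))\<^sup>2" by simp
    qed
    show "AE \<xi> in lborel. norm ((Omega_re \<Xi> ((1 / 4 ^ n) *\<^sub>R \<xi>))\<^sup>2 * (cmod (G \<xi>))\<^sup>2) \<le> (cmod (G \<xi>))\<^sup>2" for n
      using Omega_re_bounds[OF gen] by (auto simp: abs_mult intro!: mult_left_le_one_le power_le_one)
  qed measurable
  then have "b sums (L2_norm G)\<^sup>2" unfolding sums_def L2_norm_power2 .
  then have "(b has_sum (L2_norm G)\<^sup>2) UNIV"
    by (rule sums_nonneg_imp_has_sum) (simp add: b_def)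
  moreover have "((\<lambda>(l, k). (cmod (L2_inner G (shearlet_hat \<alpha> \<Xi> v \<iota> j l k)))\<^sup>2) has_sum b j)
      ({- max_shear \<alpha> j..max_shear \<alpha> j} \<times> UNIV)" for j
    unfolding sum_l[symmetric]
    by (rule has_sum_Sigma_nonneg[where g="a j"]) (use sum_k in \<open>auto intro: has_sum_finite\<close>)
  ultimately show ?thesis
    by (intro has_sum_Sigma_nonneg[where g=b]) (auto simp: case_prod_unfold)
qed

section \<open>Boundedness of the cut-offs\<close>

text \<open>
  Each point \<open>\<xi>\<close> of the cone is the image of a point of \<open>\<C>_star \<iota>\<close> under one of the admissible matrices:
  the scale \<open>j\<close> brings the main coordinate into the prescribed range, and the shear \<open>l\<close>, the integer
  nearest to the rescaled slope, brings the slope into \<open>[-1/2, 1/2]\<close>. So the norm of order 0 already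
  controls \<open>f\<close> on the whole cone.
\<close>

lemma cone_cutoff_bounded:
  fixes f :: "real^2 \<Rightarrow> real"
  assumes \<alpha>: "\<alpha> < 2" and supp: "fsupp f \<subseteq> \<C> (Cone \<iota>)"
    and C: "\<And>j l. \<bar>l\<bar> \<le> max_shear \<alpha> j \<Longrightarrow> CN_norm 0 (\<C>_star \<iota>) (rescale \<alpha> \<iota> j l f) \<le> ereal C"
  shows "\<bar>f \<xi>\<bar> \<le> \<bar>C\<bar>"
proof (cases "\<xi> \<in> \<C> (Cone \<iota>)")
  case False
  then show ?thesis using fsupp_zero[OF supp] by simp
next
  case True
  let ?m = "\<xi> $ main_axis \<iota>" and ?c = "\<xi> $ cross_axis \<iota>"
  from True have m: "1/8 \<le> \<bar>?m\<bar>" and slope: "\<bar>?c / ?m\<bar> \<le> 3/2" unfolding Cone_eq by auto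
  have nz: "?m \<noteq> 0" using m by auto
  obtain n where "4 * \<bar>?m\<bar> < 4 ^ n" using real_arch_pow[of 4 "4 * \<bar>?m\<bar>"] by auto
  define j where "j = (LEAST j. 4 * \<bar>?m\<bar> \<le> 4 ^ j)"
  have j: "4 * \<bar>?m\<bar> \<le> 4 ^ j"
    unfolding j_def by (rule LeastI[of _ n]) (use \<open>4 * \<bar>?m\<bar> < 4 ^ n\<close> in simp)
  have j': "4 ^ j \<le> 16 * \<bar>?m\<bar>"
  proof (cases j)
    case 0
    then show ?thesis using m by simp
  next
    case (Suc i)
    then have "\<not> 4 * \<bar>?m\<bar> \<le> 4 ^ i" using not_less_Least[of i "\<lambda>j. 4 * \<bar>?m\<bar> \<le> 4 ^ j"] by (simp add: j_def)
    then show ?thesis using Suc by simp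
  qed
  define x where "x = 2 powr ((2 - \<alpha>) * real j)"
  have x1: "x \<ge> 1" using \<alpha> by (simp add: x_def ge_one_powr_ge_zero)
  define t where "t = x * (?c / ?m)"
  define l where "l = round t"
  have "\<bar>t\<bar> = x * \<bar>?c / ?m\<bar>" unfolding t_def abs_mult using x1 by simp
  also have "\<dots> \<le> x * (3/2)" using slope x1 by (intro mult_left_mono) auto
  finally have t: "\<bar>t\<bar> \<le> x * (3/2)" .
  have tl: "\<bar>t - of_int l\<bar> \<le> 1/2" unfolding l_def using of_int_round_abs_le[of t] by (simp add: abs_minus_commute)
  have "real_of_int (max_shear \<alpha> j) \<ge> 2 * x" unfolding max_shear_def x_def by (rule le_of_int_ceiling)
  then have "\<bar>real_of_int l\<bar> \<le> real_of_int (max_shear \<alpha> j)" using t tl x1 by linarith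
  then have l: "\<bar>l\<bar> \<le> max_shear \<alpha> j" by linarith
  let ?\<zeta> = "\<xi> v* freq_mat \<alpha> \<iota> j l"
  have \<zeta>m: "\<bar>?\<zeta> $ main_axis \<iota>\<bar> = \<bar>?m\<bar> / 4 ^ j" by (simp add: freq_mat_main)
  have "?\<zeta> $ cross_axis \<iota> / ?\<zeta> $ main_axis \<iota> = t - of_int l"
    unfolding t_def x_def by (rule freq_mat_slope[OF nz])
  moreover have "1/32 \<le> \<bar>?m\<bar> / 4 ^ j" "\<bar>?m\<bar> / 4 ^ j \<le> 1/4"
    using j j' m by (simp_all add: divide_le_eq le_divide_eq)
  ultimately have "?\<zeta> \<in> \<C>_star \<iota>"
    using tl unfolding Cone_star_eq mem_Collect_eq \<zeta>m by linarith
  then have "ereal \<bar>partials [] (rescale \<alpha> \<iota> j l f) ?\<zeta>\<bar> \<le> CN_norm 0 (\<C>_star \<iota>) (rescale \<alpha> \<iota> j l f)"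
    unfolding CN_norm_def
    by (intro SUP_upper2[of "([], ?\<zeta>)"]) auto
  also have "\<dots> \<le> ereal C" by (rule C[OF l])
  finally have "\<bar>rescale \<alpha> \<iota> j l f ?\<zeta>\<bar> \<le> C" by simp
  moreover have "rescale \<alpha> \<iota> j l f ?\<zeta> = f \<xi>"
    unfolding rescale_def freq_mat_inv_def[symmetric]
    by (simp add: linear_substitution.inverse1[OF linear_substitution_freq_mat])
  ultimately show ?thesis by simp
qed

lemma low_cutoff_bounded:
  fixes f :: "real^2 \<Rightarrow> real"
  assumes "smooth f" and supp: "fsupp f \<subseteq> \<C> Low"
  obtains C where "\<And>\<xi>. \<bar>f \<xi>\<bar> \<le> C"
proof -
  have "continuous_on UNIV (partials [] f)" using assms(1) unfolding smooth_def by blast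
  then have cont: "continuous_on UNIV f" by simp
  have "compact (f ` cbox (\<chi> i. -1) (\<chi> i. 1))"
    by (rule compact_continuous_image[OF continuous_on_subset[OF cont]]) auto
  then have "bounded (f ` cbox (\<chi> i. -1) (\<chi> i. 1))" by (rule compact_imp_bounded)
  then obtain C where C: "\<And>\<xi>. \<xi> \<in> cbox (\<chi> i. -1) (\<chi> i. 1) \<Longrightarrow> \<bar>f \<xi>\<bar> \<le> C" "C > 0"
    unfolding bounded_pos by auto
  have "\<bar>f \<xi>\<bar> \<le> C" for \<xi>
  proof (cases "\<xi> \<in> \<C> Low")
    case True
    then have "\<xi> \<in> cbox (\<chi> i. -1) (\<chi> i. 1)" by (auto simp: mem_box_cart forall_2 abs_le_iff)
    then show ?thesis by (rule C)
  next
    case False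
    then show ?thesis using fsupp_zero[OF supp] C(2) by simp
  qed
  then show ?thesis by (rule that)
qed

lemma region_cases: "r \<in> {Low, Cone Hor, Cone Ver}"
proof (cases r)
  case (Cone \<iota>) then show ?thesis by (cases \<iota>) auto
qed simp

lemma UNIV_region: "UNIV = {Low, Cone Hor, Cone Ver}"
  using region_cases by blast

instance region :: finite
  by standard (simp add: UNIV_region)

lemma cutoffs_bounded:
  assumes \<alpha>: "\<alpha> < 2" and cut: "cutoffs \<alpha> \<chi>' \<gamma>"
  obtains B where "B > 0" "\<And>r \<xi>. \<bar>\<chi>' r \<xi>\<bar> \<le> B" "\<And>r \<xi>. \<bar>\<gamma> r \<xi>\<bar> \<le> B"
proof -
  have "\<exists>B. \<forall>\<xi>. \<bar>\<chi>' r \<xi>\<bar> \<le> B \<and> \<bar>\<gamma> r \<xi>\<bar> \<le> B" for r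
  proof (cases r)
    case Low
    have "smooth (\<chi>' Low)" "fsupp (\<chi>' Low) \<subseteq> \<C> Low" "smooth (\<gamma> Low)" "fsupp (\<gamma> Low) \<subseteq> \<C> Low"
      using cut unfolding cutoffs_def by blast+
    then obtain C D where "\<And>\<xi>. \<bar>\<chi>' Low \<xi>\<bar> \<le> C" "\<And>\<xi>. \<bar>\<gamma> Low \<xi>\<bar> \<le> D"
      using low_cutoff_bounded by metis
    then show ?thesis unfolding Low by (intro exI[of _ "max C D"]) (simp add: max.coboundedI1 max.coboundedI2)
  next
    case (Cone \<iota>)
    have supp: "fsupp (\<chi>' (Cone \<iota>)) \<subseteq> \<C> (Cone \<iota>)" "fsupp (\<gamma> (Cone \<iota>)) \<subseteq> \<C> (Cone \<iota>)"
      using cut unfolding cutoffs_def by blast+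
    have "\<exists>C::real. \<forall>j l. \<bar>l\<bar> \<le> max_shear \<alpha> j \<longrightarrow>
        CN_norm 0 (\<C>_star \<iota>) (rescale \<alpha> \<iota> j l (\<chi>' (Cone \<iota>))) \<le> ereal C \<and>
        CN_norm 0 (\<C>_star \<iota>) (rescale \<alpha> \<iota> j l (\<gamma> (Cone \<iota>))) \<le> ereal C"
      using cut unfolding cutoffs_def by blast
    then obtain C where C: "\<And>j l. \<bar>l\<bar> \<le> max_shear \<alpha> j \<Longrightarrow>
        CN_norm 0 (\<C>_star \<iota>) (rescale \<alpha> \<iota> j l (\<chi>' (Cone \<iota>))) \<le> ereal C"
      "\<And>j l. \<bar>l\<bar> \<le> max_shear \<alpha> j \<Longrightarrow>
        CN_norm 0 (\<C>_star \<iota>) (rescale \<alpha> \<iota> j l (\<gamma> (Cone \<iota>))) \<le> ereal C"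
      by blast
    show ?thesis unfolding Cone
      using cone_cutoff_bounded[OF \<alpha> supp(1) C(1)] cone_cutoff_bounded[OF \<alpha> supp(2) C(2)] by blast
  qed
  then obtain b where b: "\<And>r \<xi>. \<bar>\<chi>' r \<xi>\<bar> \<le> b r \<and> \<bar>\<gamma> r \<xi>\<bar> \<le> b r" by metis
  have le: "b r \<le> (\<Sum>r\<in>UNIV. \<bar>b r\<bar>) + 1" for r
    using member_le_sum[of r UNIV "\<lambda>r. \<bar>b r\<bar>"] by simp
  show ?thesis
  proof (rule that[of "(\<Sum>r\<in>UNIV. \<bar>b r\<bar>) + 1"])
    show "0 < (\<Sum>r\<in>UNIV. \<bar>b r\<bar>) + 1" by (simp add: add_nonneg_pos sum_nonneg)
  qed (use b le order_trans in blast)+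
qed

section \<open>Gluing tight frames with multipliers\<close>

lemma has_sum_inner_polarized:
  fixes e :: "'i \<Rightarrow> 'a::euclidean_space \<Rightarrow> complex"
  assumes e: "\<And>i. i \<in> I \<Longrightarrow> e i \<in> L2" and G: "G \<in> L2" and H: "H \<in> L2"
    and tight: "\<And>c. ((\<lambda>i. (cmod (L2_inner (\<lambda>x. G x + c * H x) (e i)))\<^sup>2) has_sum (L2_norm (\<lambda>x. G x + c * H x))\<^sup>2) I"
  shows "((\<lambda>i. L2_inner G (e i) * cnj (L2_inner H (e i))) has_sum L2_inner G H) I"
proof -
  let ?n = "\<lambda>c. (L2_norm (\<lambda>x. G x + c * H x))\<^sup>2"
  let ?t = "\<lambda>c i. (cmod (L2_inner G (e i) + c * L2_inner H (e i)))\<^sup>2"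
  have t: "((\<lambda>i. ?t c i) has_sum ?n c) I" for c
  proof -
    have "L2_inner (\<lambda>x. G x + c * H x) (e i) = L2_inner G (e i) + c * L2_inner H (e i)" if "i \<in> I" for i
      using e[OF that] G H by (simp add: L2_inner_add_left L2_scale L2_inner_scale_left)
    then show ?thesis using tight[of c] by (simp cong: has_sum_cong)
  qed
  have diff: "((\<lambda>i. ?t c i - ?t d i) has_sum (?n c - ?n d)) I" for c d
  proof -
    have "((\<lambda>i. ?t c i + (-1) * ?t d i) has_sum (?n c + (-1) * ?n d)) I"
      by (intro has_sum_add has_sum_cmult_right t)
    then show ?thesis by simp
  qed
  have "((\<lambda>i. complex_of_real (?t 1 i - ?t (-1) i) + \<i> * complex_of_real (?t \<i> i - ?t (-\<i>) i)) has_sum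
      complex_of_real (?n 1 - ?n (-1)) + \<i> * complex_of_real (?n \<i> - ?n (-\<i>))) I"
    by (intro has_sum_add has_sum_cmult_right has_sum_of_real diff)
  then have "((\<lambda>i. (1/4) * (complex_of_real (?t 1 i - ?t (-1) i) + \<i> * complex_of_real (?t \<i> i - ?t (-\<i>) i))) has_sum
      (1/4) * (complex_of_real (?n 1 - ?n (-1)) + \<i> * complex_of_real (?n \<i> - ?n (-\<i>)))) I"
    by (rule has_sum_cmult_right)
  moreover have "(1/4) * (complex_of_real (?n 1 - ?n (-1)) + \<i> * complex_of_real (?n \<i> - ?n (-\<i>))) = L2_inner G H"
    using L2_polarization[OF G H] by (simp add: complex_eq_iff)
  moreover have "(1/4) * (complex_of_real (?t 1 i - ?t (-1) i) + \<i> * complex_of_real (?t \<i> i - ?t (-\<i>) i)) =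
      L2_inner G (e i) * cnj (L2_inner H (e i))" for i
    by (simp add: complex_eq_iff cmod_power2) (simp add: power2_eq_square algebra_simps)
  ultimately show ?thesis by simp
qed

text \<open>
  Weak reconstruction together with a Bessel bound \<open>D\<close> implies unconditional convergence in norm. For the
  remainder \<open>d\<close> after a finite partial sum over \<open>J\<close>, weak reconstruction tested against \<open>d\<close> itself
  expresses \<open>\<parallel>d\<parallel>\<^sup>2\<close> as the sum of the products of the coefficients of \<open>f\<close> and \<open>d\<close> outside \<open>J\<close>.
  The Bessel bound then yields \<open>\<parallel>d\<parallel>\<^sup>2 \<le> D * tail\<close>, with the tail of the square-summable coefficients
  of \<open>f\<close>.
\<close>

theorem L2_has_sum_of_dual_Bessel:
  fixes \<phi> \<psi> :: "'i \<Rightarrow> 'a::euclidean_space \<Rightarrow> complex"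
  assumes \<phi>: "\<And>i. i \<in> I \<Longrightarrow> \<phi> i \<in> L2" and D: "D > 0"
    and Bessel: "\<And>g. g \<in> L2 \<Longrightarrow> \<exists>s\<le>D * (L2_norm g)\<^sup>2. ((\<lambda>i. (cmod (L2_inner g (\<phi> i)))\<^sup>2) has_sum s) I"
    and f: "f \<in> L2" and square: "(\<lambda>i. (cmod (L2_inner f (\<psi> i)))\<^sup>2) summable_on I"
    and weak: "\<And>g. g \<in> L2 \<Longrightarrow> ((\<lambda>i. L2_inner f (\<psi> i) * cnj (L2_inner g (\<phi> i))) has_sum L2_inner f g) I"
  shows "L2_has_sum (\<lambda>i. L2_inner f (\<psi> i)) \<phi> I f"
proof -
  define c where "c i = L2_inner f (\<psi> i)" for i
  define p where "p J x = (\<Sum>i\<in>J. c i * \<phi> i x)" for J x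
  have p: "p J \<in> L2" if "J \<subseteq> I" for J
    unfolding p_def[abs_def] using that \<phi> by (intro L2_sum L2_scale) auto
  obtain T where T: "((\<lambda>i. (cmod (c i))\<^sup>2) has_sum T) I"
    using square unfolding c_def summable_on_def by blast
  have bound: "(L2_norm (\<lambda>x. p J x - f x))\<^sup>2 \<le> D * (T - (\<Sum>i\<in>J. (cmod (c i))\<^sup>2))"
    if J: "finite J" "J \<subseteq> I" for J
  proof -
    define d where "d x = f x - p J x" for x
    have d: "d \<in> L2" unfolding d_def[abs_def] by (intro L2_diff f p J)
    have "((\<lambda>i. c i * cnj (L2_inner d (\<phi> i))) has_sum (L2_inner f d - (\<Sum>i\<in>J. c i * cnj (L2_inner d (\<phi> i))))) (I - J)"
      using weak[OF d] J unfolding c_def by (intro has_sum_Diff has_sum_finite)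
    moreover have "(\<Sum>i\<in>J. c i * cnj (L2_inner d (\<phi> i))) = L2_inner (p J) d"
    proof -
      have "L2_inner d (p J) = (\<Sum>i\<in>J. cnj (c i) * L2_inner d (\<phi> i))"
        unfolding p_def using J \<phi> d by (subst L2_inner_sum_right) (auto intro: L2_scale simp: L2_inner_scale_right)
      then show ?thesis by (subst L2_inner_commute) simp
    qed
    moreover have "L2_inner f d - L2_inner (p J) d = complex_of_real ((L2_norm d)\<^sup>2)"
      using L2_inner_diff_left[OF f p[OF J(2)] d] unfolding L2_inner_self[symmetric] d_def[abs_def] by simp
    ultimately have S: "((\<lambda>i. c i * cnj (L2_inner d (\<phi> i))) has_sum complex_of_real ((L2_norm d)\<^sup>2)) (I - J)"
      by simp
    have Tc: "((\<lambda>i. (cmod (c i))\<^sup>2) has_sum (T - (\<Sum>i\<in>J. (cmod (c i))\<^sup>2))) (I - J)"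
      using T J by (intro has_sum_Diff has_sum_finite)
    obtain s where s: "s \<le> D * (L2_norm d)\<^sup>2" "((\<lambda>i. (cmod (L2_inner d (\<phi> i)))\<^sup>2) has_sum s) I"
      using Bessel[OF d] by blast
    have Td: "((\<lambda>i. (cmod (L2_inner d (\<phi> i)))\<^sup>2) has_sum (s - (\<Sum>i\<in>J. (cmod (L2_inner d (\<phi> i)))\<^sup>2))) (I - J)"
      using s(2) J by (intro has_sum_Diff has_sum_finite)
    \<comment> \<open>Young's inequality \<open>uv \<le> (D/2) u\<^sup>2 + v\<^sup>2 / (2 D)\<close>; with this weight the Bessel bound turns the second term into half of the left-hand side.\<close>
    have "norm (complex_of_real ((L2_norm d)\<^sup>2)) \<le>
      (D / 2) * (T - (\<Sum>i\<in>J. (cmod (c i))\<^sup>2)) + (1 / (2 * D)) * (s - (\<Sum>i\<in>J. (cmod (L2_inner d (\<phi> i)))\<^sup>2))"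
    proof (rule norm_infsum_le[OF S])
      show "((\<lambda>i. (D / 2) * (cmod (c i))\<^sup>2 + (1 / (2 * D)) * (cmod (L2_inner d (\<phi> i)))\<^sup>2) has_sum
          (D / 2) * (T - (\<Sum>i\<in>J. (cmod (c i))\<^sup>2)) + (1 / (2 * D)) * (s - (\<Sum>i\<in>J. (cmod (L2_inner d (\<phi> i)))\<^sup>2))) (I - J)"
        by (intro has_sum_add has_sum_cmult_right Tc Td)
      fix i
      let ?a = "cmod (c i)" and ?b = "cmod (L2_inner d (\<phi> i))"
      have "0 \<le> (D * ?a - ?b)\<^sup>2" by simp
      then have "2 * D * (?a * ?b) \<le> D\<^sup>2 * ?a\<^sup>2 + ?b\<^sup>2" by (simp add: power2_diff power_mult_distrib)
      then have "(2 * D * (?a * ?b)) / (2 * D) \<le> (D\<^sup>2 * ?a\<^sup>2 + ?b\<^sup>2) / (2 * D)"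
        using D by (intro divide_right_mono) auto
      then show "norm (c i * cnj (L2_inner d (\<phi> i))) \<le> (D / 2) * ?a\<^sup>2 + (1 / (2 * D)) * ?b\<^sup>2"
        using D by (simp add: norm_mult add_divide_distrib power2_eq_square)
    qed
    moreover have "s - (\<Sum>i\<in>J. (cmod (L2_inner d (\<phi> i)))\<^sup>2) \<le> D * (L2_norm d)\<^sup>2"
      using s(1) sum_nonneg[of J "\<lambda>i. (cmod (L2_inner d (\<phi> i)))\<^sup>2"] by simp
    then have "(1 / (2 * D)) * (s - (\<Sum>i\<in>J. (cmod (L2_inner d (\<phi> i)))\<^sup>2)) \<le> (1 / (2 * D)) * (D * (L2_norm d)\<^sup>2)"
      using D by (intro mult_left_mono) auto
    moreover have "(1 / (2 * D)) * (D * (L2_norm d)\<^sup>2) = (L2_norm d)\<^sup>2 / 2" using D by simp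
    moreover have "norm (complex_of_real ((L2_norm d)\<^sup>2)) = (L2_norm d)\<^sup>2"
      unfolding norm_of_real by simp
    ultimately have "(L2_norm d)\<^sup>2 \<le> (D / 2) * (T - (\<Sum>i\<in>J. (cmod (c i))\<^sup>2)) + (L2_norm d)\<^sup>2 / 2" by linarith
    then have "(L2_norm d)\<^sup>2 \<le> D * (T - (\<Sum>i\<in>J. (cmod (c i))\<^sup>2))" by simp
    moreover have "L2_norm d = L2_norm (\<lambda>x. p J x - f x)"
      unfolding d_def[abs_def] by (rule L2_norm_minus_commute)
    ultimately show ?thesis by simp
  qed
  have ev: "\<forall>\<^sub>F J in finite_subsets_at_top I. finite J \<and> J \<subseteq> I"
    by (rule eventually_finite_subsets_at_top_weakI) auto
  have "((\<lambda>J. D * (T - (\<Sum>i\<in>J. (cmod (c i))\<^sup>2))) \<longlongrightarrow> D * (T - T)) (finite_subsets_at_top I)"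
    using T unfolding has_sum_def by (intro tendsto_intros)
  then have lim: "((\<lambda>J. D * (T - (\<Sum>i\<in>J. (cmod (c i))\<^sup>2))) \<longlongrightarrow> 0) (finite_subsets_at_top I)" by simp
  have "((\<lambda>J. (L2_norm (\<lambda>x. p J x - f x))\<^sup>2) \<longlongrightarrow> 0) (finite_subsets_at_top I)"
    by (rule Lim_null_comparison[OF _ lim]) (use ev bound in \<open>auto elim!: eventually_mono\<close>)
  from tendsto_real_sqrt[OF this]
  have "((\<lambda>J. L2_norm (\<lambda>x. p J x - f x)) \<longlongrightarrow> 0) (finite_subsets_at_top I)" by simp
  then have "L2_tendsto p f (finite_subsets_at_top I)"
    by (subst L2_tendsto_iff) (use ev p f in \<open>auto elim!: eventually_mono\<close>)
  then show ?thesis unfolding L2_has_sum_def p_def[abs_def] c_def .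
qed

text \<open>
  A family \<open>e\<close> on the Fourier side whose index set is split by \<open>reg\<close> into finitely many parts, the
  part \<open>r\<close> being tight for functions living on \<open>C r\<close>. The members of \<open>e\<close> themselves may leave \<open>C r\<close>, as
  shearlets near the boundary of a cone do. The systems \<open>\<phi>\<close> and \<open>\<psi>\<close> arise from \<open>e\<close> by the multipliers
  \<open>a\<close> and \<open>b\<close>. The assumptions are symmetric in the two systems, so every result also holds with
  the systems exchanged. \<open>D\<close> is a common upper frame bound.
\<close>

locale glued_tight_frames =
  fixes I :: "'i set" and reg :: "'i \<Rightarrow> 'r::finite" and C :: "'r \<Rightarrow> 'a::euclidean_space set"
    and e :: "'i \<Rightarrow> 'a \<Rightarrow> complex" and a b :: "'r \<Rightarrow> 'a \<Rightarrow> real" and B D :: real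
    and \<phi> \<psi> :: "'i \<Rightarrow> 'a \<Rightarrow> complex"
  assumes countable: "countable I"
    and e_L2: "\<And>i. i \<in> I \<Longrightarrow> e i \<in> L2"
    and tight: "\<And>r G. G \<in> L2 \<Longrightarrow> (AE \<xi> in lborel. \<xi> \<notin> C r \<longrightarrow> G \<xi> = 0) \<Longrightarrow>
      ((\<lambda>i. (cmod (L2_inner G (e i)))\<^sup>2) has_sum (L2_norm G)\<^sup>2) {i \<in> I. reg i = r}"
    and a_meas: "\<And>r. a r \<in> borel_measurable borel" and b_meas: "\<And>r. b r \<in> borel_measurable borel"
    and a_le: "\<And>r \<xi>. \<bar>a r \<xi>\<bar> \<le> B" and b_le: "\<And>r \<xi>. \<bar>b r \<xi>\<bar> \<le> B" and B: "B > 0"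
    and D_eq: "D = real CARD('r) * B\<^sup>2"
    and a_supp: "\<And>r \<xi>. \<xi> \<notin> C r \<Longrightarrow> a r \<xi> = 0" and b_supp: "\<And>r \<xi>. \<xi> \<notin> C r \<Longrightarrow> b r \<xi> = 0"
    and ab: "\<And>\<xi>. (\<Sum>r\<in>UNIV. a r \<xi> * b r \<xi>) = 1"
    and \<phi>_L2: "\<And>i. i \<in> I \<Longrightarrow> \<phi> i \<in> L2" and \<psi>_L2: "\<And>i. i \<in> I \<Longrightarrow> \<psi> i \<in> L2"
    and \<phi>_inner: "\<And>i f. i \<in> I \<Longrightarrow> f \<in> L2 \<Longrightarrow>
      L2_inner f (\<phi> i) = L2_inner (\<lambda>\<xi>. complex_of_real (a (reg i) \<xi>) * fourier_L2 f \<xi>) (e i)"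
    and \<psi>_inner: "\<And>i f. i \<in> I \<Longrightarrow> f \<in> L2 \<Longrightarrow>
      L2_inner f (\<psi> i) = L2_inner (\<lambda>\<xi>. complex_of_real (b (reg i) \<xi>) * fourier_L2 f \<xi>) (e i)"
begin

lemma swapped: "glued_tight_frames I reg C e b a B D \<psi> \<phi>"
proof
  show "(\<Sum>r\<in>UNIV. b r \<xi> * a r \<xi>) = 1" for \<xi> using ab[of \<xi>] by (simp only: mult.commute)
qed (fact countable e_L2 tight a_meas b_meas a_le b_le B D_eq a_supp b_supp \<phi>_L2 \<psi>_L2 \<phi>_inner \<psi>_inner)+

definition filtered_hat :: "('r \<Rightarrow> 'a \<Rightarrow> real) \<Rightarrow> 'r \<Rightarrow> ('a \<Rightarrow> complex) \<Rightarrow> 'a \<Rightarrow> complex" where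
  "filtered_hat m r f \<xi> = complex_of_real (m r \<xi>) * fourier_L2 f \<xi>"

lemma filtered_hat_L2:
  assumes "f \<in> L2" shows "filtered_hat a r f \<in> L2" "filtered_hat b r f \<in> L2"
  unfolding filtered_hat_def[abs_def] using a_meas b_meas a_le b_le
  by (auto intro!: L2_mult_bounded[where C=B] fourier_L2_in_L2 assms)

lemma index_split: "(\<Union>r\<in>UNIV. {i \<in> I. reg i = r}) = I" by auto

lemma has_sum_regions:
  fixes g :: "'i \<Rightarrow> 'c::topological_comm_monoid_add"
  assumes "\<And>r. (g has_sum s r) {i \<in> I. reg i = r}"
  shows "(g has_sum (\<Sum>r\<in>UNIV. s r)) I"
  using sum_has_sum[where A=UNIV and f=g and s=s and B="\<lambda>r. {i \<in> I. reg i = r}"] assms index_split by auto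

lemma energy:
  assumes f: "f \<in> L2"
  shows "((\<lambda>i. (cmod (L2_inner f (\<phi> i)))\<^sup>2) has_sum (\<Sum>r\<in>UNIV. (L2_norm (filtered_hat a r f))\<^sup>2)) I"
proof (rule has_sum_regions)
  fix r
  have "((\<lambda>i. (cmod (L2_inner (filtered_hat a r f) (e i)))\<^sup>2) has_sum (L2_norm (filtered_hat a r f))\<^sup>2) {i \<in> I. reg i = r}"
    by (rule tight[OF filtered_hat_L2(1)[OF f]]) (simp add: filtered_hat_def a_supp)
  then show "((\<lambda>i. (cmod (L2_inner f (\<phi> i)))\<^sup>2) has_sum (L2_norm (filtered_hat a r f))\<^sup>2) {i \<in> I. reg i = r}"
    by (rule has_sum_cong[THEN iffD1, rotated]) (use f in \<open>auto simp: \<phi>_inner filtered_hat_def[abs_def]\<close>)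
qed

lemma energy_integral:
  assumes f: "f \<in> L2"
  shows "integrable lborel (\<lambda>\<xi>. (\<Sum>r\<in>UNIV. (a r \<xi>)\<^sup>2) * (cmod (fourier_L2 f \<xi>))\<^sup>2)"
    and "(\<Sum>r\<in>UNIV. (L2_norm (filtered_hat a r f))\<^sup>2) = (\<integral>\<xi>. (\<Sum>r\<in>UNIV. (a r \<xi>)\<^sup>2) * (cmod (fourier_L2 f \<xi>))\<^sup>2 \<partial>lborel)"
proof -
  have eq: "(\<Sum>r\<in>UNIV. (a r \<xi>)\<^sup>2) * (cmod (fourier_L2 f \<xi>))\<^sup>2 = (\<Sum>r\<in>UNIV. (cmod (filtered_hat a r f \<xi>))\<^sup>2)" for \<xi>
    by (simp add: sum_distrib_right filtered_hat_def norm_mult power_mult_distrib)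
  have int: "integrable lborel (\<lambda>\<xi>. (cmod (filtered_hat a r f \<xi>))\<^sup>2)" for r by (intro L2_integrable filtered_hat_L2 f)
  show "integrable lborel (\<lambda>\<xi>. (\<Sum>r\<in>UNIV. (a r \<xi>)\<^sup>2) * (cmod (fourier_L2 f \<xi>))\<^sup>2)"
    unfolding eq by (intro Bochner_Integration.integrable_sum int)
  show "(\<Sum>r\<in>UNIV. (L2_norm (filtered_hat a r f))\<^sup>2) = (\<integral>\<xi>. (\<Sum>r\<in>UNIV. (a r \<xi>)\<^sup>2) * (cmod (fourier_L2 f \<xi>))\<^sup>2 \<partial>lborel)"
    unfolding eq L2_norm_power2 by (rule Bochner_Integration.integral_sum[symmetric]) (rule int)
qed

lemma sum_squares_le: "(\<Sum>r\<in>UNIV. (a r \<xi>)\<^sup>2) \<le> D" "(\<Sum>r\<in>UNIV. (b r \<xi>)\<^sup>2) \<le> D"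
proof -
  have "(a r \<xi>)\<^sup>2 \<le> B\<^sup>2" "(b r \<xi>)\<^sup>2 \<le> B\<^sup>2" for r using a_le[of r \<xi>] b_le[of r \<xi>] B by (auto simp: abs_le_square_iff[symmetric])
  then show "(\<Sum>r\<in>UNIV. (a r \<xi>)\<^sup>2) \<le> D" "(\<Sum>r\<in>UNIV. (b r \<xi>)\<^sup>2) \<le> D"
    unfolding D_eq by (auto intro!: sum_bounded_above)
qed

lemma D_pos: "D > 0" unfolding D_eq using B by (simp add: card_gt_0_iff)

text \<open>
  The multipliers satisfy \<open>\<Sum>\<^sub>r a\<^sub>r b\<^sub>r = 1\<close>; an upper bound for one system is thus a lower bound for the
  other.
\<close>

lemma sum_squares_ge: "1 / D \<le> (\<Sum>r\<in>UNIV. (a r \<xi>)\<^sup>2)"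
proof -
  have "1 = (\<Sum>r\<in>UNIV. a r \<xi> * b r \<xi>)\<^sup>2" by (simp add: ab)
  also have "\<dots> \<le> (\<Sum>r\<in>UNIV. (a r \<xi>)\<^sup>2) * (\<Sum>r\<in>UNIV. (b r \<xi>)\<^sup>2)" by (rule Cauchy_Schwarz_ineq_sum)
  also have "\<dots> \<le> (\<Sum>r\<in>UNIV. (a r \<xi>)\<^sup>2) * D"
    by (intro mult_left_mono sum_squares_le(2) sum_nonneg) simp
  finally show ?thesis using D_pos by (simp only: pos_divide_le_eq)
qed

lemma energy_bounds:
  assumes f: "f \<in> L2"
  shows "(\<Sum>r\<in>UNIV. (L2_norm (filtered_hat a r f))\<^sup>2) \<le> D * (L2_norm f)\<^sup>2"
    and "1 / D * (L2_norm f)\<^sup>2 \<le> (\<Sum>r\<in>UNIV. (L2_norm (filtered_hat a r f))\<^sup>2)"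
proof -
  have norm: "c * (L2_norm f)\<^sup>2 = (\<integral>\<xi>. c * (cmod (fourier_L2 f \<xi>))\<^sup>2 \<partial>lborel)" for c
    by (simp add: L2_norm_power2[symmetric] L2_norm_fourier_L2[OF f])
  have int: "integrable lborel (\<lambda>\<xi>. c * (cmod (fourier_L2 f \<xi>))\<^sup>2)" for c
    by (intro integrable_mult_right L2_integrable fourier_L2_in_L2 f)
  show "(\<Sum>r\<in>UNIV. (L2_norm (filtered_hat a r f))\<^sup>2) \<le> D * (L2_norm f)\<^sup>2"
    unfolding norm energy_integral(2)[OF f]
    by (intro integral_mono energy_integral(1)[OF f] int mult_right_mono sum_squares_le) simp
  show "1 / D * (L2_norm f)\<^sup>2 \<le> (\<Sum>r\<in>UNIV. (L2_norm (filtered_hat a r f))\<^sup>2)"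
    unfolding norm energy_integral(2)[OF f]
    by (intro integral_mono energy_integral(1)[OF f] int mult_right_mono sum_squares_ge) simp
qed

lemma frame_\<phi>: "frame I L2 \<phi>"
  unfolding frame_def frame_with_bounds_def
proof (intro exI conjI ballI)
  show "0 < 1 / D" using D_pos by simp
  show "1 / D \<le> D" using order_trans[OF sum_squares_ge sum_squares_le(1)] .
  fix f :: "'a \<Rightarrow> complex" assume f: "f \<in> L2"
  show "(\<lambda>i. (cmod (L2_inner f (\<phi> i)))\<^sup>2) summable_on I"
    using energy[OF f] by (auto simp: summable_on_def)
  show "1 / D * (L2_norm f)\<^sup>2 \<le> (\<Sum>\<^sub>\<infinity>i\<in>I. (cmod (L2_inner f (\<phi> i)))\<^sup>2)"
       "(\<Sum>\<^sub>\<infinity>i\<in>I. (cmod (L2_inner f (\<phi> i)))\<^sup>2) \<le> D * (L2_norm f)\<^sup>2"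
    unfolding infsumI[OF energy[OF f]] by (fact energy_bounds[OF f])+
qed (use countable \<phi>_L2 in auto)

text \<open>
  On each part, polarised tightness evaluates the sum as the inner product of \<open>b\<^sub>r f^\<close> and \<open>a\<^sub>r g^\<close>.
  Adding the parts, \<open>\<Sum>\<^sub>r a\<^sub>r b\<^sub>r = 1\<close> leaves the inner product of \<open>f^\<close> and \<open>g^\<close>.
\<close>

lemma weak_reconstruction:
  assumes f: "f \<in> L2" and g: "g \<in> L2"
  shows "((\<lambda>i. L2_inner f (\<psi> i) * cnj (L2_inner g (\<phi> i))) has_sum L2_inner f g) I"
proof -
  let ?F = "\<lambda>r. filtered_hat b r f" and ?G = "\<lambda>r. filtered_hat a r g"
  have "((\<lambda>i. L2_inner f (\<psi> i) * cnj (L2_inner g (\<phi> i))) has_sum L2_inner (?F r) (?G r)) {i \<in> I. reg i = r}" for r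
  proof -
    have "((\<lambda>i. L2_inner (?F r) (e i) * cnj (L2_inner (?G r) (e i))) has_sum L2_inner (?F r) (?G r)) {i \<in> I. reg i = r}"
    proof (rule has_sum_inner_polarized)
      fix c
      show "((\<lambda>i. (cmod (L2_inner (\<lambda>x. ?F r x + c * ?G r x) (e i)))\<^sup>2) has_sum (L2_norm (\<lambda>x. ?F r x + c * ?G r x))\<^sup>2) {i \<in> I. reg i = r}"
      proof (rule tight)
        show "(\<lambda>x. ?F r x + c * ?G r x) \<in> L2" by (intro L2_add L2_scale filtered_hat_L2 f g)
      qed (simp add: filtered_hat_def a_supp b_supp)
    qed (auto intro: e_L2 filtered_hat_L2 f g)
    then show ?thesis
      by (rule has_sum_cong[THEN iffD1, rotated]) (use f g in \<open>auto simp: \<phi>_inner \<psi>_inner filtered_hat_def[abs_def]\<close>)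
  qed
  then have "((\<lambda>i. L2_inner f (\<psi> i) * cnj (L2_inner g (\<phi> i))) has_sum (\<Sum>r\<in>UNIV. L2_inner (?F r) (?G r))) I"
    by (rule has_sum_regions)
  also have "(\<Sum>r\<in>UNIV. L2_inner (?F r) (?G r)) = (\<integral>\<xi>. (\<Sum>r\<in>UNIV. ?F r \<xi> * cnj (?G r \<xi>)) \<partial>lborel)"
    unfolding L2_inner_def
    by (rule Bochner_Integration.integral_sum[symmetric]) (intro L2_inner_integrable filtered_hat_L2 f g)
  also have "\<dots> = L2_inner (fourier_L2 f) (fourier_L2 g)"
    unfolding L2_inner_def
  proof (rule Bochner_Integration.integral_cong[OF refl])
    fix \<xi>
    have "(\<Sum>r\<in>UNIV. ?F r \<xi> * cnj (?G r \<xi>)) = complex_of_real (\<Sum>r\<in>UNIV. a r \<xi> * b r \<xi>) * (fourier_L2 f \<xi> * cnj (fourier_L2 g \<xi>))"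
      unfolding of_real_sum sum_distrib_right by (rule sum.cong) (auto simp: filtered_hat_def mult_ac)
    then show "(\<Sum>r\<in>UNIV. ?F r \<xi> * cnj (?G r \<xi>)) = fourier_L2 f \<xi> * cnj (fourier_L2 g \<xi>)" by (simp add: ab)
  qed
  also have "\<dots> = L2_inner f g"
    by (intro has_fourier_L2_inner has_fourier_L2_fourier_L2 f g)
  finally show ?thesis .
qed

end

sublocale glued_tight_frames \<subseteq> swapped: glued_tight_frames I reg C e b a B D \<psi> \<phi>
  by (rule swapped)

context glued_tight_frames begin

lemma strong_reconstruction:
  assumes f: "f \<in> L2" shows "L2_has_sum (\<lambda>i. L2_inner f (\<psi> i)) \<phi> I f"
proof (rule L2_has_sum_of_dual_Bessel[OF \<phi>_L2 D_pos _ f])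
  show "\<exists>s\<le>D * (L2_norm g)\<^sup>2. ((\<lambda>i. (cmod (L2_inner g (\<phi> i)))\<^sup>2) has_sum s) I" if "g \<in> L2" for g
    using energy[OF that] energy_bounds(1)[OF that] by blast
  show "(\<lambda>i. (cmod (L2_inner f (\<psi> i)))\<^sup>2) summable_on I"
    using swapped.energy[OF f] by (auto simp: summable_on_def)
qed (use weak_reconstruction[OF f] in auto)

end

theorem (in glued_tight_frames) dual_frame_pair_glued: "dual_frame_pair I L2 \<phi> \<psi>"
  unfolding dual_frame_pair_def
  using frame_\<phi> swapped.frame_\<phi> strong_reconstruction
    glued_tight_frames.strong_reconstruction[OF swapped] by blast

lemma dual_frame_pair_reconstructing:
  "dual_frame_pair I H \<phi> \<psi> \<Longrightarrow> \<psi> \<in> reconstructing I H \<phi>"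
  by (auto simp: dual_frame_pair_def reconstructing_def frame_def frame_with_bounds_def)

section \<open>The dual pair of filtered shearlet systems\<close>

text \<open>
  A real multiplier is self-adjoint, so it can be moved from the generator to the analysed function.
  The transform of the generator enters only up to a null set, which allows \<open>e\<close> to be an explicit
  representative.
\<close>

lemma fourier_filter_L2_inner:
  fixes \<phi> e :: "'a::euclidean_space \<Rightarrow> complex"
  assumes m [measurable]: "m \<in> borel_measurable borel" and m_le: "\<And>\<xi>. \<bar>m \<xi>\<bar> \<le> B"
    and \<phi>: "\<phi> \<in> L2" and e: "e \<in> L2" "AE \<xi> in lborel. fourier_L2 \<phi> \<xi> = e \<xi>"
  shows "fourier_filter m \<phi> \<in> L2"
    and "\<And>f. f \<in> L2 \<Longrightarrow> L2_inner f (fourier_filter m \<phi>) = L2_inner (\<lambda>\<xi>. complex_of_real (m \<xi>) * fourier_L2 f \<xi>) e"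
proof -
  let ?F = "\<lambda>\<xi>. complex_of_real (m \<xi>) * fourier_L2 \<phi> \<xi>"
  have mult: "(\<lambda>\<xi>. complex_of_real (m \<xi>) * fourier_L2 f \<xi>) \<in> L2" if "f \<in> L2" for f
    by (rule L2_mult_bounded[where C=B]) (use m_le that in \<open>auto intro: fourier_L2_in_L2\<close>)
  have has: "has_fourier_L2 (fourier_filter m \<phi>) ?F"
    unfolding fourier_filter_def by (rule has_fourier_L2_inv_fourier_L2[OF mult[OF \<phi>]])
  then show "fourier_filter m \<phi> \<in> L2" by (rule has_fourier_L2D)
  fix f :: "'a \<Rightarrow> complex" assume f: "f \<in> L2"
  have "L2_inner f (fourier_filter m \<phi>) = L2_inner (fourier_L2 f) ?F"
    by (rule has_fourier_L2_inner[OF has_fourier_L2_fourier_L2[OF f] has, symmetric])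
  also have "\<dots> = L2_inner (\<lambda>\<xi>. complex_of_real (m \<xi>) * fourier_L2 f \<xi>) (fourier_L2 \<phi>)"
    unfolding L2_inner_def by (rule Bochner_Integration.integral_cong) (auto simp: mult_ac)
  also have "\<dots> = L2_inner (\<lambda>\<xi>. complex_of_real (m \<xi>) * fourier_L2 f \<xi>) e"
    by (rule L2_inner_cong_AE) (use e in \<open>auto intro!: mult[OF f] fourier_L2_in_L2 \<phi>\<close>)
  finally show "L2_inner f (fourier_filter m \<phi>) = L2_inner (\<lambda>\<xi>. complex_of_real (m \<xi>) * fourier_L2 f \<xi>) e" .
qed

lemma parseval_frame_band_tight:
  assumes "parseval_frame I (L2_band K) \<phi>" and G: "G \<in> L2"
    and supp: "AE \<xi> in lborel. \<xi> \<notin> K \<longrightarrow> G \<xi> = 0"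
  shows "((\<lambda>k. (cmod (L2_inner G (fourier_L2 (\<phi> k))))\<^sup>2) has_sum (L2_norm G)\<^sup>2) I"
proof -
  let ?g = "inv_fourier_L2 G"
  have g: "?g \<in> L2" by (rule inv_fourier_L2_in_L2[OF G])
  have band: "?g \<in> L2_band K"
    using g fourier_L2_inv_fourier_L2[OF G] supp unfolding L2_band_def by (auto elim: eventually_elim2)
  then have *: "(\<lambda>i. (cmod (L2_inner ?g (\<phi> i)))\<^sup>2) summable_on I"
      "(\<Sum>\<^sub>\<infinity>i\<in>I. (cmod (L2_inner ?g (\<phi> i)))\<^sup>2) = (L2_norm ?g)\<^sup>2"
    using assms(1) unfolding parseval_frame_def frame_with_bounds_def by (auto intro: order_antisym)
  have "((\<lambda>i. (cmod (L2_inner ?g (\<phi> i)))\<^sup>2) has_sum (L2_norm ?g)\<^sup>2) I"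
    using has_sum_infsum[OF *(1)] unfolding *(2) .
  moreover have "L2_norm ?g = L2_norm G"
    by (rule has_fourier_L2_norm[OF has_fourier_L2_inv_fourier_L2[OF G], symmetric])
  moreover have "L2_inner ?g (\<phi> i) = L2_inner G (fourier_L2 (\<phi> i))" if "i \<in> I" for i
  proof -
    have "\<phi> i \<in> L2" using assms(1) that
      unfolding parseval_frame_def frame_with_bounds_def L2_band_def by blast
    then show ?thesis
      by (intro has_fourier_L2_inner[symmetric] has_fourier_L2_inv_fourier_L2 G has_fourier_L2_fourier_L2)
  qed
  ultimately show ?thesis by (auto elim: has_sum_cong[THEN iffD1, rotated])
qed

fun index_region :: "(nat \<times> int \<times> (int^2) \<times> dir) + int^2 \<Rightarrow> region" where
  "index_region (Inl (j, l, k, \<iota>)) = Cone \<iota>"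
| "index_region (Inr k) = Low"

fun generator_hat :: "real \<Rightarrow> (real \<Rightarrow> complex) \<Rightarrow> (real \<Rightarrow> complex) \<Rightarrow> (int^2 \<Rightarrow> real^2 \<Rightarrow> complex) \<Rightarrow>
    (nat \<times> int \<times> (int^2) \<times> dir) + int^2 \<Rightarrow> real^2 \<Rightarrow> complex" where
  "generator_hat \<alpha> \<Xi> v \<phi>0 (Inl (j, l, k, \<iota>)) = shearlet_hat \<alpha> \<Xi> v \<iota> j l k"
| "generator_hat \<alpha> \<Xi> v \<phi>0 (Inr k) = fourier_L2 (\<phi>0 k)"

instance dir :: finite
proof
  have "(UNIV :: dir set) \<subseteq> {Hor, Ver}"
    by (intro subsetI, rename_tac \<iota>, case_tac \<iota>) simp_all
  then show "finite (UNIV :: dir set)" by (rule finite_subset) simp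
qed

theorem lemma4p3:
  fixes \<alpha> :: real
    and \<Xi> v :: "real \<Rightarrow> complex"
    and \<phi>0 :: "int^2 \<Rightarrow> real^2 \<Rightarrow> complex"
    and \<chi>' \<gamma> :: "region \<Rightarrow> real^2 \<Rightarrow> real"
  assumes "1 \<le> \<alpha>" and "\<alpha> < 2"
    and "radial_generator \<Xi>"
    and "directional_window v"
    and "parseval_frame UNIV (L2_band (\<C> Low)) \<phi>0"
    and "cutoffs \<alpha> \<chi>' \<gamma>"
  shows "dual_frame_pair (system_index \<alpha>) L2
      (shearlet_system \<alpha> \<Xi> v \<phi>0 \<chi>') (shearlet_system \<alpha> \<Xi> v \<phi>0 \<gamma>) \<and>
    shearlet_system \<alpha> \<Xi> v \<phi>0 \<gamma> \<in> reconstructing (system_index \<alpha>) L2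
      (shearlet_system \<alpha> \<Xi> v \<phi>0 \<chi>')"
proof -
  note \<alpha> = assms(2) and gen = assms(3) and dw = assms(4) and low = assms(5) and cut = assms(6)
  let ?e = "generator_hat \<alpha> \<Xi> v \<phi>0"
  let ?sys = "shearlet_system \<alpha> \<Xi> v \<phi>0"
  let ?I = "system_index \<alpha>"
  obtain B where B: "B > 0" "\<And>r \<xi>. \<bar>\<chi>' r \<xi>\<bar> \<le> B" "\<And>r \<xi>. \<bar>\<gamma> r \<xi>\<bar> \<le> B"
    using cutoffs_bounded[OF \<alpha> cut] by blast
  have \<phi>0: "\<phi>0 k \<in> L2" for k
    using low unfolding parseval_frame_def frame_with_bounds_def L2_band_def by blast
  have e_L2: "?e i \<in> L2" for i
    by (cases i rule: index_region.cases) (simp_all add: shearlet_hat_in_L2[OF gen dw] fourier_L2_in_L2 \<phi>0)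
  have meas: "\<chi>' r \<in> borel_measurable borel" "\<gamma> r \<in> borel_measurable borel" for r
  proof -
    have "continuous_on UNIV (partials [] (\<chi>' r))" "continuous_on UNIV (partials [] (\<gamma> r))"
      using cut unfolding cutoffs_def smooth_def by blast+
    then show "\<chi>' r \<in> borel_measurable borel" "\<gamma> r \<in> borel_measurable borel"
      by (simp_all add: borel_measurable_continuous_onI)
  qed
  have supp: "\<chi>' r \<xi> = 0" "\<gamma> r \<xi> = 0" if "\<xi> \<notin> \<C> r" for r \<xi>
    using cut fsupp_zero[OF _ that] unfolding cutoffs_def by blast+
  have sys: "?sys m i \<in> L2"
      "L2_inner f (?sys m i) = L2_inner (\<lambda>\<xi>. complex_of_real (m (index_region i) \<xi>) * fourier_L2 f \<xi>) (?e i)"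
    if m: "\<And>r. m r \<in> borel_measurable borel" "\<And>r \<xi>. \<bar>m r \<xi>\<bar> \<le> B" and f: "f \<in> L2" for m i f
  proof -
    have "?sys m i \<in> L2 \<and>
      L2_inner f (?sys m i) = L2_inner (\<lambda>\<xi>. complex_of_real (m (index_region i) \<xi>) * fourier_L2 f \<xi>) (?e i)"
    proof (cases i rule: index_region.cases)
      case (1 j l k \<iota>)
      have s: "shearlet_hat \<alpha> \<Xi> v \<iota> j l k \<in> L2" by (rule shearlet_hat_in_L2[OF gen dw])
      show ?thesis unfolding 1
        using fourier_filter_L2_inner[OF m inv_fourier_L2_in_L2[OF s] s fourier_L2_inv_fourier_L2[OF s]] f
        by (simp add: shearlet_def)
    next
      case (2 k)
      show ?thesis unfolding 2
        using fourier_filter_L2_inner[OF m \<phi>0 fourier_L2_in_L2[OF \<phi>0] AE_I2[OF refl]] f by simp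
    qed
    then show "?sys m i \<in> L2"
      "L2_inner f (?sys m i) = L2_inner (\<lambda>\<xi>. complex_of_real (m (index_region i) \<xi>) * fourier_L2 f \<xi>) (?e i)"
      by auto
  qed
  have tight: "((\<lambda>i. (cmod (L2_inner G (?e i)))\<^sup>2) has_sum (L2_norm G)\<^sup>2) {i \<in> ?I. index_region i = r}"
    if G: "G \<in> L2" and supp: "AE \<xi> in lborel. \<xi> \<notin> \<C> r \<longrightarrow> G \<xi> = 0" for r G
  proof (cases r)
    case Low
    have "{i \<in> ?I. index_region i = Low} = range Inr"
    proof (intro subset_antisym subsetI)
      fix i assume "i \<in> {i \<in> ?I. index_region i = Low}"
      then show "i \<in> range Inr" by (cases i rule: index_region.cases) auto
    qed (auto simp: system_index_def)
    moreover have "((\<lambda>i. (cmod (L2_inner G (?e i)))\<^sup>2) has_sum (L2_norm G)\<^sup>2) (range Inr)"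
      using parseval_frame_band_tight[OF low G] supp Low
      by (subst has_sum_reindex) (auto simp: o_def)
    ultimately show ?thesis using Low by simp
  next
    case (Cone \<iota>)
    let ?S = "Sigma UNIV (\<lambda>j. {- max_shear \<alpha> j..max_shear \<alpha> j} \<times> (UNIV :: (int^2) set))"
    let ?h = "\<lambda>(j, l, k). Inl (j, l, k, \<iota>) :: (nat \<times> int \<times> (int^2) \<times> dir) + int^2"
    have "{i \<in> ?I. index_region i = Cone \<iota>} = ?h ` ?S"
    proof (intro subset_antisym subsetI)
      fix i assume i: "i \<in> {i \<in> ?I. index_region i = Cone \<iota>}"
      then obtain j l k where "i = Inl (j, l, k, \<iota>)" by (cases i rule: index_region.cases) auto
      with i show "i \<in> ?h ` ?S"
        by (intro image_eqI[of _ _ "(j, l, k)"]) (auto simp: system_index_def \<Delta>_def abs_le_iff)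
    qed (auto simp: system_index_def \<Delta>_def abs_le_iff)
    moreover have "inj_on ?h ?S" by (auto intro!: inj_onI)
    moreover have "(\<lambda>i. (cmod (L2_inner G (?e i)))\<^sup>2) \<circ> ?h =
        (\<lambda>(j, l, k). (cmod (L2_inner G (shearlet_hat \<alpha> \<Xi> v \<iota> j l k)))\<^sup>2)" by (auto simp: fun_eq_iff)
    ultimately show ?thesis
      using shearlets_tight_on_cone[OF \<alpha> gen dw G supp[unfolded Cone]] Cone by (simp add: has_sum_reindex)
  qed
  have unity: "(\<Sum>r\<in>UNIV. \<chi>' r \<xi> * \<gamma> r \<xi>) = 1" for \<xi>
    using cut unfolding cutoffs_def UNIV_region by blast
  interpret glued_tight_frames ?I index_region \<C> ?e \<chi>' \<gamma> B "real CARD(region) * B\<^sup>2" "?sys \<chi>'" "?sys \<gamma>"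
  proof
    show "countable ?I" by (rule countableI_type)
    show "?sys \<chi>' i \<in> L2" "?sys \<gamma> i \<in> L2" for i
      using sys(1)[where m=\<chi>', OF meas(1) B(2) L2_zero] sys(1)[where m=\<gamma>, OF meas(2) B(3) L2_zero] by blast+
  qed (use e_L2 tight meas B supp unity sys(2)[where m=\<chi>', OF meas(1) B(2)] sys(2)[where m=\<gamma>, OF meas(2) B(3)] in blast)+
  show ?thesis
    using dual_frame_pair_glued dual_frame_pair_reconstructing by blast
qed

end
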